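(* Let $d\in\{2,3\}$, let $\Omega\subset\mathbb{R}^d$ be a bounded polyhedral domain covered exactly by a shape-regular partition $\mathcal{T}_h$ into simplices, let $V_h$ be the Crouzeix-Raviart element space and $V_h^c$ the conforming linear element space on $\mathcal{T}_h$. For $\gamma\ge0$ and $1\le i\le\dim V_h$, let $\lambda_{i,h}^{\gamma}$ be the $i$-th eigenvalue (in nondecreasing order, counted with multiplicity) of the penalized Crouzeix-Raviart discrete eigenvalue problem with penalty parameter $\gamma$, and for $1\le i\le\dim V_h^c$ let $\lambda_{i,h}^{P_1}$ be the $i$-th eigenvalue of the conforming linear element discretization. Then, for every $1\le i\le\dim V_h$, $$\lim_{\gamma\to+\infty}\lambda_{i,h}^{\gamma}=\begin{cases}\lambda_{i,h}^{P_1}, & i\le\dim V_h^c,\\ +\infty, & i>\dim V_h^c.\end{cases}$$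
   Context: Continuous problem. Let $a,c$ be bounded measurable real-valued coefficient functions on $\Omega$, let $V=H^1_0(\Omega)$ and $a(u,v)=\int_\Omega (a\nabla u\cdot\nabla v+cuv)\,dx$. This bilinear form is assumed symmetric, bounded and coercive: $|a(u,v)|\le C\|u\|_{1,\Omega}\|v\|_{1,\Omega}$ and $\|v\|_{1,\Omega}^2\le C\,a(v,v)$ for all $u,v\in V$, with a constant $C>0$. The continuous eigenvalue problem is: find $(\lambda,u)\in\mathbb{R}\times V$ with $\|u\|_{0,\Omega}=1$ and $a(u,v)=\lambda(u,v)$ for all $v\in V$, where $(\cdot,\cdot)$ is the $L^2(\Omega)$ inner product; the discrete eigenvalues below are approximations of its eigenvalues $0<\lambda_1\le\lambda_2\le\cdots\nearrow+\infty$. Mesh. $\mathcal{T}_h$ is a shape-regular (conforming) partition into simplices; $\mathcal{E}_h^I$ and $\mathcal{E}_h^b$ are the sets of interior and boundary $(d-1)$-dimensional faces, and $\mathcal{E}_h=\mathcal{E}_h^I\cup\mathcal{E}_h^b$. For an interior face $e=K\cap K'$ ($K,K'\in\mathcal{T}_h$), the jump of a piecewise function $v$ is $[v]|_e=v|_K-v|_{K'}$ if $K$ has the bigger global label, and $[v]|_e=v|_{K'}-v|_K$ otherwise. On a boundary face $e$, $[v]|_e=v|_e$. $|e|$ denotes the $(d-1)$-dimensional measure of $e$. Crouzeix-Raviart space: $V_h=\{v\in L^2(\Omega): v|_K\in P_1(K)\ \forall K\in\mathcal{T}_h,\ \int_e[v]\,ds=0\ \forall e\in\mathcal{E}_h^I,\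 \int_e v\,ds=0\ \forall e\in\mathcal{E}_h^b\}$, where $P_1(K)$ is the space of polynomials of degree at most $1$ on $K$. Conforming linear element space: $V_h^c=\{v\in L^2(\Omega): v|_K\in P_1(K)\ \forall K\in\mathcal{T}_h,\ v\text{ is continuous on interior faces},\ v|_{\partial\Omega}=0\}$. Penalized bilinear form, for $\gamma\ge0$ and $u,v\in V_h$: $$a_h^{\gamma}(u,v)=\sum_{K\in\mathcal{T}_h}\int_K (a\nabla u\cdot\nabla v+cuv)\,dx+\gamma\sum_{e\in\mathcal{E}_h}\frac{1}{|e|^{2-d/2}}\int_e[u][v]\,ds .$$ The penalized Crouzeix-Raviart (PCR) discrete eigenvalue problem is: find $(\lambda_h^\gamma,u_h^\gamma)\in\mathbb{R}\times V_h$ with $\|u_h^\gamma\|_{0,\Omega}=1$ and $a_h^\gamma(u_h^\gamma,v)=\lambda_h^\gamma(u_h^\gamma,v)$ for all $v\in V_h$; its eigenvalues are $\lambda_{1,h}^\gamma\le\lambda_{2,h}^\gamma\le\cdots\le\lambda_{\dim V_h,h}^\gamma$. The conforming linear element discretization is: find $(\lambda_h,u_h)\in\mathbb{R}\times V_h^c$ with $\|u_h\|_{0,\Omega}=1$ and $a(u_h,v)=\lambda_h(u_h,v)$ for all $v\in V_h^c$; its eigenvalues are $\lambda_{1,h}^{P_1}\le\cdots\le\lambda_{\dim V_h^c,h}^{P_1}$. *)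

theory Defs
  imports "HOL-Analysis.Analysis"
begin

section \<open>The spaces L2, H1 and H1-zero\<close>

text \<open>Elements of the function spaces are represented by functions on the whole space; every notion
  below only depends on their values almost everywhere on \<open>\<Omega>\<close>.\<close>

definition L2 :: "'a::euclidean_space set \<Rightarrow> ('a \<Rightarrow> 'b::euclidean_space) set" where
  "L2 \<Omega> = {u. u \<in> borel_measurable (lebesgue_on \<Omega>) \<and> integrable (lebesgue_on \<Omega>) (\<lambda>x. (norm (u x))\<^sup>2)}"

definition L2_inner :: "'a::euclidean_space set \<Rightarrow> ('a \<Rightarrow> real) \<Rightarrow> ('a \<Rightarrow> real) \<Rightarrow> real" where
  "L2_inner \<Omega> u v = (\<integral>x. u x * v x \<partial>lebesgue_on \<Omega>)"

definition L2_norm :: "'a::euclidean_space set \<Rightarrow> ('a \<Rightarrow> real) \<Rightarrow> real" where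
  "L2_norm \<Omega> u = sqrt (L2_inner \<Omega> u u)"

primrec Ck :: "nat \<Rightarrow> ('a::euclidean_space \<Rightarrow> real) \<Rightarrow> bool" where
  "Ck 0 f \<longleftrightarrow> continuous_on UNIV f"
| "Ck (Suc k) f \<longleftrightarrow> (\<forall>x. f differentiable (at x)) \<and>
     (\<forall>b\<in>Basis. Ck k (\<lambda>x. frechet_derivative f (at x) b))"

definition test_functions :: "'a::euclidean_space set \<Rightarrow> ('a \<Rightarrow> real) set" where
  "test_functions \<Omega> = {\<phi>. (\<forall>k. Ck k \<phi>) \<and> compact (closure {x. \<phi> x \<noteq> 0}) \<and> closure {x. \<phi> x \<noteq> 0} \<subseteq> \<Omega>}"

definition is_weak_gradient ::
  "'a::euclidean_space set \<Rightarrow> ('a \<Rightarrow> real) \<Rightarrow> ('a \<Rightarrow> 'a) \<Rightarrow> bool" where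
  "is_weak_gradient \<Omega> u g \<longleftrightarrow>
     (\<forall>\<phi>\<in>test_functions \<Omega>. \<forall>b\<in>Basis.
        (\<integral>x. u x * frechet_derivative \<phi> (at x) b \<partial>lebesgue_on \<Omega>)
        = - (\<integral>x. (g x \<bullet> b) * \<phi> x \<partial>lebesgue_on \<Omega>))"

definition H1 :: "'a::euclidean_space set \<Rightarrow> ('a \<Rightarrow> real) set" where
  "H1 \<Omega> = {u \<in> L2 \<Omega>. \<exists>g\<in>L2 \<Omega>. is_weak_gradient \<Omega> u g}"

text \<open>The weak gradient is unique up to null sets, so the choice below is immaterial under
  integrals.\<close>

definition weak_gradient :: "'a::euclidean_space set \<Rightarrow> ('a \<Rightarrow> real) \<Rightarrow> 'a \<Rightarrow> 'a" where
  "weak_gradient \<Omega> u = (SOME g. g \<in> L2 \<Omega> \<and> is_weak_gradient \<Omega> u g)"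

definition H1_norm :: "'a::euclidean_space set \<Rightarrow> ('a \<Rightarrow> real) \<Rightarrow> real" where
  "H1_norm \<Omega> u = sqrt (\<integral>x. (u x)\<^sup>2 + (norm (weak_gradient \<Omega> u x))\<^sup>2 \<partial>lebesgue_on \<Omega>)"

definition H10 :: "'a::euclidean_space set \<Rightarrow> ('a \<Rightarrow> real) set" where
  "H10 \<Omega> = {u \<in> H1 \<Omega>. \<exists>\<phi>. (\<forall>n::nat. \<phi> n \<in> test_functions \<Omega>) \<and>
      (\<lambda>n. H1_norm \<Omega> (\<lambda>x. u x - \<phi> n x)) \<longlonglongrightarrow> 0}"

definition cont_form ::
  "'a::euclidean_space set \<Rightarrow> ('a \<Rightarrow> real) \<Rightarrow> ('a \<Rightarrow> real) \<Rightarrow> ('a \<Rightarrow> real) \<Rightarrow> ('a \<Rightarrow> real) \<Rightarrow> real" where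
  "cont_form \<Omega> a c u v =
     (\<integral>x. a x * (weak_gradient \<Omega> u x \<bullet> weak_gradient \<Omega> v x) + c x * u x * v x \<partial>lebesgue_on \<Omega>)"


section \<open>Variational eigenvalue problems\<close>

definition eigenpair :: "'a::euclidean_space set \<Rightarrow> ('a \<Rightarrow> real) set \<Rightarrow>
    (('a \<Rightarrow> real) \<Rightarrow> ('a \<Rightarrow> real) \<Rightarrow> real) \<Rightarrow> real \<Rightarrow> ('a \<Rightarrow> real) \<Rightarrow> bool" where
  "eigenpair \<Omega> V B \<mu> u \<longleftrightarrow> u \<in> V \<and> L2_norm \<Omega> u = 1 \<and> (\<forall>v\<in>V. B u v = \<mu> * L2_inner \<Omega> u v)"

definition eigenvalues :: "'a::euclidean_space set \<Rightarrow> ('a \<Rightarrow> real) set \<Rightarrow>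
    (('a \<Rightarrow> real) \<Rightarrow> ('a \<Rightarrow> real) \<Rightarrow> real) \<Rightarrow> real set" where
  "eigenvalues \<Omega> V B = {\<mu>. \<exists>u. eigenpair \<Omega> V B \<mu> u}"

definition eigenspace :: "'a::euclidean_space set \<Rightarrow> ('a \<Rightarrow> real) set \<Rightarrow>
    (('a \<Rightarrow> real) \<Rightarrow> ('a \<Rightarrow> real) \<Rightarrow> real) \<Rightarrow> real \<Rightarrow> ('a \<Rightarrow> real) set" where
  "eigenspace \<Omega> V B \<mu> = {u \<in> V. \<forall>v\<in>V. B u v = \<mu> * L2_inner \<Omega> u v}"

text \<open>Linear independence and dimension are those of the space of classes modulo equality almost
  everywhere on \<open>\<Omega>\<close>.\<close>

definition L2_independent :: "'a::euclidean_space set \<Rightarrow> nat \<Rightarrow> (nat \<Rightarrow> 'a \<Rightarrow> real) \<Rightarrow> bool" where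
  "L2_independent \<Omega> n u \<longleftrightarrow>
     (\<forall>k::nat \<Rightarrow> real. (AE x in lebesgue_on \<Omega>. (\<Sum>i<n. k i * u i x) = 0) \<longrightarrow> (\<forall>i<n. k i = 0))"

definition L2_dim :: "'a::euclidean_space set \<Rightarrow> ('a \<Rightarrow> real) set \<Rightarrow> nat" where
  "L2_dim \<Omega> V = (GREATEST n. \<exists>u. (\<forall>i<n. u i \<in> V) \<and> L2_independent \<Omega> n u)"

definition eigenvalue_list :: "'a::euclidean_space set \<Rightarrow> ('a \<Rightarrow> real) set \<Rightarrow>
    (('a \<Rightarrow> real) \<Rightarrow> ('a \<Rightarrow> real) \<Rightarrow> real) \<Rightarrow> real list" where
  "eigenvalue_list \<Omega> V B =
     concat (map (\<lambda>\<mu>. replicate (L2_dim \<Omega> (eigenspace \<Omega> V B \<mu>)) \<mu>)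
       (sorted_list_of_set (eigenvalues \<Omega> V B)))"

text \<open>The index \<open>i\<close> starts at 1.\<close>

definition nth_eigenvalue :: "'a::euclidean_space set \<Rightarrow> ('a \<Rightarrow> real) set \<Rightarrow>
    (('a \<Rightarrow> real) \<Rightarrow> ('a \<Rightarrow> real) \<Rightarrow> real) \<Rightarrow> nat \<Rightarrow> real" where
  "nth_eigenvalue \<Omega> V B i = eigenvalue_list \<Omega> V B ! (i - 1)"


section \<open>Domain and mesh\<close>

text \<open>The condition \<open>interior (closure \<Omega>) = \<Omega>\<close> excludes cracks, i.e. parts of the boundary with the
  domain on both sides, which the mesh would not see.\<close>

definition polyhedral_domain :: "'a::euclidean_space set \<Rightarrow> bool" where
  "polyhedral_domain \<Omega> \<longleftrightarrow> open \<Omega> \<and> connected \<Omega> \<and> \<Omega> \<noteq> {} \<and> interior (closure \<Omega>) = \<Omega> \<and>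
     (\<exists>\<P>. finite \<P> \<and> (\<forall>P\<in>\<P>. polytope P) \<and> closure \<Omega> = \<Union>\<P>)"

definition simplicial_mesh :: "'a::euclidean_space set \<Rightarrow> 'a set set \<Rightarrow> bool" where
  "simplicial_mesh \<Omega> \<T> \<longleftrightarrow>
     triangulation \<T> \<and> (\<forall>K\<in>\<T>. int DIM('a) simplex K) \<and> \<Union>\<T> = closure \<Omega>"

definition inradius :: "'a::euclidean_space set \<Rightarrow> real" where
  "inradius K = Sup {r. 0 \<le> r \<and> (\<exists>x. cball x r \<subseteq> K)}"

definition shape_regular :: "real \<Rightarrow> 'a::euclidean_space set set \<Rightarrow> bool" where
  "shape_regular \<sigma> \<T> \<longleftrightarrow> (\<forall>K\<in>\<T>. diameter K \<le> \<sigma> * inradius K)"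

definition interior_faces :: "'a::euclidean_space set set \<Rightarrow> 'a set set" where
  "interior_faces \<T> = {e. \<exists>K\<in>\<T>. \<exists>K'\<in>\<T>. K \<noteq> K' \<and> e = K \<inter> K' \<and> e facet_of K \<and> e facet_of K'}"

definition boundary_faces :: "'a::euclidean_space set \<Rightarrow> 'a set set \<Rightarrow> 'a set set" where
  "boundary_faces \<Omega> \<T> = {e. (\<exists>K\<in>\<T>. e facet_of K) \<and> e \<subseteq> frontier \<Omega>}"

definition faces :: "'a::euclidean_space set \<Rightarrow> 'a set set \<Rightarrow> 'a set set" where
  "faces \<Omega> \<T> = interior_faces \<T> \<union> boundary_faces \<Omega> \<T>"


section \<open>Integration over faces\<close>

definition direction_onb :: "'a::euclidean_space set \<Rightarrow> 'a set" where
  "direction_onb H = (SOME B. pairwise orthogonal B \<and> (\<forall>b\<in>B. norm b = 1) \<and>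
     span B = {x - y | x y. x \<in> H \<and> y \<in> H})"

text \<open>Lebesgue measure of the proper dimension on an affine subspace \<open>H\<close>: the image of the product
  Lebesgue measure under orthonormal coordinates. It depends neither on the chosen basis nor on the
  chosen origin.\<close>

definition flat_lebesgue :: "'a::euclidean_space set \<Rightarrow> 'a measure" where
  "flat_lebesgue H =
     distr (\<Pi>\<^sub>M b\<in>direction_onb H. (lborel :: real measure)) borel
       (\<lambda>t. (SOME p. p \<in> H) + (\<Sum>b\<in>direction_onb H. t b *\<^sub>R b))"

definition face_area :: "'a::euclidean_space set \<Rightarrow> real" where
  "face_area e = measure (flat_lebesgue (affine hull e)) e"

definition face_integral :: "'a::euclidean_space set \<Rightarrow> ('a \<Rightarrow> real) \<Rightarrow> real" where
  "face_integral e f = set_lebesgue_integral (flat_lebesgue (affine hull e)) e f"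


section \<open>Piecewise linear functions\<close>

definition P1 :: "('a::euclidean_space \<Rightarrow> real) set" where
  "P1 = {p. \<exists>\<alpha> \<beta>. \<forall>x. p x = \<alpha> + \<beta> \<bullet> x}"

definition piecewise_P1 :: "'a::euclidean_space set \<Rightarrow> 'a set set \<Rightarrow> ('a \<Rightarrow> real) set" where
  "piecewise_P1 \<Omega> \<T> = {v \<in> L2 \<Omega>. \<forall>K\<in>\<T>. \<exists>p\<in>P1. AE x in lebesgue_on K. v x = p x}"

text \<open>The polynomial \<open>v|\<^sub>K\<close>; its values on the faces of \<open>K\<close> are the traces taken from inside \<open>K\<close>.\<close>

definition on_cell :: "('a::euclidean_space \<Rightarrow> real) \<Rightarrow> 'a set \<Rightarrow> 'a \<Rightarrow> real" where
  "on_cell v K = (THE p. p \<in> P1 \<and> (AE x in lebesgue_on K. v x = p x))"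

definition gradient :: "('a::euclidean_space \<Rightarrow> real) \<Rightarrow> 'a \<Rightarrow> 'a" where
  "gradient f x = (THE D. GDERIV f x :> D)"

text \<open>\<open>lab\<close> is the global numbering of the cells; the cells containing an interior face are the two
  cells sharing it, so the jump is the value from the cell with the larger label minus the value
  from the cell with the smaller label.\<close>

definition jump :: "'a::euclidean_space set set \<Rightarrow> ('a set \<Rightarrow> nat) \<Rightarrow> ('a \<Rightarrow> real) \<Rightarrow> 'a set \<Rightarrow> 'a \<Rightarrow> real" where
  "jump \<T> lab v e x =
     (if e \<in> interior_faces \<T>
      then on_cell v (ARG_MAX lab K. K \<in> \<T> \<and> e facet_of K) x
         - on_cell v (ARG_MIN lab K. K \<in> \<T> \<and> e facet_of K) x
      else on_cell v (THE K. K \<in> \<T> \<and> e facet_of K) x)"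

definition CR_space :: "'a::euclidean_space set \<Rightarrow> 'a set set \<Rightarrow> ('a set \<Rightarrow> nat) \<Rightarrow> ('a \<Rightarrow> real) set" where
  "CR_space \<Omega> \<T> lab = {v \<in> piecewise_P1 \<Omega> \<T>.
     (\<forall>e\<in>interior_faces \<T>. face_integral e (jump \<T> lab v e) = 0) \<and>
     (\<forall>e\<in>boundary_faces \<Omega> \<T>. \<forall>K\<in>\<T>. e facet_of K \<longrightarrow> face_integral e (on_cell v K) = 0)}"

text \<open>As for the jumps, the condition \<open>v = 0\<close> on \<open>\<partial>\<Omega>\<close> concerns the trace of a piecewise function,
  which is defined face by face.\<close>

definition P1_space :: "'a::euclidean_space set \<Rightarrow> 'a set set \<Rightarrow> ('a \<Rightarrow> real) set" where
  "P1_space \<Omega> \<T> = {v \<in> piecewise_P1 \<Omega> \<T>.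
     (\<forall>e\<in>interior_faces \<T>. \<forall>K\<in>\<T>. \<forall>K'\<in>\<T>. e facet_of K \<and> e facet_of K' \<longrightarrow>
        (\<forall>x\<in>e. on_cell v K x = on_cell v K' x)) \<and>
     (\<forall>e\<in>boundary_faces \<Omega> \<T>. \<forall>K\<in>\<T>. e facet_of K \<longrightarrow> (\<forall>x\<in>e. on_cell v K x = 0))}"


section \<open>The penalized Crouzeix-Raviart form\<close>

definition PCR_form :: "'a::euclidean_space set \<Rightarrow> 'a set set \<Rightarrow> ('a set \<Rightarrow> nat) \<Rightarrow>
    ('a \<Rightarrow> real) \<Rightarrow> ('a \<Rightarrow> real) \<Rightarrow> real \<Rightarrow> ('a \<Rightarrow> real) \<Rightarrow> ('a \<Rightarrow> real) \<Rightarrow> real" where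
  "PCR_form \<Omega> \<T> lab a c \<gamma> u v =
     (\<Sum>K\<in>\<T>. \<integral>x. a x * (gradient (on_cell u K) x \<bullet> gradient (on_cell v K) x)
                  + c x * u x * v x \<partial>lebesgue_on K)
     + \<gamma> * (\<Sum>e\<in>faces \<Omega> \<T>. 1 / face_area e powr (2 - real DIM('a) / 2)
                  * face_integral e (\<lambda>x. jump \<T> lab u e x * jump \<T> lab v e x))"

end

theory Submission
  imports Defs
begin

text \<open>
  On the Crouzeix-Raviart space \<open>V\<close> the penalized form is \<open>b u v + \<gamma> * s u v\<close>, where \<open>b\<close> is the sum of
  the cell energies and \<open>s\<close> penalizes the jumps. The form \<open>s\<close> is positive semidefinite, its kernel is
  the conforming space \<open>W\<close>, and on \<open>W\<close> the form \<open>b\<close> is the continuous form. Since \<open>V\<close> is finite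
  dimensional, these facts imply the limit (\<open>penalized_eigenvalue_limit\<close>), as follows.

  Write \<open>\<mu> \<gamma> j\<close> for the penalized eigenvalues and \<open>\<nu> j\<close>, \<open>f j\<close> for the eigenvalues and eigenfunctions
  on \<open>W\<close>, with \<open>j\<close> counted from 0. On the span of \<open>f 0, ..., f j\<close> the penalty vanishes, so the min-max
  principle gives \<open>\<mu> \<gamma> j \<le> \<nu> j\<close>. Conversely, consider the unit sphere of the functions in \<open>V\<close> that are
  orthogonal to the \<open>f l\<close> with \<open>l < j\<close> and \<open>l < dim W\<close>. A function on this sphere without penalty
  lies in \<open>W\<close> and satisfies \<open>\<nu> j \<le> b v v\<close>; if \<open>j \<ge> dim W\<close>, there is no such function. As the sphere is
  compact, for every \<open>t < \<nu> j\<close> (for every \<open>t\<close> at all if \<open>j \<ge> dim W\<close>) a large \<open>\<gamma>\<close> makes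
  \<open>b v v + \<gamma> * s v v \<ge> t\<close> on the whole sphere. The span of the first \<open>j + 1\<close> penalized eigenfunctions
  has a dimension larger than the number of orthogonality conditions, so it meets the sphere, and
  \<open>\<mu> \<gamma> j \<ge> t\<close>.

  The kernel of the penalty (\<open>penalty_zero_iff\<close>) is found face by face. An affine jump whose square
  has zero integral over a face vanishes there, because the face measure is positive on relatively
  open sets. It remains to see that every face belongs to exactly two cells or, on the boundary, to
  exactly one: near a relative interior point of a facet, a cell fills one of the two half balls cut
  out by the hyperplane of the facet.

  On \<open>W\<close> the forms agree (\<open>cont_form_eq\<close>) because the gradient computed cell by cell is a weak
  gradient, and weak gradients are unique up to null sets. For the former, let \<open>\<phi>\<close> be a test
  function and fix a coordinate direction. The difference quotients of \<open>u * \<phi>\<close> in this direction have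
  integral 0 by translation invariance, and by dominated convergence the piecewise derivative, their
  limit, has integral 0 as well. The bound comes from the lines in the given direction that miss all
  faces of dimension at most \<open>d - 2\<close>: almost all lines do, and along such a line \<open>u * \<phi>\<close> passes from
  cell to cell only through facets, where \<open>u\<close> is continuous, so it is Lipschitz. Uniqueness is the
  fundamental lemma of the calculus of variations, tested with smooth bumps that increase to
  indicator functions of boxes.
\<close>

section \<open>Forms on finite-dimensional spaces of functions\<close>

text \<open>The only fact of linear algebra behind all dimension counts below; the proof eliminates one
  unknown and one equation.\<close>

lemma underdetermined_system_has_nonzero_solution:
  fixes A :: "'i \<Rightarrow> 'j \<Rightarrow> real"
  assumes "finite I" "finite J" "card I < card J"
  shows "\<exists>c. (\<exists>j\<in>J. c j \<noteq> 0) \<and> (\<forall>i\<in>I. (\<Sum>j\<in>J. A i j * c j) = 0)"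
  using assms
proof (induction I arbitrary: J A rule: finite_induct)
  case empty
  then have "J \<noteq> {}" by auto
  then show ?case by (intro exI[of _ "\<lambda>_. 1"]) auto
next
  case (insert i I)
  show ?case
  proof (cases "\<exists>j0\<in>J. A i j0 \<noteq> 0")
    case False
    have "card I < card J" using insert by simp
    from insert.IH[OF insert.prems(1) this, of A]
    obtain c where "\<exists>j\<in>J. c j \<noteq> 0" "\<forall>i\<in>I. (\<Sum>j\<in>J. A i j * c j) = 0" by blast
    moreover have "(\<Sum>j\<in>J. A i j * c j) = 0" using False by (intro sum.neutral) auto
    ultimately show ?thesis by auto
  next
    case True
    then obtain j0 where j0: "j0 \<in> J" "A i j0 \<noteq> 0" by blast
    let ?J = "J - {j0}"
    \<comment> \<open>Equation \<open>i\<close>, solved for the unknown \<open>j0\<close>, is substituted into the other equations.\<close>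
    let ?A = "\<lambda>k j. A k j - A k j0 / A i j0 * A i j"
    have "finite ?J" "card I < card ?J" using insert j0 by auto
    from insert.IH[OF this, of ?A]
    obtain c where c: "\<exists>j\<in>?J. c j \<noteq> 0" "\<forall>k\<in>I. (\<Sum>j\<in>?J. ?A k j * c j) = 0" by blast
    define d where "d = c(j0 := - (\<Sum>j\<in>?J. A i j * c j) / A i j0)"
    have sumd: "(\<Sum>j\<in>J. A k j * d j) = A k j0 * d j0 + (\<Sum>j\<in>?J. A k j * c j)" for k
      by (subst sum.remove[OF insert.prems(1) j0(1)]) (auto simp: d_def intro!: sum.cong)
    have "(\<Sum>j\<in>J. A k j * d j) = 0" if "k \<in> I" for k
    proof -
      have "(\<Sum>j\<in>?J. A k j * c j) - A k j0 / A i j0 * (\<Sum>j\<in>?J. A i j * c j) = 0"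
        using c(2)[rule_format, OF that]
        by (simp add: sum_subtractf sum_distrib_left algebra_simps)
      then show ?thesis unfolding sumd by (simp add: d_def)
    qed
    moreover have "(\<Sum>j\<in>J. A i j * d j) = 0" unfolding sumd using j0 by (simp add: d_def)
    moreover have "\<exists>j\<in>J. d j \<noteq> 0" using c(1) by (auto simp: d_def)
    ultimately show ?thesis by blast
  qed
qed

text \<open>Linear combinations are written out pointwise, as in the notion of linear independence modulo
  null sets.\<close>

definition comb :: "(nat \<Rightarrow> real) \<Rightarrow> (nat \<Rightarrow> 'a \<Rightarrow> real) \<Rightarrow> nat \<Rightarrow> 'a \<Rightarrow> real" where
  "comb c f n = (\<lambda>x. \<Sum>i<n. c i * f i x)"

text \<open>A linear subspace of \<open>L2\<close>, not divided by the functions that vanish almost everywhere. The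
  \<open>L2\<close> inner product is therefore only positive semidefinite on it.\<close>

locale L2_subspace =
  fixes \<Omega> :: "'a::euclidean_space set" and V :: "('a \<Rightarrow> real) set"
  assumes sub: "V \<subseteq> L2 \<Omega>" and zero: "(\<lambda>x. 0) \<in> V"
    and lin: "\<And>u v \<alpha> \<beta>. u \<in> V \<Longrightarrow> v \<in> V \<Longrightarrow> (\<lambda>x. \<alpha> * u x + \<beta> * v x) \<in> V"
begin

abbreviation ip where "ip \<equiv> L2_inner \<Omega>"

text \<open>The last condition says that a form is well defined modulo null sets: it cannot see a function
  of norm 0.\<close>

definition form :: "(('a \<Rightarrow> real) \<Rightarrow> ('a \<Rightarrow> real) \<Rightarrow> real) \<Rightarrow> bool" where
  "form B \<longleftrightarrow> (\<forall>u\<in>V. \<forall>v\<in>V. B u v = B v u) \<and>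
     (\<forall>u\<in>V. \<forall>v\<in>V. \<forall>w\<in>V. \<forall>\<alpha> \<beta>. B (\<lambda>x. \<alpha> * u x + \<beta> * v x) w = \<alpha> * B u w + \<beta> * B v w) \<and>
     (\<forall>u\<in>V. \<forall>w\<in>V. ip u u = 0 \<longrightarrow> B u w = 0)"

lemma form_sym: "form B \<Longrightarrow> u \<in> V \<Longrightarrow> v \<in> V \<Longrightarrow> B u v = B v u"
  and form_lin: "form B \<Longrightarrow> u \<in> V \<Longrightarrow> v \<in> V \<Longrightarrow> w \<in> V \<Longrightarrow>
    B (\<lambda>x. \<alpha> * u x + \<beta> * v x) w = \<alpha> * B u w + \<beta> * B v w"
  and form_null: "form B \<Longrightarrow> u \<in> V \<Longrightarrow> w \<in> V \<Longrightarrow> ip u u = 0 \<Longrightarrow> B u w = 0"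
  unfolding form_def by blast+

lemma form_lin_right:
  assumes "form B" "u \<in> V" "v \<in> V" "w \<in> V"
  shows "B w (\<lambda>x. \<alpha> * u x + \<beta> * v x) = \<alpha> * B w u + \<beta> * B w v"
proof -
  have "B w (\<lambda>x. \<alpha> * u x + \<beta> * v x) = B (\<lambda>x. \<alpha> * u x + \<beta> * v x) w"
    using assms by (intro form_sym lin)
  also have "\<dots> = \<alpha> * B u w + \<beta> * B v w" using assms by (rule form_lin)
  also have "\<dots> = \<alpha> * B w u + \<beta> * B w v" using assms by (simp add: form_sym[of B w])
  finally show ?thesis .
qed

lemma product_integrable:
  assumes "u \<in> V" "v \<in> V" shows "integrable (lebesgue_on \<Omega>) (\<lambda>x. u x * v x)"
proof (rule Bochner_Integration.integrable_bound)
  have u: "u \<in> borel_measurable (lebesgue_on \<Omega>)" "integrable (lebesgue_on \<Omega>) (\<lambda>x. (u x)\<^sup>2)"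
    and v: "v \<in> borel_measurable (lebesgue_on \<Omega>)" "integrable (lebesgue_on \<Omega>) (\<lambda>x. (v x)\<^sup>2)"
    using assms sub by (auto simp: L2_def)
  show "integrable (lebesgue_on \<Omega>) (\<lambda>x. (u x)\<^sup>2 + (v x)\<^sup>2)" using u v by simp
  show "(\<lambda>x. u x * v x) \<in> borel_measurable (lebesgue_on \<Omega>)" using u v by simp
  have "\<bar>s * t\<bar> \<le> s\<^sup>2 + t\<^sup>2" for s t :: real
  proof -
    have "2 * (\<bar>s\<bar> * \<bar>t\<bar>) \<le> \<bar>s\<bar>\<^sup>2 + \<bar>t\<bar>\<^sup>2"
      using sum_squares_bound[of "\<bar>s\<bar>" "\<bar>t\<bar>"] by simp
    moreover have "0 \<le> \<bar>s\<bar> * \<bar>t\<bar>" by simp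
    ultimately show ?thesis unfolding abs_mult power2_abs by linarith
  qed
  then show "AE x in lebesgue_on \<Omega>. norm (u x * v x) \<le> norm ((u x)\<^sup>2 + (v x)\<^sup>2)"
    by (intro AE_I2) (simp add: order_trans[OF _ abs_ge_self])
qed

lemma ip_nonneg: "0 \<le> ip u u"
  by (simp add: L2_inner_def)

lemma ip_zero_iff:
  assumes "u \<in> V" shows "ip u u = 0 \<longleftrightarrow> (AE x in lebesgue_on \<Omega>. u x = 0)"
proof -
  have "(ip u u = 0) \<longleftrightarrow> (AE x in lebesgue_on \<Omega>. u x * u x = 0)"
    unfolding L2_inner_def
    by (intro integral_nonneg_eq_0_iff_AE product_integrable assms) auto
  then show ?thesis by simp
qed

lemma form_ip: "form ip"
  unfolding form_def
proof (intro conjI ballI allI impI)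
  fix u v assume "u \<in> V" "v \<in> V"
  show "ip u v = ip v u" by (simp add: L2_inner_def mult.commute)
next
  fix u v w \<alpha> \<beta> assume V: "u \<in> V" "v \<in> V" "w \<in> V"
  have "ip (\<lambda>x. \<alpha> * u x + \<beta> * v x) w = (\<integral>x. \<alpha> * (u x * w x) + \<beta> * (v x * w x) \<partial>lebesgue_on \<Omega>)"
    by (simp add: L2_inner_def algebra_simps)
  also have "\<dots> = \<alpha> * ip u w + \<beta> * ip v w"
    unfolding L2_inner_def using V product_integrable by (subst Bochner_Integration.integral_add) auto
  finally show "ip (\<lambda>x. \<alpha> * u x + \<beta> * v x) w = \<alpha> * ip u w + \<beta> * ip v w" .
next
  fix u w assume V: "u \<in> V" "w \<in> V" and "ip u u = 0"
  then have "AE x in lebesgue_on \<Omega>. u x = 0" by (simp add: ip_zero_iff)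
  then have "AE x in lebesgue_on \<Omega>. u x * w x = 0" by eventually_elim simp
  then show "ip u w = 0" unfolding L2_inner_def by (rule integral_eq_zero_AE)
qed

lemma comb_in: "(\<And>i. i < n \<Longrightarrow> f i \<in> V) \<Longrightarrow> comb c f n \<in> V"
proof (induction n)
  case 0 then show ?case by (simp add: comb_def zero)
next
  case (Suc n)
  have "comb c f (Suc n) = (\<lambda>x. 1 * comb c f n x + c n * f n x)" by (auto simp: comb_def)
  moreover have "(\<lambda>x. 1 * comb c f n x + c n * f n x) \<in> V"
    using Suc by (intro lin) auto
  ultimately show ?case by simp
qed

lemma form_zero: "form B \<Longrightarrow> w \<in> V \<Longrightarrow> B (\<lambda>x. 0) w = 0"
  using form_lin[of B "\<lambda>x. 0" "\<lambda>x. 0" w 0 0, OF _ zero zero] by auto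

lemma functional_comb:
  assumes F: "\<And>u v \<alpha> \<beta>. u \<in> V \<Longrightarrow> v \<in> V \<Longrightarrow> F (\<lambda>x. \<alpha> * u x + \<beta> * v x) = \<alpha> * F u + \<beta> * F v"
    and f: "\<And>i. i < n \<Longrightarrow> f i \<in> V"
  shows "F (comb c f n) = (\<Sum>i<n. c i * (F (f i) :: real))"
  using f
proof (induction n)
  case 0 then show ?case using F[OF zero zero, of 0 0] by (simp add: comb_def)
next
  case (Suc n)
  have "comb c f (Suc n) = (\<lambda>x. 1 * comb c f n x + c n * f n x)" by (auto simp: comb_def)
  then have "F (comb c f (Suc n)) = 1 * F (comb c f n) + c n * F (f n)"
    using F[of "comb c f n" "f n" 1 "c n"] Suc.prems comb_in[of n f c] by simp
  then show ?case using Suc by simp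
qed

lemma form_comb: "form B \<Longrightarrow> (\<And>i. i < n \<Longrightarrow> f i \<in> V) \<Longrightarrow> w \<in> V \<Longrightarrow>
  B (comb c f n) w = (\<Sum>i<n. c i * B (f i) w)"
  by (rule functional_comb[where F = "\<lambda>u. B u w"]) (rule form_lin)

lemma form_comb_comb:
  assumes B: "form B" and f: "\<And>i. i < n \<Longrightarrow> f i \<in> V"
  shows "B (comb c f n) (comb c f n) = (\<Sum>i<n. \<Sum>j<n. c i * c j * B (f i) (f j))"
proof -
  have V: "comb c f n \<in> V" using f by (rule comb_in)
  have term_eq: "c i * B (f i) (comb c f n) = (\<Sum>j<n. c i * c j * B (f i) (f j))" if i: "i < n" for i
  proof -
    have "B (f i) (comb c f n) = B (comb c f n) (f i)" by (rule form_sym[OF B f[OF i] V])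
    also have "\<dots> = (\<Sum>j<n. c j * B (f j) (f i))" by (rule form_comb[OF B f f[OF i]])
    also have "\<dots> = (\<Sum>j<n. c j * B (f i) (f j))"
      using form_sym[OF B f[OF i] f] by (intro sum.cong) auto
    finally show ?thesis by (simp add: sum_distrib_left mult.assoc)
  qed
  have "B (comb c f n) (comb c f n) = (\<Sum>i<n. c i * B (f i) (comb c f n))" by (rule form_comb[OF B f V])
  also have "\<dots> = (\<Sum>i<n. \<Sum>j<n. c i * c j * B (f i) (f j))"
    by (intro sum.cong refl term_eq) simp
  finally show ?thesis .
qed

definition orthonormal :: "nat \<Rightarrow> (nat \<Rightarrow> 'a \<Rightarrow> real) \<Rightarrow> bool" where
  "orthonormal n e \<longleftrightarrow> (\<forall>i<n. e i \<in> V) \<and> (\<forall>i<n. \<forall>j<n. ip (e i) (e j) = of_bool (i = j))"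

text \<open>Completeness is stated as maximality: nothing of positive norm is orthogonal to the family. Modulo
  null sets such a family spans the space (\<open>onb_null\<close>, \<open>form_expand\<close>).\<close>

definition onb :: "nat \<Rightarrow> (nat \<Rightarrow> 'a \<Rightarrow> real) \<Rightarrow> bool" where
  "onb n e \<longleftrightarrow> orthonormal n e \<and> (\<forall>v\<in>V. (\<forall>i<n. ip v (e i) = 0) \<longrightarrow> ip v v = 0)"

lemma orthonormal_in: "orthonormal n e \<Longrightarrow> i < n \<Longrightarrow> e i \<in> V"
  by (simp add: orthonormal_def)

lemma onb_orthonormal: "onb n e \<Longrightarrow> orthonormal n e"
  by (simp add: onb_def)

lemma orthonormal_coefficient:
  assumes "orthonormal n e" "j < n" shows "ip (comb c e n) (e j) = c j"
proof -
  have "ip (comb c e n) (e j) = (\<Sum>i<n. c i * ip (e i) (e j))"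
    using assms by (intro form_comb form_ip) (auto simp: orthonormal_in)
  also have "\<dots> = (\<Sum>i<n. if i = j then c i else 0)"
    using assms by (intro sum.cong) (auto simp: orthonormal_def)
  finally show ?thesis using assms by simp
qed

lemma orthonormal_norm:
  assumes "orthonormal n e" shows "ip (comb c e n) (comb c e n) = (\<Sum>i<n. (c i)\<^sup>2)"
proof -
  have "ip (comb c e n) (comb c e n) = (\<Sum>i<n. c i * ip (e i) (comb c e n))"
    using assms by (intro form_comb form_ip) (auto simp: orthonormal_in comb_in)
  also have "\<dots> = (\<Sum>i<n. c i * c i)"
    using assms by (intro sum.cong) (auto simp: orthonormal_coefficient orthonormal_in comb_in
       form_sym[OF form_ip, of "e _" "comb c e n"])
  finally show ?thesis by (simp add: power2_eq_square)
qed

lemma form_diff: "form B \<Longrightarrow> u \<in> V \<Longrightarrow> v \<in> V \<Longrightarrow> w \<in> V \<Longrightarrow> B (\<lambda>x. u x - v x) w = B u w - B v w"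
  and diff_in: "u \<in> V \<Longrightarrow> v \<in> V \<Longrightarrow> (\<lambda>x. u x - v x) \<in> V"
  using form_lin[of B u v w 1 "-1"] lin[of u v 1 "-1"] by auto

lemma scale_in: "u \<in> V \<Longrightarrow> (\<lambda>x. \<alpha> * u x) \<in> V"
  and form_scale: "form B \<Longrightarrow> u \<in> V \<Longrightarrow> w \<in> V \<Longrightarrow> B (\<lambda>x. \<alpha> * u x) w = \<alpha> * B u w"
  using lin[of u u \<alpha> 0] form_lin[of B u u w \<alpha> 0] by auto

lemma form_scale_scale: "form B \<Longrightarrow> u \<in> V \<Longrightarrow> B (\<lambda>x. \<alpha> * u x) (\<lambda>x. \<alpha> * u x) = \<alpha>\<^sup>2 * B u u"
  using form_scale[of B u "\<lambda>x. \<alpha> * u x" \<alpha>] form_scale[of B u u \<alpha>] form_sym[of B u "\<lambda>x. \<alpha> * u x"]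
    scale_in[of u \<alpha>] by (simp add: power2_eq_square)

lemma form_null_diff:
  assumes "form B" "u \<in> V" "v \<in> V" "w \<in> V" "ip (\<lambda>x. u x - v x) (\<lambda>x. u x - v x) = 0"
  shows "B u w = B v w"
  using form_null[OF assms(1) diff_in[OF assms(2,3)] assms(4,5)] form_diff[OF assms(1-4)] by simp

lemma onb_null:
  assumes "onb n e" "v \<in> V"
  defines "r \<equiv> (\<lambda>x. v x - comb (\<lambda>i. ip v (e i)) e n x)"
  shows "ip r r = 0"
proof -
  have on: "orthonormal n e" using assms(1) onb_orthonormal by simp
  have V: "comb (\<lambda>i. ip v (e i)) e n \<in> V" using on by (intro comb_in) (simp add: orthonormal_in)
  have "r \<in> V" unfolding r_def using assms V by (intro diff_in)
  moreover have "ip r (e i) = 0" if "i < n" for i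
    unfolding r_def using assms(2) V that on
    by (subst form_diff[OF form_ip]) (auto simp: orthonormal_in orthonormal_coefficient)
  ultimately show ?thesis using assms(1) by (simp add: onb_def)
qed

lemma form_expand:
  assumes "onb n e" "form B" "v \<in> V" "w \<in> V"
  shows "B v w = (\<Sum>i<n. ip v (e i) * B (e i) w)"
proof -
  have on: "orthonormal n e" using assms(1) onb_orthonormal by simp
  have V: "comb (\<lambda>i. ip v (e i)) e n \<in> V" using on by (intro comb_in) (simp add: orthonormal_in)
  have "B v w = B (comb (\<lambda>i. ip v (e i)) e n) w"
    by (rule form_null_diff[OF assms(2,3) V assms(4) onb_null[OF assms(1,3)]])
  then show ?thesis using assms on by (simp add: form_comb orthonormal_in)
qed

text \<open>The dimension count of the min-max principle: \<open>k\<close> linear conditions leave a unit vector in a span of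
  dimension \<open>n > k\<close>.\<close>

lemma orthonormal_span_meets_orthogonal_complement:
  assumes on: "orthonormal n e" and "k < n" and f: "\<And>j. j < k \<Longrightarrow> f j \<in> V"
  shows "\<exists>c. ip (comb c e n) (comb c e n) = 1 \<and> (\<forall>j<k. ip (comb c e n) (f j) = 0)"
proof -
  obtain c where c: "\<exists>i<n. c i \<noteq> 0" "\<forall>j<k. (\<Sum>i<n. ip (e i) (f j) * c i) = 0"
    using underdetermined_system_has_nonzero_solution[of "{..<k}" "{..<n}" "\<lambda>j i. ip (e i) (f j)"]
      \<open>k < n\<close> by auto
  define s where "s = (\<Sum>i<n. (c i)\<^sup>2)"
  have s: "s > 0"
  proof -
    obtain i where "i < n" "c i \<noteq> 0" using c by blast
    then have "0 < (c i)\<^sup>2" "(c i)\<^sup>2 \<le> s"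
      unfolding s_def by (auto intro!: member_le_sum[of i "{..<n}" "\<lambda>i. (c i)\<^sup>2"])
    then show ?thesis by linarith
  qed
  define d where "d i = c i / sqrt s" for i
  have "ip (comb d e n) (comb d e n) = 1"
    unfolding orthonormal_norm[OF on] using s
    by (simp add: d_def power_divide flip: sum_divide_distrib) (simp add: s_def)
  moreover have "ip (comb d e n) (f j) = 0" if "j < k" for j
  proof -
    have "ip (comb d e n) (f j) = (\<Sum>i<n. d i * ip (e i) (f j))"
      using that on f by (intro form_comb form_ip) (auto simp: orthonormal_in)
    also have "\<dots> = (\<Sum>i<n. ip (e i) (f j) * c i) / sqrt s"
      by (simp add: d_def sum_divide_distrib mult.commute)
    finally show ?thesis using c that by simp
  qed
  ultimately show ?thesis by blast
qed

lemma orthonormal_le_onb: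
  assumes "onb n e" "orthonormal m f" shows "m \<le> n"
proof (rule ccontr)
  assume "\<not> m \<le> n"
  then have "n < m" by simp
  from orthonormal_span_meets_orthogonal_complement[OF assms(2) this, of e]
  obtain c where c: "ip (comb c f m) (comb c f m) = 1" "\<forall>j<n. ip (comb c f m) (e j) = 0"
    using assms(1) onb_orthonormal orthonormal_in by blast
  moreover have "comb c f m \<in> V" using assms by (simp add: comb_in orthonormal_in)
  ultimately show False using assms(1) by (auto simp: onb_def)
qed

lemma orthonormal_extend:
  assumes on: "orthonormal n f" and v: "v \<in> V" "ip v v = 1" "\<And>i. i < n \<Longrightarrow> ip v (f i) = 0"
  shows "orthonormal (Suc n) (f(n := v))"
  unfolding orthonormal_def
proof (intro conjI allI impI)
  fix i assume "i < Suc n" then show "(f(n := v)) i \<in> V"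
    using on v by (auto simp: orthonormal_in)
next
  fix i j assume "i < Suc n" "j < Suc n"
  then show "ip ((f(n := v)) i) ((f(n := v)) j) = of_bool (i = j)"
    using on v form_sym[OF form_ip v(1), of "f i"] by (auto simp: orthonormal_def less_Suc_eq)
qed

lemma normalize:
  assumes "v \<in> V" "ip v v \<noteq> 0"
  obtains \<alpha> where "\<alpha> \<noteq> 0" "(\<lambda>x. \<alpha> * v x) \<in> V" "ip (\<lambda>x. \<alpha> * v x) (\<lambda>x. \<alpha> * v x) = 1"
proof
  let ?a = "1 / sqrt (ip v v)"
  show "?a \<noteq> 0" using assms by simp
  show "(\<lambda>x. ?a * v x) \<in> V" using assms scale_in by blast
  show "ip (\<lambda>x. ?a * v x) (\<lambda>x. ?a * v x) = 1"
    using form_scale_scale[OF form_ip assms(1), of ?a] assms ip_nonneg[of v]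
    by (simp add: power_divide)
qed

lemma onb_or_extend:
  assumes on: "orthonormal n f" and "\<not> onb n f"
  shows "\<exists>v\<in>V. ip v v = 1 \<and> (\<forall>i<n. ip v (f i) = 0)"
proof -
  obtain v where v: "v \<in> V" "\<forall>i<n. ip v (f i) = 0" "ip v v \<noteq> 0"
    using assms by (auto simp: onb_def)
  obtain \<alpha> where \<alpha>: "\<alpha> \<noteq> 0" "(\<lambda>x. \<alpha> * v x) \<in> V" "ip (\<lambda>x. \<alpha> * v x) (\<lambda>x. \<alpha> * v x) = 1"
    using normalize v by blast
  then show ?thesis using v on form_scale[OF form_ip v(1)]
    by (intro bexI[of _ "\<lambda>x. \<alpha> * v x"]) (auto simp: orthonormal_in)
qed

lemma onb_of_card:
  assumes "onb n e" "orthonormal n f" shows "onb n f"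
proof (rule ccontr)
  assume "\<not> onb n f"
  then obtain v where "orthonormal (Suc n) (f(n := v))"
    using onb_or_extend[OF assms(2)] orthonormal_extend[OF assms(2)] by blast
  then show False using orthonormal_le_onb[OF assms(1)] by fastforce
qed

text \<open>A longest orthonormal family is complete, since a function of positive norm orthogonal to it
  could be normalized and appended.\<close>

lemma onb_exists:
  assumes "\<And>m f. orthonormal m f \<Longrightarrow> m \<le> D"
  shows "\<exists>n e. onb n e"
proof -
  let ?n = "GREATEST n. \<exists>f. orthonormal n f"
  have 0: "\<exists>f. orthonormal 0 f" by (simp add: orthonormal_def)
  obtain f where f: "orthonormal ?n f"
    using GreatestI_nat[of "\<lambda>n. \<exists>f. orthonormal n f" 0 D] 0 assms by blast
  have "onb ?n f"
  proof (rule ccontr)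
    assume "\<not> onb ?n f"
    then obtain v where "orthonormal (Suc ?n) (f(?n := v))"
      using onb_or_extend[OF f] orthonormal_extend[OF f] by blast
    then have "Suc ?n \<le> ?n"
      using Greatest_le_nat[of "\<lambda>n. \<exists>f. orthonormal n f" "Suc ?n" D] assms by blast
    then show False by simp
  qed
  then show ?thesis by blast
qed

lemma L2_independent_iff:
  assumes "\<And>i. i < n \<Longrightarrow> f i \<in> V"
  shows "L2_independent \<Omega> n f \<longleftrightarrow> (\<forall>c. ip (comb c f n) (comb c f n) = 0 \<longrightarrow> (\<forall>i<n. c i = 0))"
  unfolding L2_independent_def using ip_zero_iff[OF comb_in[of n f]] assms by (simp add: comb_def)

lemma L2_dim_onb:
  assumes "onb n e" shows "L2_dim \<Omega> V = n"
  unfolding L2_dim_def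
proof (rule Greatest_equality)
  have on: "orthonormal n e" using assms onb_orthonormal by simp
  have "L2_independent \<Omega> n e"
    using on by (subst L2_independent_iff) (auto simp: orthonormal_in orthonormal_norm sum_nonneg_eq_0_iff)
  then show "\<exists>u. (\<forall>i<n. u i \<in> V) \<and> L2_independent \<Omega> n u"
    using on orthonormal_in by blast
  fix m assume "\<exists>u. (\<forall>i<m. u i \<in> V) \<and> L2_independent \<Omega> m u"
  then obtain u where u: "\<And>i. i < m \<Longrightarrow> u i \<in> V" "L2_independent \<Omega> m u" by blast
  show "m \<le> n"
  proof (rule ccontr)
    assume "\<not> m \<le> n"
    then obtain c where c: "\<exists>i<m. c i \<noteq> 0" "\<forall>j<n. (\<Sum>i<m. ip (u i) (e j) * c i) = 0"
      using underdetermined_system_has_nonzero_solution[of "{..<n}" "{..<m}" "\<lambda>j i. ip (u i) (e j)"]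
      by auto
    have "ip (comb c u m) (e j) = 0" if "j < n" for j
      using form_comb[where f = u, OF form_ip u(1) orthonormal_in[OF on that], of m c] c that
      by (simp add: mult.commute)
    then have "ip (comb c u m) (comb c u m) = 0"
      using assms u comb_in by (auto simp: onb_def)
    then show False using u c L2_independent_iff by blast
  qed
qed

end

section \<open>The spectral theorem\<close>

context L2_subspace begin

definition unit_orth :: "nat \<Rightarrow> (nat \<Rightarrow> 'a \<Rightarrow> real) \<Rightarrow> ('a \<Rightarrow> real) set" where
  "unit_orth k f = {v \<in> V. ip v v = 1 \<and> (\<forall>j<k. ip v (f j) = 0)}"

text \<open>Compactness without a topology on the function space: in coordinates with respect to an
  orthonormal basis, the unit sphere of an orthogonal complement is a closed subset of a cube in
  \<open>nat \<Rightarrow> real\<close>, and quadratic forms become polynomials. Only the values of forms are transported,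
  because a function agrees with its expansion only almost everywhere.\<close>

lemma unit_orth_compact:
  assumes onb: "onb n e" and f: "\<And>j. j < k \<Longrightarrow> f j \<in> V"
  obtains Z :: "(nat \<Rightarrow> real) set" where "compact Z"
    "\<And>c. c \<in> Z \<Longrightarrow> comb c e n \<in> unit_orth k f"
    "\<And>v. v \<in> unit_orth k f \<Longrightarrow> \<exists>c\<in>Z. \<forall>B. form B \<longrightarrow> B v v = B (comb c e n) (comb c e n)"
    "\<And>B. form B \<Longrightarrow> continuous_on Z (\<lambda>c. B (comb c e n) (comb c e n))"
proof -
  have on: "orthonormal n e" using onb onb_orthonormal by simp
  have eV: "\<And>i. i < n \<Longrightarrow> e i \<in> V" using on orthonormal_in by simp
  define P where "P = (\<Pi>\<^sub>E i\<in>UNIV. if i < n then {-1..1} else {0::real})"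
  define Z where "Z = P \<inter> {c. (\<Sum>i<n. (c i)\<^sup>2) = 1} \<inter> (\<Inter>j\<in>{..<k}. {c. (\<Sum>i<n. c i * ip (e i) (f j)) = 0})"
  have cont: "continuous_on S (\<lambda>c::nat \<Rightarrow> real. c i)" for S i
    by (rule continuous_on_subset[OF continuous_on_product_coordinates]) auto
  have "compact P"
    unfolding P_def compactin_euclidean_iff[symmetric] euclidean_product_topology[symmetric]
    by (simp only: compactin_PiE) (auto simp: compactin_euclidean_iff)
  moreover have "closed {c::nat \<Rightarrow> real. (\<Sum>i<n. (c i)\<^sup>2) = 1}"
    by (intro closed_Collect_eq continuous_intros cont)
  moreover have "closed {c::nat \<Rightarrow> real. (\<Sum>i<n. c i * ip (e i) (f j)) = 0}" for j
    by (intro closed_Collect_eq continuous_intros cont)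
  ultimately have Z: "compact Z"
    unfolding Z_def by (intro compact_Int_closed closed_INT) auto
  show ?thesis
  proof (rule that[OF Z])
    fix c assume "c \<in> Z"
    then show "comb c e n \<in> unit_orth k f"
      using eV f unfolding unit_orth_def Z_def
      by (auto simp: comb_in orthonormal_norm[OF on] form_comb[OF form_ip])
  next
    fix v assume v: "v \<in> unit_orth k f"
    then have vV: "v \<in> V" by (simp add: unit_orth_def)
    define c where "c i = (if i < n then ip v (e i) else 0)" for i
    have comb: "comb c e n = comb (\<lambda>i. ip v (e i)) e n" by (simp add: comb_def c_def)
    have cV: "comb c e n \<in> V" using eV comb_in by simp
    have null: "ip (\<lambda>x. v x - comb c e n x) (\<lambda>x. v x - comb c e n x) = 0"
      using onb_null[OF onb vV] comb by simp
    have eq: "B v w = B (comb c e n) w" if "form B" "w \<in> V" for B w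
      using form_null_diff[OF that(1) vV cV that(2) null] .
    have eqq: "B v v = B (comb c e n) (comb c e n)" if "form B" for B
      using eq[OF that vV] eq[OF that cV] form_sym[OF that vV cV] by simp
    have 1: "(\<Sum>i<n. (c i)\<^sup>2) = 1"
      using eqq[OF form_ip] orthonormal_norm[OF on, of c] v by (simp add: unit_orth_def)
    have "\<bar>c i\<bar> \<le> 1" for i
    proof (cases "i < n")
      case True
      then have "(c i)\<^sup>2 \<le> 1" unfolding 1[symmetric] by (intro member_le_sum) auto
      then show ?thesis by (simp add: abs_square_le_1)
    qed (simp add: c_def)
    then have "c \<in> P" unfolding P_def by (auto simp: abs_le_iff c_def PiE_iff) (metis minus_le_iff)+
    moreover have "(\<Sum>i<n. c i * ip (e i) (f j)) = 0" if "j < k" for j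
      using eq[OF form_ip f[OF that]] v that form_comb[OF form_ip eV f[OF that], where c = c]
      by (simp add: unit_orth_def)
    ultimately have "c \<in> Z" using 1 by (simp add: Z_def)
    then show "\<exists>c\<in>Z. \<forall>B. form B \<longrightarrow> B v v = B (comb c e n) (comb c e n)"
      using eqq by blast
  next
    fix B assume B: "form B"
    show "continuous_on Z (\<lambda>c. B (comb c e n) (comb c e n))"
      by (simp add: form_comb_comb[OF B eV]) (intro continuous_intros cont)
  qed
qed

lemma form_combine:
  assumes "form A" "form B" shows "form (\<lambda>u v. \<alpha> * A u v + \<beta> * B u v)"
  unfolding form_def
proof (intro conjI ballI allI impI)
  fix u v assume "u \<in> V" "v \<in> V"
  then show "\<alpha> * A u v + \<beta> * B u v = \<alpha> * A v u + \<beta> * B v u"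
    by (simp add: form_sym[OF assms(1), of u v] form_sym[OF assms(2), of u v])
next
  fix u v w s t assume V: "u \<in> V" "v \<in> V" "w \<in> V"
  show "\<alpha> * A (\<lambda>x. s * u x + t * v x) w + \<beta> * B (\<lambda>x. s * u x + t * v x) w =
       s * (\<alpha> * A u w + \<beta> * B u w) + t * (\<alpha> * A v w + \<beta> * B v w)"
    using V by (simp add: form_lin[OF assms(1)] form_lin[OF assms(2)] algebra_simps)
next
  fix u w assume "u \<in> V" "w \<in> V" "ip u u = 0"
  then show "\<alpha> * A u w + \<beta> * B u w = 0" by (simp add: form_null[OF assms(1)] form_null[OF assms(2)])
qed

text \<open>The form minus the minimum times the inner product is positive semidefinite and vanishes at the
  minimiser. Moving from the minimiser in direction \<open>v\<close> gives a quadratic polynomial that is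
  nonnegative and has a zero at 0, so its linear term vanishes: this is the eigenvalue equation.\<close>

lemma rayleigh_minimiser:
  assumes B: "form B" and f: "\<And>j. j < k \<Longrightarrow> f j \<in> V" and onb: "onb n e"
    and ne: "unit_orth k f \<noteq> {}"
  obtains u where "u \<in> unit_orth k f"
    "\<And>v. v \<in> V \<Longrightarrow> (\<forall>j<k. ip v (f j) = 0) \<Longrightarrow> B u u * ip v v \<le> B v v"
    "\<And>v. v \<in> V \<Longrightarrow> (\<forall>j<k. ip v (f j) = 0) \<Longrightarrow> B u v = B u u * ip u v"
proof -
  obtain Z :: "(nat \<Rightarrow> real) set" where Z: "compact Z"
    "\<And>c. c \<in> Z \<Longrightarrow> comb c e n \<in> unit_orth k f"
    "\<And>v. v \<in> unit_orth k f \<Longrightarrow> \<exists>c\<in>Z. \<forall>B. form B \<longrightarrow> B v v = B (comb c e n) (comb c e n)"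
    "\<And>B. form B \<Longrightarrow> continuous_on Z (\<lambda>c. B (comb c e n) (comb c e n))"
    by (rule unit_orth_compact[OF onb f]) (assumption, blast)
  have "Z \<noteq> {}" using Z(3) ne by blast
  then obtain c where c: "c \<in> Z" "\<And>d. d \<in> Z \<Longrightarrow> B (comb c e n) (comb c e n) \<le> B (comb d e n) (comb d e n)"
    using continuous_attains_inf[OF Z(1) _ Z(4)[OF B]] by blast
  define u where "u = comb c e n"
  define \<mu> where "\<mu> = B u u"
  have u: "u \<in> unit_orth k f" "u \<in> V" "ip u u = 1" "\<And>j. j < k \<Longrightarrow> ip u (f j) = 0"
    using Z(2)[OF c(1)] by (auto simp: u_def unit_orth_def)
  have min1: "\<mu> \<le> B v v" if v: "v \<in> unit_orth k f" for v
  proof -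
    obtain d where "d \<in> Z" "\<forall>B. form B \<longrightarrow> B v v = B (comb d e n) (comb d e n)" using Z(3)[OF v] by blast
    then show ?thesis using c(2)[of d] B unfolding u_def \<mu>_def by metis
  qed
  have min: "\<mu> * ip v v \<le> B v v" if v: "v \<in> V" "\<forall>j<k. ip v (f j) = 0" for v
  proof (cases "ip v v = 0")
    case True then show ?thesis using form_null[OF B v(1,1)] by simp
  next
    case False
    obtain \<alpha> where \<alpha>: "\<alpha> \<noteq> 0" "(\<lambda>x. \<alpha> * v x) \<in> V" "ip (\<lambda>x. \<alpha> * v x) (\<lambda>x. \<alpha> * v x) = 1"
      using normalize[OF v(1) False] by blast
    have "(\<lambda>x. \<alpha> * v x) \<in> unit_orth k f"
      using \<alpha> v f form_scale[OF form_ip v(1)] by (auto simp: unit_orth_def)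
    from min1[OF this] have "\<mu> \<le> \<alpha>\<^sup>2 * B v v" using form_scale_scale[OF B v(1)] by simp
    moreover have "\<alpha>\<^sup>2 * ip v v = 1" using \<alpha> form_scale_scale[OF form_ip v(1)] by simp
    ultimately have "\<alpha>\<^sup>2 * (\<mu> * ip v v) \<le> \<alpha>\<^sup>2 * B v v" by (simp add: algebra_simps)
    then show ?thesis using \<alpha>(1) by (simp add: mult_le_cancel_left)
  qed
  have orth: "B u v = \<mu> * ip u v" if v: "v \<in> V" "\<forall>j<k. ip v (f j) = 0" for v
  proof -
    define Q where "Q = (\<lambda>u v. 1 * B u v + (- \<mu>) * ip u v)"
    have Q: "form Q" unfolding Q_def by (intro form_combine B form_ip)
    have Qn: "0 \<le> Q w w" if "w \<in> V" "\<forall>j<k. ip w (f j) = 0" for w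
      using min[OF that] by (simp add: Q_def)
    have Quu: "Q u u = 0" by (simp add: Q_def \<mu>_def u)
    have key: "0 \<le> 2 * t * Q u v + t\<^sup>2 * Q v v" for t
    proof -
      let ?w = "\<lambda>x. 1 * u x + t * v x"
      have w: "?w \<in> V" by (rule lin[OF u(2) v(1)])
      have "\<forall>j<k. ip ?w (f j) = 0"
        using form_lin[OF form_ip u(2) v(1) f, of _ 1 t] u v by simp
      then have "0 \<le> Q ?w ?w" using Qn w by blast
      also have "Q ?w ?w = Q u ?w + t * Q v ?w"
        using form_lin[OF Q u(2) v(1) w, of 1 t] by simp
      also have "Q u ?w = t * Q u v" using form_lin_right[OF Q u(2) v(1) u(2), of 1 t] Quu by simp
      also have "Q v ?w = Q u v + t * Q v v"
        using form_lin_right[OF Q u(2) v(1) v(1), of 1 t] form_sym[OF Q u(2) v(1)] by simp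
      finally show ?thesis by (simp add: algebra_simps power2_eq_square)
    qed
    have "Q u v = 0"
    proof (rule ccontr)
      assume nz: "Q u v \<noteq> 0"
      \<comment> \<open>The polynomial is negative at \<open>- Q u v / M\<close>, for any \<open>M > Q v v / 2\<close>; adding 1 covers \<open>Q v v = 0\<close>.\<close>
      define M where "M = 1 + Q v v"
      have M: "M > 0" "Q v v < M" using Qn[OF v] by (auto simp: M_def)
      have "2 * (- q / M) * q + (- q / M)\<^sup>2 * r = q\<^sup>2 * (r / M - 2) / M" for q r
        using M by (simp add: power2_eq_square divide_simps) (simp add: algebra_simps)
      with key[of "- Q u v / M"] have "0 \<le> (Q u v)\<^sup>2 * (Q v v / M - 2) / M" by metis
      moreover have "(Q u v)\<^sup>2 * (Q v v / M - 2) / M < 0"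
        using M nz by (intro divide_neg_pos mult_pos_neg) (auto simp: field_simps)
      ultimately show False by simp
    qed
    then show ?thesis by (simp add: Q_def)
  qed
  show ?thesis by (rule that[OF u(1) min[unfolded \<mu>_def] orth[unfolded \<mu>_def]])
qed

text \<open>The last condition is the variational characterization of \<open>\<mu> i\<close>. It contains the ordering of the
  eigenvalues and one half of the min-max principle.\<close>

definition eigenbasis where
  "eigenbasis B n e \<mu> \<longleftrightarrow> orthonormal n e \<and> (\<forall>i<n. \<forall>v\<in>V. B (e i) v = \<mu> i * ip (e i) v) \<and>
    (\<forall>i<n. \<forall>v\<in>V. (\<forall>j<i. ip v (e j) = 0) \<longrightarrow> \<mu> i * ip v v \<le> B v v)"

lemma eigenbasis_mono:
  assumes "eigenbasis B n e \<mu>" "i \<le> j" "j < n" shows "\<mu> i \<le> \<mu> j"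
proof -
  have on: "orthonormal n e" using assms by (simp add: eigenbasis_def)
  have "e j \<in> V" "ip (e j) (e j) = 1" "\<forall>l<i. ip (e j) (e l) = 0"
    using on assms by (auto simp: orthonormal_def)
  moreover have "\<forall>v\<in>V. (\<forall>l<i. ip v (e l) = 0) \<longrightarrow> \<mu> i * ip v v \<le> B v v"
    using assms unfolding eigenbasis_def by simp
  ultimately have "\<mu> i * 1 \<le> B (e j) (e j)" by metis
  moreover have "B (e j) (e j) = \<mu> j * 1"
    using assms on unfolding eigenbasis_def orthonormal_def by simp
  ultimately show ?thesis by simp
qed

text \<open>Successive minimization of the Rayleigh quotient. The minimiser satisfies the eigenvalue equation
  against the orthogonal complement of the earlier eigenvectors; against these vectors themselves
  it holds by symmetry, both sides being 0.\<close>

theorem spectral_theorem: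
  assumes B: "form B" and onb: "onb n b"
  obtains e \<mu> where "eigenbasis B n e \<mu>"
proof -
  have "\<exists>e \<mu>. eigenbasis B k e \<mu>" if "k \<le> n" for k
    using that
  proof (induction k)
    case 0
    show ?case by (simp add: eigenbasis_def orthonormal_def)
  next
    case (Suc k)
    then obtain e \<mu> where e: "eigenbasis B k e \<mu>" by auto
    have on: "orthonormal k e" and eig: "\<And>i v. i < k \<Longrightarrow> v \<in> V \<Longrightarrow> B (e i) v = \<mu> i * ip (e i) v"
      and low: "\<And>i v. i < k \<Longrightarrow> v \<in> V \<Longrightarrow> (\<forall>j<i. ip v (e j) = 0) \<Longrightarrow> \<mu> i * ip v v \<le> B v v"
      using e by (auto simp: eigenbasis_def)
    have eV: "\<And>i. i < k \<Longrightarrow> e i \<in> V" using on orthonormal_in by simp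
    have "\<not> onb k e" using orthonormal_le_onb[of k e n b] onb Suc.prems onb_orthonormal by fastforce
    then have ne: "unit_orth k e \<noteq> {}" using onb_or_extend[OF on] by (auto simp: unit_orth_def)
    obtain u where u: "u \<in> unit_orth k e"
      "\<And>v. v \<in> V \<Longrightarrow> (\<forall>j<k. ip v (e j) = 0) \<Longrightarrow> B u u * ip v v \<le> B v v"
      "\<And>v. v \<in> V \<Longrightarrow> (\<forall>j<k. ip v (e j) = 0) \<Longrightarrow> B u v = B u u * ip u v"
      using rayleigh_minimiser[OF B eV onb ne] by metis
    have uV: "u \<in> V" "ip u u = 1" "\<And>j. j < k \<Longrightarrow> ip u (e j) = 0" using u(1) by (auto simp: unit_orth_def)
    \<comment> \<open>The part \<open>p\<close> of \<open>v\<close> in the span of the earlier eigenvectors contributes 0 on both sides.\<close>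
    have eigu: "B u v = B u u * ip u v" if v: "v \<in> V" for v
    proof -
      define p where "p = comb (\<lambda>i. ip v (e i)) e k"
      have pV: "p \<in> V" unfolding p_def using eV by (rule comb_in)
      have rV: "(\<lambda>x. v x - p x) \<in> V" using v pV by (rule diff_in)
      have "ip (\<lambda>x. v x - p x) (e j) = 0" if "j < k" for j
        using form_diff[OF form_ip v pV eV[OF that]] orthonormal_coefficient[OF on that]
        by (simp add: p_def)
      then have r: "B u (\<lambda>x. v x - p x) = B u u * ip u (\<lambda>x. v x - p x)"
        using u(3)[OF rV] by simp
      have z: "A u p = 0" if A: "form A" and "\<And>i. i < k \<Longrightarrow> A (e i) u = 0" for A
        using form_comb[OF A eV uV(1), where c = "\<lambda>i. ip v (e i)"] that(2) form_sym[OF A uV(1) pV]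
        by (simp add: p_def)
      have iz: "ip (e i) u = 0" if "i < k" for i
        using form_sym[OF form_ip eV[OF that] uV(1)] uV(3)[OF that] by simp
      have "ip u p = 0" by (rule z[OF form_ip iz])
      moreover have "B u p = 0" by (rule z[OF B]) (simp add: eig uV iz)
      moreover have diff: "A u (\<lambda>x. v x - p x) = A u v - A u p" if A: "form A" for A
        using form_sym[OF A uV(1) rV] form_diff[OF A v pV uV(1)] form_sym[OF A v uV(1)]
          form_sym[OF A pV uV(1)] by simp
      ultimately show ?thesis using r diff[OF B] diff[OF form_ip] by simp
    qed
    have "eigenbasis B (Suc k) (e(k := u)) (\<mu>(k := B u u))"
      unfolding eigenbasis_def
      using orthonormal_extend[OF on uV] eig eigu low u(2)
      by (auto simp: less_Suc_eq)
    then show ?case by blast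
  qed
  then show ?thesis using that by blast
qed

end

section \<open>Eigenvalue lists and large penalties\<close>

lemma sorted_concat_replicate:
  "sorted xs \<Longrightarrow> sorted (concat (map (\<lambda>m. replicate (k m) m) xs))"
  by (induction xs) (auto simp: sorted_append sorted_replicate)

lemma count_concat_replicate:
  "distinct xs \<Longrightarrow> count (mset (concat (map (\<lambda>m. replicate (k m) m) xs))) y = (if y \<in> set xs then k y else 0)"
  by (induction xs) auto

lemma count_map_upt: "count (mset (map \<mu> [0..<n])) y = card {j. j < n \<and> \<mu> j = y}"
proof (induction n)
  case (Suc n)
  have "{j. j < Suc n \<and> \<mu> j = y} = (if \<mu> n = y then insert n {j. j < n \<and> \<mu> j = y} else {j. j < n \<and> \<mu> j = y})"
    by (auto simp: less_Suc_eq)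
  then show ?case using Suc by simp
qed simp

text \<open>Repeating each value according to its multiplicity recovers a nondecreasing finite sequence:
  both lists are sorted and have the same elements with multiplicity.\<close>

lemma sorted_list_with_multiplicities:
  fixes \<mu> :: "nat \<Rightarrow> 'b::linorder"
  assumes "\<And>i j. i \<le> j \<Longrightarrow> j < n \<Longrightarrow> \<mu> i \<le> \<mu> j"
  shows "concat (map (\<lambda>m. replicate (card {j. j < n \<and> \<mu> j = m}) m) (sorted_list_of_set (\<mu> ` {..<n})))
    = map \<mu> [0..<n]" (is "?l = ?r")
proof -
  have "mset ?l = mset ?r"
  proof (rule multiset_eqI)
    fix y show "count (mset ?l) y = count (mset ?r) y"
    proof (cases "y \<in> \<mu> ` {..<n}")
      case False
      then have "{j. j < n \<and> \<mu> j = y} = {}" by auto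
      then show ?thesis using False unfolding count_map_upt by (subst count_concat_replicate) auto
    qed (unfold count_map_upt, subst count_concat_replicate, auto)
  qed
  moreover have "sorted ?l" by (intro sorted_concat_replicate sorted_sorted_list_of_set)
  moreover have "sorted ?r" using assms by (auto simp: sorted_iff_nth_mono)
  ultimately show ?thesis using properties_for_sort[of ?l ?r] sorted_sort_id[of ?r] by simp
qed

lemma nth_eigenvalue_cong:
  assumes "\<And>u v. u \<in> V \<Longrightarrow> v \<in> V \<Longrightarrow> A u v = B u v"
  shows "nth_eigenvalue \<Omega> V A i = nth_eigenvalue \<Omega> V B i"
proof -
  have "eigenvalues \<Omega> V A = eigenvalues \<Omega> V B" "eigenspace \<Omega> V A = eigenspace \<Omega> V B"
    using assms by (auto simp: eigenvalues_def eigenpair_def eigenspace_def fun_eq_iff)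
  then show ?thesis by (simp add: nth_eigenvalue_def eigenvalue_list_def)
qed

context L2_subspace begin

lemma L2_subspace_eigenspace:
  assumes B: "form B" shows "L2_subspace \<Omega> (eigenspace \<Omega> V B m)"
proof
  show "eigenspace \<Omega> V B m \<subseteq> L2 \<Omega>" using sub by (auto simp: eigenspace_def)
  show "(\<lambda>x. 0) \<in> eigenspace \<Omega> V B m"
    using zero form_zero[OF B] form_zero[OF form_ip] by (auto simp: eigenspace_def)
  fix u v \<alpha> \<beta> assume "u \<in> eigenspace \<Omega> V B m" "v \<in> eigenspace \<Omega> V B m"
  then show "(\<lambda>x. \<alpha> * u x + \<beta> * v x) \<in> eigenspace \<Omega> V B m"
    using lin[of u v \<alpha> \<beta>] by (auto simp: eigenspace_def form_lin[OF B] form_lin[OF form_ip] algebra_simps)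
qed

text \<open>By symmetry \<open>B v (e j)\<close> can be evaluated with either eigenvalue, so eigenfunctions for different
  eigenvalues are orthogonal.\<close>

lemma eigenvalue_of_coefficient:
  assumes B: "form B" and e: "eigenbasis B n e \<mu>" and v: "v \<in> V" and ev: "\<And>w. w \<in> V \<Longrightarrow> B v w = m * ip v w"
    and j: "j < n" "ip v (e j) \<noteq> 0"
  shows "m = \<mu> j"
proof -
  have ej: "e j \<in> V" using e j by (auto simp: eigenbasis_def orthonormal_in)
  have "m * ip v (e j) = B (e j) v" unfolding ev[OF ej, symmetric] by (rule form_sym[OF B v ej])
  also have "\<dots> = \<mu> j * ip (e j) v" using e j v by (simp add: eigenbasis_def)
  also have "ip (e j) v = ip v (e j)" by (rule form_sym[OF form_ip ej v])
  finally show ?thesis using j by simp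
qed

text \<open>The basis vectors with eigenvalue \<open>m\<close> form a complete orthonormal family of the eigenspace, because
  an element of the eigenspace has no component along the others.\<close>

lemma L2_dim_eigenspace:
  assumes B: "form B" and onb: "onb n b" and e: "eigenbasis B n e \<mu>"
  shows "L2_dim \<Omega> (eigenspace \<Omega> V B m) = card {j. j < n \<and> \<mu> j = m}" (is "_ = card ?J")
proof -
  interpret E: L2_subspace \<Omega> "eigenspace \<Omega> V B m" using B by (rule L2_subspace_eigenspace)
  have on: "orthonormal n e" and eig: "\<And>i v. i < n \<Longrightarrow> v \<in> V \<Longrightarrow> B (e i) v = \<mu> i * ip (e i) v"
    using e by (auto simp: eigenbasis_def)
  have onbe: "onb n e" using onb_of_card[OF onb on] .
  obtain h where h: "bij_betw h {0..<card ?J} ?J" using ex_bij_betw_nat_finite[of ?J] by auto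
  then have hJ: "h i < n" "\<mu> (h i) = m" if "i < card ?J" for i
    using that bij_betwE[OF h] by auto
  have inj: "h i = h j \<longleftrightarrow> i = j" if "i < card ?J" "j < card ?J" for i j
    using h that by (auto simp: bij_betw_def inj_on_def)
  have "E.onb (card ?J) (\<lambda>i. e (h i))"
    unfolding E.onb_def E.orthonormal_def
  proof (intro conjI allI impI ballI)
    fix i assume "i < card ?J"
    then show "e (h i) \<in> eigenspace \<Omega> V B m"
      using hJ[of i] eig orthonormal_in[OF on] by (auto simp: eigenspace_def)
  next
    fix i j assume "i < card ?J" "j < card ?J"
    then show "ip (e (h i)) (e (h j)) = of_bool (i = j)"
      using hJ[of i] hJ[of j] inj[of i j] on by (simp add: orthonormal_def)
  next
    fix v assume v: "v \<in> eigenspace \<Omega> V B m" and z: "\<forall>i<card ?J. ip v (e (h i)) = 0"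
    then have vV: "v \<in> V" and ev: "\<And>w. w \<in> V \<Longrightarrow> B v w = m * ip v w" by (auto simp: eigenspace_def)
    have "ip v (e j) = 0" if j: "j < n" for j
    proof (cases "\<mu> j = m")
      case True
      then have "j \<in> h ` {0..<card ?J}" using h j by (auto simp: bij_betw_def)
      then show ?thesis using z by auto
    next
      case False
      then show ?thesis using eigenvalue_of_coefficient[OF B e vV ev j] by blast
    qed
    then show "ip v v = 0" using onbe vV by (simp add: onb_def)
  qed
  then show ?thesis by (rule E.L2_dim_onb)
qed

lemma eigenvalues_eigenbasis:
  assumes B: "form B" and onb: "onb n b" and e: "eigenbasis B n e \<mu>"
  shows "eigenvalues \<Omega> V B = \<mu> ` {..<n}"
proof (intro equalityI subsetI)
  have on: "orthonormal n e" and eig: "\<And>i v. i < n \<Longrightarrow> v \<in> V \<Longrightarrow> B (e i) v = \<mu> i * ip (e i) v"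
    using e by (auto simp: eigenbasis_def)
  have onbe: "onb n e" using onb_of_card[OF onb on] .
  have norm1: "L2_norm \<Omega> u = 1 \<longleftrightarrow> ip u u = 1" for u
    by (simp add: L2_norm_def)
  {
    fix m assume "m \<in> \<mu> ` {..<n}"
    then obtain i where i: "i < n" "m = \<mu> i" by auto
    then have "eigenpair \<Omega> V B m (e i)"
      using eig on by (simp add: eigenpair_def norm1 orthonormal_def)
    then show "m \<in> eigenvalues \<Omega> V B" by (auto simp: eigenvalues_def)
  next
    fix m assume "m \<in> eigenvalues \<Omega> V B"
    then obtain u where u: "u \<in> V" "ip u u = 1" "\<And>v. v \<in> V \<Longrightarrow> B u v = m * ip u v"
      by (auto simp: eigenvalues_def eigenpair_def norm1)
    then obtain j where j: "j < n" "ip u (e j) \<noteq> 0" using onbe unfolding onb_def by (metis zero_neq_one)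
    have "m = \<mu> j" by (rule eigenvalue_of_coefficient[OF B e u(1,3) j])
    then show "m \<in> \<mu> ` {..<n}" using j by simp
  }
qed

text \<open>From here on the eigenvalue list of a problem can be replaced by the numbers \<open>\<mu> 0, \<mu> 1, ...\<close> of any
  eigenbasis.\<close>

theorem nth_eigenvalue_eigenbasis:
  assumes B: "form B" and onb: "onb n b" and e: "eigenbasis B n e \<mu>" and i: "1 \<le> i" "i \<le> n"
  shows "nth_eigenvalue \<Omega> V B i = \<mu> (i - 1)"
proof -
  have "eigenvalue_list \<Omega> V B = map \<mu> [0..<n]"
    unfolding eigenvalue_list_def L2_dim_eigenspace[OF B onb e] eigenvalues_eigenbasis[OF B onb e]
    by (rule sorted_list_with_multiplicities) (rule eigenbasis_mono[OF e])
  then show ?thesis using i by (simp add: nth_eigenvalue_def)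
qed

text \<open>The second half of the min-max principle: on the span of the first \<open>j + 1\<close> eigenvectors the
  Rayleigh quotient is a weighted mean of \<open>\<mu> 0, ..., \<mu> j\<close>.\<close>

lemma eigenbasis_upper:
  assumes B: "form B" and e: "eigenbasis B n e \<mu>" and j: "j < n"
  shows "B (comb c e (Suc j)) (comb c e (Suc j)) \<le> \<mu> j * ip (comb c e (Suc j)) (comb c e (Suc j))"
proof -
  let ?v = "comb c e (Suc j)"
  have on: "orthonormal n e" and eig: "\<And>i v. i < n \<Longrightarrow> v \<in> V \<Longrightarrow> B (e i) v = \<mu> i * ip (e i) v"
    using e by (auto simp: eigenbasis_def)
  have eV: "\<And>i. i < Suc j \<Longrightarrow> e i \<in> V" using on j orthonormal_in by simp
  have onj: "orthonormal (Suc j) e" using on j by (simp add: orthonormal_def)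
  have vV: "?v \<in> V" using eV by (rule comb_in)
  have "B ?v ?v = (\<Sum>i<Suc j. c i * B (e i) ?v)" using form_comb[OF B eV vV] .
  also have "\<dots> = (\<Sum>i<Suc j. \<mu> i * (c i)\<^sup>2)"
  proof (intro sum.cong refl)
    fix i assume "i \<in> {..<Suc j}"
    then have i: "i < Suc j" "i < n" using j by auto
    have "ip (e i) ?v = c i"
      using form_sym[OF form_ip eV[OF i(1)] vV] orthonormal_coefficient[OF onj i(1)] by simp
    then show "c i * B (e i) ?v = \<mu> i * (c i)\<^sup>2" using eig[OF i(2) vV] by (simp add: power2_eq_square)
  qed
  also have "\<dots> \<le> (\<Sum>i<Suc j. \<mu> j * (c i)\<^sup>2)"
    using j by (intro sum_mono mult_right_mono eigenbasis_mono[OF e]) auto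
  also have "\<dots> = \<mu> j * ip ?v ?v"
    unfolding orthonormal_norm[OF onj] by (simp only: sum_distrib_left)
  finally show ?thesis .
qed

text \<open>On the compact part of the sphere where \<open>b v v \<le> t\<close>, the penalty is positive and hence bounded away
  from 0, while \<open>b v v\<close> is bounded below; so a large \<open>\<gamma>\<close> suffices there. Elsewhere the bound holds for
  all \<open>\<gamma> \<ge> 0\<close>.\<close>

lemma large_penalty_lower_bound:
  assumes onb: "onb n e" and f: "\<And>j. j < k \<Longrightarrow> f j \<in> V"
    and b: "form b" and s: "form s" and nonneg: "\<And>v. v \<in> V \<Longrightarrow> 0 \<le> s v v"
    and ker: "\<And>v. v \<in> unit_orth k f \<Longrightarrow> s v v = 0 \<Longrightarrow> t < b v v"
  shows "\<exists>\<Gamma>. \<forall>\<gamma>\<ge>\<Gamma>. \<forall>v\<in>unit_orth k f. t \<le> b v v + \<gamma> * s v v"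
proof -
  obtain Z :: "(nat \<Rightarrow> real) set" where Z: "compact Z"
    "\<And>c. c \<in> Z \<Longrightarrow> comb c e n \<in> unit_orth k f"
    "\<And>v. v \<in> unit_orth k f \<Longrightarrow> \<exists>c\<in>Z. \<forall>B. form B \<longrightarrow> B v v = B (comb c e n) (comb c e n)"
    "\<And>B. form B \<Longrightarrow> continuous_on Z (\<lambda>c. B (comb c e n) (comb c e n))"
    by (rule unit_orth_compact[OF onb f]) (assumption, blast)
  define bb where "bb c = b (comb c e n) (comb c e n)" for c
  define ss where "ss c = s (comb c e n) (comb c e n)" for c
  have cb: "continuous_on Z bb" and cs: "continuous_on Z ss"
    using Z(4)[OF b] Z(4)[OF s] by (auto simp: bb_def ss_def)
  have ss0: "0 \<le> ss c" if "c \<in> Z" for c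
    using Z(2)[OF that] nonneg by (auto simp: ss_def unit_orth_def)
  have kerc: "t < bb c" if "c \<in> Z" "ss c = 0" for c
    using Z(2)[OF that(1)] ker that by (auto simp: ss_def bb_def)
  define Z0 where "Z0 = {c\<in>Z. bb c \<le> t}"
  have "compact Z0"
  proof -
    have "Z0 = Z \<inter> bb -` {..t}" by (auto simp: Z0_def)
    moreover have "closedin (top_of_set Z) (Z \<inter> bb -` {..t})"
      using cb by (intro continuous_closedin_preimage) auto
    ultimately show ?thesis using Z(1) closedin_compact by metis
  qed
  have "\<exists>\<Gamma>\<ge>0. \<forall>c\<in>Z0. t \<le> bb c + \<Gamma> * ss c"
  proof (cases "Z0 = {}")
    case False
    have sub0: "Z0 \<subseteq> Z" by (auto simp: Z0_def)
    obtain c1 where c1: "c1 \<in> Z0" "\<And>c. c \<in> Z0 \<Longrightarrow> bb c1 \<le> bb c"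
      using continuous_attains_inf[OF \<open>compact Z0\<close> False continuous_on_subset[OF cb sub0]] by blast
    obtain c2 where c2: "c2 \<in> Z0" "\<And>c. c \<in> Z0 \<Longrightarrow> ss c2 \<le> ss c"
      using continuous_attains_inf[OF \<open>compact Z0\<close> False continuous_on_subset[OF cs sub0]] by blast
    have pos: "ss c2 > 0" using ss0[of c2] kerc[of c2] c2(1) by (force simp: Z0_def)
    have le: "bb c1 \<le> t" using c1 by (simp add: Z0_def)
    let ?G = "(t - bb c1) / ss c2"
    have G: "?G \<ge> 0" using pos le by simp
    have "t \<le> bb c + ?G * ss c" if "c \<in> Z0" for c
    proof -
      have "t - bb c1 = ?G * ss c2" using pos by simp
      also have "\<dots> \<le> ?G * ss c" using G c2(2)[OF that] by (rule mult_left_mono[rotated])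
      finally show ?thesis using c1(2)[OF that] by linarith
    qed
    then show ?thesis using G by blast
  qed auto
  then obtain \<Gamma> where G: "\<Gamma> \<ge> 0" "\<And>c. c \<in> Z0 \<Longrightarrow> t \<le> bb c + \<Gamma> * ss c" by blast
  have "t \<le> b v v + \<gamma> * s v v" if g: "\<gamma> \<ge> \<Gamma>" and v: "v \<in> unit_orth k f" for \<gamma> v
  proof -
    obtain c where c: "c \<in> Z" "\<forall>B. form B \<longrightarrow> B v v = B (comb c e n) (comb c e n)" using Z(3)[OF v] by blast
    then have eq: "b v v = bb c" "s v v = ss c" using b s unfolding bb_def ss_def by metis+
    show ?thesis
    proof (cases "c \<in> Z0")
      case True
      have "\<Gamma> * ss c \<le> \<gamma> * ss c" using g ss0[OF c(1)] by (rule mult_right_mono)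
      then show ?thesis using G(2)[OF True] unfolding eq by linarith
    next
      case False
      then have "t \<le> bb c" using c by (simp add: Z0_def)
      moreover have "0 \<le> \<gamma> * ss c" using ss0[OF c(1)] g G(1) by simp
      ultimately show ?thesis unfolding eq by linarith
    qed
  qed
  then show ?thesis by blast
qed

end

text \<open>The limit for abstract forms, by the min-max argument described at the top. The lower bound is
  proved once, for an arbitrary number \<open>k\<close> of orthogonality conditions; then \<open>k\<close> is \<open>j\<close> if \<open>j < dim W\<close>, and
  \<open>dim W\<close> otherwise.\<close>

theorem penalized_eigenvalue_limit:
  assumes "L2_subspace \<Omega> V" "L2_subspace \<Omega> W" and WV: "W \<subseteq> V"
    and onb: "L2_subspace.onb \<Omega> V N u"
    and b: "L2_subspace.form \<Omega> V b" and s: "L2_subspace.form \<Omega> V s"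
    and nonneg: "\<And>v. v \<in> V \<Longrightarrow> 0 \<le> s v v"
    and ker: "\<And>v. v \<in> V \<Longrightarrow> s v v = 0 \<longleftrightarrow> v \<in> W"
    and bW: "\<And>v w. v \<in> W \<Longrightarrow> w \<in> W \<Longrightarrow> bW v w = b v w"
    and i: "1 \<le> i" "i \<le> L2_dim \<Omega> V"
  shows "i \<le> L2_dim \<Omega> W \<Longrightarrow>
      ((\<lambda>\<gamma>. nth_eigenvalue \<Omega> V (\<lambda>v w. b v w + \<gamma> * s v w) i) \<longlongrightarrow> nth_eigenvalue \<Omega> W bW i) at_top"
    and "L2_dim \<Omega> W < i \<Longrightarrow>
      filterlim (\<lambda>\<gamma>. nth_eigenvalue \<Omega> V (\<lambda>v w. b v w + \<gamma> * s v w) i) at_top at_top"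
proof -
  interpret V: L2_subspace \<Omega> V by fact
  interpret W: L2_subspace \<Omega> W by fact
  have fW: "W.form bW"
    unfolding W.form_def
  proof (intro conjI ballI allI impI)
    fix v w assume "v \<in> W" "w \<in> W"
    then show "bW v w = bW w v" using bW WV V.form_sym[OF b, of v w] by auto
  next
    fix v w z \<alpha> \<beta> assume "v \<in> W" "w \<in> W" "z \<in> W"
    then show "bW (\<lambda>x. \<alpha> * v x + \<beta> * w x) z = \<alpha> * bW v z + \<beta> * bW w z"
      using bW WV V.form_lin[OF b, of v w z \<alpha> \<beta>] W.lin[of v w \<alpha> \<beta>] by (auto simp: subset_iff)
  next
    fix v w assume "v \<in> W" "w \<in> W" "L2_inner \<Omega> v v = 0"
    then show "bW v w = 0" using bW WV V.form_null[OF b, of v w] by auto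
  qed
  have "m \<le> N" if "W.orthonormal m f" for m f
    using that WV by (intro V.orthonormal_le_onb[OF onb, of m f]) (auto simp: W.orthonormal_def V.orthonormal_def)
  then obtain M w where onbW: "W.onb M w" using W.onb_exists by blast
  have dimV: "L2_dim \<Omega> V = N" and dimW: "L2_dim \<Omega> W = M"
    using V.L2_dim_onb[OF onb] W.L2_dim_onb[OF onbW] by auto
  obtain f \<nu> where f: "W.eigenbasis bW M f \<nu>" using W.spectral_theorem[OF fW onbW] by blast
  have onf: "W.orthonormal M f" using f by (simp add: W.eigenbasis_def)
  have onbf: "W.onb M f" by (rule W.onb_of_card[OF onbW onf])
  have fWin: "\<And>j. j < M \<Longrightarrow> f j \<in> W" using onf W.orthonormal_in by simp
  then have fV: "\<And>j. j < M \<Longrightarrow> f j \<in> V" using WV by auto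
  define B where "B \<gamma> = (\<lambda>v w. b v w + \<gamma> * s v w)" for \<gamma>
  have fB: "V.form (B \<gamma>)" for \<gamma>
    using V.form_combine[OF b s, of 1 \<gamma>] by (simp add: B_def)
  have "\<forall>\<gamma>. \<exists>e \<mu>. V.eigenbasis (B \<gamma>) N e \<mu>"
    using V.spectral_theorem[OF fB onb] by metis
  then obtain e \<mu> where e: "\<And>\<gamma>. V.eigenbasis (B \<gamma>) N (e \<gamma>) (\<mu> \<gamma>)" by metis
  have on: "V.orthonormal N (e \<gamma>)" for \<gamma> using e[of \<gamma>] by (simp add: V.eigenbasis_def)
  have nthV: "nth_eigenvalue \<Omega> V (B \<gamma>) i = \<mu> \<gamma> (i - 1)" for \<gamma>
    using V.nth_eigenvalue_eigenbasis[OF fB onb e] i dimV by simp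
  define j where "j = i - 1"
  have j: "j < N" using i dimV by (simp add: j_def)
  \<comment> \<open>A penalized eigenvalue is at least \<open>t\<close> once \<open>t\<close> is a lower bound on the sphere of some \<open>k \<le> j\<close> conditions.\<close>
  have lower: "\<forall>\<^sub>F \<gamma> in at_top. t \<le> \<mu> \<gamma> j"
    if k: "k \<le> j" "k \<le> M" and low: "\<And>v. v \<in> V.unit_orth k f \<Longrightarrow> s v v = 0 \<Longrightarrow> t < b v v" for t k
  proof -
    have fk: "\<And>l. l < k \<Longrightarrow> f l \<in> V" using fV k by simp
    obtain \<Gamma> where G: "\<And>\<gamma> v. \<gamma> \<ge> \<Gamma> \<Longrightarrow> v \<in> V.unit_orth k f \<Longrightarrow> t \<le> b v v + \<gamma> * s v v"
      using V.large_penalty_lower_bound[where k = k and f = f and t = t, OF onb fk b s nonneg low] by blast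
    have "t \<le> \<mu> \<gamma> j" if g: "\<gamma> \<ge> \<Gamma>" for \<gamma>
    proof -
      have onj: "V.orthonormal (Suc j) (e \<gamma>)" using on[of \<gamma>] j by (simp add: V.orthonormal_def)
      obtain c where c: "L2_inner \<Omega> (comb c (e \<gamma>) (Suc j)) (comb c (e \<gamma>) (Suc j)) = 1"
          "\<forall>l<k. L2_inner \<Omega> (comb c (e \<gamma>) (Suc j)) (f l) = 0"
        using V.orthonormal_span_meets_orthogonal_complement[OF onj, of k f] k fk by auto
      have "comb c (e \<gamma>) (Suc j) \<in> V" using V.orthonormal_in[OF onj] by (rule V.comb_in)
      then have "comb c (e \<gamma>) (Suc j) \<in> V.unit_orth k f" using c by (simp add: V.unit_orth_def)
      from G[OF g this] V.eigenbasis_upper[OF fB e j, of \<gamma> c] c(1) show ?thesis by (simp add: B_def)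
    qed
    then show ?thesis unfolding eventually_at_top_linorder by blast
  qed
  {
    assume "i \<le> L2_dim \<Omega> W"
    then have jM: "j < M" using i dimW by (simp add: j_def)
    have upper: "\<mu> \<gamma> j \<le> \<nu> j" for \<gamma>
    proof -
      have onj: "W.orthonormal (Suc j) f" using onf jM by (simp add: W.orthonormal_def)
      then have onjV: "V.orthonormal (Suc j) f" using WV by (auto simp: W.orthonormal_def V.orthonormal_def)
      obtain c where c: "L2_inner \<Omega> (comb c f (Suc j)) (comb c f (Suc j)) = 1"
          "\<forall>l<j. L2_inner \<Omega> (comb c f (Suc j)) (e \<gamma> l) = 0"
        using V.orthonormal_span_meets_orthogonal_complement[OF onjV, of j "e \<gamma>"]
          V.orthonormal_in[OF on] j by auto
      let ?v = "comb c f (Suc j)"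
      have vW: "?v \<in> W" using W.orthonormal_in[OF onj] by (rule W.comb_in)
      then have vV: "?v \<in> V" using WV by auto
      have "\<mu> \<gamma> j * L2_inner \<Omega> ?v ?v \<le> B \<gamma> ?v ?v"
        using e[of \<gamma>] j vV c(2) unfolding V.eigenbasis_def by blast
      also have "B \<gamma> ?v ?v = bW ?v ?v" using bW[OF vW vW] ker[OF vV] vW by (simp add: B_def)
      also have "\<dots> \<le> \<nu> j * L2_inner \<Omega> ?v ?v" by (rule W.eigenbasis_upper[OF fW f jM])
      finally show ?thesis using c(1) by simp
    qed
    have "((\<lambda>\<gamma>. \<mu> \<gamma> j) \<longlongrightarrow> \<nu> j) at_top"
    proof (rule order_tendstoI)
      fix a assume "a < \<nu> j"
      then obtain t where t: "a < t" "t < \<nu> j" using dense by blast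
      have "\<forall>\<^sub>F \<gamma> in at_top. t \<le> \<mu> \<gamma> j"
      proof (rule lower[of j])
        fix v assume v: "v \<in> V.unit_orth j f" and "s v v = 0"
        then have vW: "v \<in> W" using ker by (auto simp: V.unit_orth_def)
        have "\<nu> j * L2_inner \<Omega> v v \<le> bW v v"
          using f jM vW v unfolding W.eigenbasis_def V.unit_orth_def by blast
        then show "t < b v v" using t v bW[OF vW vW] by (simp add: V.unit_orth_def)
      qed (use jM in auto)
      then show "\<forall>\<^sub>F \<gamma> in at_top. a < \<mu> \<gamma> j" by eventually_elim (use t in linarith)
    next
      fix a assume "\<nu> j < a"
      then show "\<forall>\<^sub>F \<gamma> in at_top. \<mu> \<gamma> j < a" using upper le_less_trans by (intro always_eventually) blast
    qed
    moreover have "nth_eigenvalue \<Omega> W bW i = \<nu> j"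
      unfolding j_def using W.nth_eigenvalue_eigenbasis[OF fW onbW f] i \<open>i \<le> L2_dim \<Omega> W\<close> dimW by simp
    ultimately show "((\<lambda>\<gamma>. nth_eigenvalue \<Omega> V (\<lambda>v w. b v w + \<gamma> * s v w) i) \<longlongrightarrow> nth_eigenvalue \<Omega> W bW i) at_top"
      using nthV by (simp add: B_def j_def)
  next
    assume "L2_dim \<Omega> W < i"
    then have Mj: "M \<le> j" using i dimW by (simp add: j_def)
    have "\<forall>\<^sub>F \<gamma> in at_top. t \<le> \<mu> \<gamma> j" for t
    proof (rule lower[of M])
      fix v assume v: "v \<in> V.unit_orth M f" and "s v v = 0"
      then have vW: "v \<in> W" using ker by (auto simp: V.unit_orth_def)
      then show "t < b v v" using v onbf unfolding W.onb_def V.unit_orth_def by force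
    qed (use Mj in auto)
    then have "filterlim (\<lambda>\<gamma>. \<mu> \<gamma> j) at_top at_top" by (simp add: filterlim_at_top)
    then show "filterlim (\<lambda>\<gamma>. nth_eigenvalue \<Omega> V (\<lambda>v w. b v w + \<gamma> * s v w) i) at_top at_top"
      using nthV by (simp add: B_def j_def)
  }
qed

section \<open>Cells and facets of a simplicial mesh\<close>

text \<open>Project a point \<open>z\<close> close to \<open>x\<close> from \<open>y\<close> onto the hyperplane. The projection is close to \<open>x\<close>, so it
  lies in \<open>e\<close>; and if \<open>z\<close> is on the side of \<open>y\<close>, it lies on the segment between \<open>y\<close> and its projection.\<close>

lemma half_ball_inside_convex:
  fixes K :: "'a::euclidean_space set"
  assumes K: "convex K" and eK: "e \<subseteq> K" and H: "affine hull e = {y. a \<bullet> y = b}"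
    and x: "x \<in> rel_interior e" and y: "y \<in> K" "a \<bullet> y < b"
  shows "\<exists>r>0. ball x r \<inter> {z. a \<bullet> z \<le> b} \<subseteq> K"
proof -
  have xe: "x \<in> e" using x rel_interior_subset by auto
  then have "x \<in> affine hull e" by (rule hull_inc)
  then have ax: "a \<bullet> x = b" using H by simp
  obtain \<delta> where \<delta>: "\<delta> > 0" "ball x \<delta> \<inter> affine hull e \<subseteq> e" using x by (auto simp: mem_rel_interior_ball)
  \<comment> \<open>\<open>N z\<close> is the central projection of \<open>z\<close> from \<open>y\<close> onto the hyperplane.\<close>
  define s where "s z = (b - a \<bullet> y) / (a \<bullet> z - a \<bullet> y)" for z
  define N where "N z = y + s z *\<^sub>R (z - y)" for z
  have Nx: "N x = x" using y ax by (simp add: N_def s_def)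
  have "(N \<longlongrightarrow> N x) (at x)" unfolding N_def s_def using ax y by (intro tendsto_intros) auto
  then have "\<forall>\<^sub>F z in at x. dist (N z) x < \<delta>" using \<delta>(1) Nx tendstoD by fastforce
  moreover have "\<forall>\<^sub>F z in at x. a \<bullet> y < a \<bullet> z"
    using ax y by (intro order_tendstoD(1)[where y = "a \<bullet> x"] tendsto_intros) auto
  ultimately have "\<forall>\<^sub>F z in at x. dist (N z) x < \<delta> \<and> a \<bullet> y < a \<bullet> z" by (rule eventually_conj)
  then obtain r where r: "r > 0" "\<And>z. z \<noteq> x \<Longrightarrow> dist z x < r \<Longrightarrow> dist (N z) x < \<delta> \<and> a \<bullet> y < a \<bullet> z"
    unfolding eventually_at by auto
  have "z \<in> K" if z: "z \<in> ball x r" "a \<bullet> z \<le> b" for z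
  proof (cases "z = x")
    case True then show ?thesis using xe eK by auto
  next
    case False
    then have z2: "dist (N z) x < \<delta>" "a \<bullet> y < a \<bullet> z" using r z by (auto simp: dist_commute)
    have "a \<bullet> N z = b" using z2 by (simp add: N_def s_def inner_add_right inner_diff_right)
    then have "N z \<in> affine hull e" using H by simp
    then have NK: "N z \<in> K" using \<delta> z2 eK by (auto simp: dist_commute)
    have s1: "s z \<ge> 1" using z2 z by (simp add: s_def)
    have "z = (1 - 1 / s z) *\<^sub>R y + (1 / s z) *\<^sub>R N z" using s1 by (simp add: N_def algebra_simps)
    also have "\<dots> \<in> K" using s1 NK y by (intro convexD[OF K]) auto
    finally show ?thesis .
  qed
  then show ?thesis using r by auto
qed

lemma facet_convex_compact:
  assumes "e facet_of K" "convex K" "compact K"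
  shows "convex e" "compact e" "e \<noteq> {}"
  using assms face_of_imp_convex[of e K] face_of_imp_compact[of K e] by (auto simp: facet_of_def)

locale mesh =
  fixes \<Omega> :: "'a::euclidean_space set" and \<T> :: "'a set set"
  assumes domain: "polyhedral_domain \<Omega>" "bounded \<Omega>" and simplicial: "simplicial_mesh \<Omega> \<T>"
begin

lemma finite_cells: "finite \<T>"
  and cover: "\<Union>\<T> = closure \<Omega>"
  and open_domain: "open \<Omega>"
  and cell_simplex: "K \<in> \<T> \<Longrightarrow> int DIM('a) simplex K"
  and cell_Int_face: "K \<in> \<T> \<Longrightarrow> L \<in> \<T> \<Longrightarrow> (K \<inter> L) face_of K"
  using simplicial domain unfolding simplicial_mesh_def triangulation_def polyhedral_domain_def by blast+

lemma cell_convex: "K \<in> \<T> \<Longrightarrow> convex K"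
  and cell_compact: "K \<in> \<T> \<Longrightarrow> compact K"
  and cell_closed: "K \<in> \<T> \<Longrightarrow> closed K"
  and cell_aff_dim: "K \<in> \<T> \<Longrightarrow> aff_dim K = int DIM('a)"
  using cell_simplex convex_simplex compact_simplex closed_simplex aff_dim_simplex by blast+

lemma cell_interior: "K \<in> \<T> \<Longrightarrow> interior K \<noteq> {}"
  using cell_aff_dim[of K] cell_convex[of K]
  by (metis aff_dim_eq_full interior_rel_interior rel_interior_eq_empty aff_dim_empty of_nat_0_le_iff
       aff_dim_empty_eq not_one_le_zero DIM_positive of_nat_le_0_iff neg_0_le_iff_le int_one_le_iff_zero_less)

lemma cell_interior_subset: "K \<in> \<T> \<Longrightarrow> interior K \<subseteq> \<Omega>"
proof -
  assume "K \<in> \<T>"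
  then have "interior K \<subseteq> interior (closure \<Omega>)" using cover by (intro interior_mono) auto
  then show ?thesis using domain by (simp add: polyhedral_domain_def)
qed

lemma cell_Int_lowdim:
  assumes "K \<in> \<T>" "L \<in> \<T>" "K \<noteq> L"
  shows "aff_dim (K \<inter> L) < int DIM('a)"
proof (rule ccontr)
  assume "\<not> ?thesis"
  then have "K \<inter> L = K" "L \<inter> K = L"
    using face_of_aff_dim_lt[OF cell_convex[OF assms(1)] cell_Int_face[OF assms(1,2)]]
      face_of_aff_dim_lt[OF cell_convex[OF assms(2)] cell_Int_face[OF assms(2,1)]]
      cell_aff_dim assms by (auto simp: Int_commute)
  then show False using assms(3) by auto
qed

lemma cell_Int_interior:
  assumes "K \<in> \<T>" "L \<in> \<T>" "K \<noteq> L" shows "interior (K \<inter> L) = {}"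
  using cell_Int_lowdim[OF assms] aff_dim_nonempty_interior[of "K \<inter> L"] by auto

lemma negligible_cell_frontier: "K \<in> \<T> \<Longrightarrow> negligible (frontier K)"
  using cell_convex negligible_convex_frontier by blast

lemma facet_hyperplane:
  assumes "K \<in> \<T>" "e facet_of K"
  obtains a b where "a \<noteq> 0" "affine hull e = {y. a \<bullet> y = b}"
proof -
  have "aff_dim e = int DIM('a) - 1" using assms cell_aff_dim by (simp add: facet_of_def)
  then have "aff_dim e = int (DIM('a) - 1)" using DIM_positive[where 'a = 'a] by (simp add: of_nat_diff)
  then have "\<exists>a b. a \<noteq> 0 \<and> affine hull e = {y. a \<bullet> y = b}" unfolding aff_dim_eq_hyperplane .
  then show ?thesis using that by blast
qed

text \<open>A cell is not contained in the hyperplane of its facet, so it has a point on one of the two sides;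
  the half ball on this side lies in the cell.\<close>

lemma facet_half_ball:
  assumes K: "K \<in> \<T>" "e facet_of K" and H: "affine hull e = {y. a \<bullet> y = b}"
    and x: "x \<in> rel_interior e"
  shows "(\<exists>r>0. ball x r \<inter> {z. a \<bullet> z \<le> b} \<subseteq> K) \<or> (\<exists>r>0. ball x r \<inter> {z. a \<bullet> z \<ge> b} \<subseteq> K)"
proof -
  have conv: "convex K" and eK: "e \<subseteq> K" using cell_convex K facet_of_imp_subset by auto
  have "\<not> K \<subseteq> affine hull e"
  proof
    assume "K \<subseteq> affine hull e"
    then have "aff_dim K \<le> aff_dim e" by (metis aff_dim_affine_hull aff_dim_subset)
    then show False using K by (simp add: facet_of_def)
  qed
  then obtain y where y: "y \<in> K" "a \<bullet> y \<noteq> b" using H by auto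
  show ?thesis
  proof (cases "a \<bullet> y < b")
    case True
    then show ?thesis using half_ball_inside_convex[OF conv eK H x y(1)] by blast
  next
    case False
    then have "(- a) \<bullet> y < - b" using y by simp
    from half_ball_inside_convex[OF conv eK _ x y(1) this] show ?thesis
      using H by simp
  qed
qed

text \<open>Two cells that fill the same half ball overlap, which is impossible for different cells. This
  bounds the number of cells at a facet by the number of sides of a hyperplane.\<close>

lemma half_balls_meet_in_interior:
  fixes a x :: 'a
  assumes a: "a \<noteq> 0" and ax: "a \<bullet> x = b" and "r > 0" "s > 0"
    and "ball x r \<inter> {z. a \<bullet> z \<le> b} \<subseteq> K" "ball x s \<inter> {z. a \<bullet> z \<le> b} \<subseteq> L"
  shows "interior (K \<inter> L) \<noteq> {}"
proof -
  define t where "t = min r s"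
  have t: "t > 0" using assms by (simp add: t_def)
  let ?U = "ball x t \<inter> {z. a \<bullet> z < b}"
  have "?U \<subseteq> K \<inter> L" using assms by (auto simp: t_def)
  moreover have "open ?U" by (intro open_Int open_ball open_halfspace_lt)
  moreover have "x - (t / (2 * norm a)) *\<^sub>R a \<in> ?U"
    using a t ax by (auto simp: dist_norm inner_diff_right)
  ultimately show ?thesis by (metis empty_iff interiorI)
qed

lemma facet_of_two_cells:
  assumes "K \<in> \<T>" "L \<in> \<T>" "K \<noteq> L" "e facet_of K" "e facet_of L"
  shows "e = K \<inter> L" and "e \<in> interior_faces \<T>"
proof -
  have "e face_of (K \<inter> L)"
    using assms facet_of_imp_subset by (intro face_of_subset[OF facet_of_imp_face_of[OF assms(4)]]) blast+
  moreover have "convex (K \<inter> L)" using assms cell_convex by (simp add: convex_Int)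
  moreover have "aff_dim (K \<inter> L) \<le> aff_dim e"
    using cell_Int_lowdim[OF assms(1-3)] assms(4) cell_aff_dim[OF assms(1)] by (simp add: facet_of_def)
  ultimately show e: "e = K \<inter> L" using face_of_aff_dim_lt[of "K \<inter> L" e] by linarith
  show "e \<in> interior_faces \<T>" using assms e unfolding interior_faces_def by blast
qed

lemma not_facet_of_three_cells:
  assumes "K \<in> \<T>" "L \<in> \<T>" "M \<in> \<T>" "K \<noteq> L" "K \<noteq> M" "L \<noteq> M"
    "e facet_of K" "e facet_of L" "e facet_of M"
  shows False
proof -
  obtain a b where ab: "a \<noteq> 0" "affine hull e = {y. a \<bullet> y = b}" using facet_hyperplane assms by metis
  have "rel_interior e \<noteq> {}"
    using assms(7) rel_interior_eq_empty[of e] face_of_imp_convex by (auto simp: facet_of_def)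
  then obtain x where x: "x \<in> rel_interior e" by auto
  then have "x \<in> affine hull e" using rel_interior_subset[of e] hull_subset[of e affine] by blast
  then have ax: "a \<bullet> x = b" using ab by simp
  have flip: "{z. a \<bullet> z \<ge> b} = {z. (- a) \<bullet> z \<le> - b}" by simp
  note sides = facet_half_ball[OF assms(1,7) ab(2) x] facet_half_ball[OF assms(2,8) ab(2) x]
     facet_half_ball[OF assms(3,9) ab(2) x]
  have no: "\<not> (ball x r \<inter> {z. a' \<bullet> z \<le> b'} \<subseteq> P \<and> ball x s \<inter> {z. a' \<bullet> z \<le> b'} \<subseteq> Q)"
    if "a' \<noteq> 0" "a' \<bullet> x = b'" "r > 0" "s > 0" "P \<in> \<T>" "Q \<in> \<T>" "P \<noteq> Q" for r s P Q a' b'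
    using half_balls_meet_in_interior[OF that(1-4)] cell_Int_interior[OF that(5-7)] by blast
  have "\<not> ((\<exists>r>0. ball x r \<inter> {z. a \<bullet> z \<le> b} \<subseteq> P) \<and> (\<exists>r>0. ball x r \<inter> {z. a \<bullet> z \<le> b} \<subseteq> Q))"
    "\<not> ((\<exists>r>0. ball x r \<inter> {z. a \<bullet> z \<ge> b} \<subseteq> P) \<and> (\<exists>r>0. ball x r \<inter> {z. a \<bullet> z \<ge> b} \<subseteq> Q))"
    if "P \<in> \<T>" "Q \<in> \<T>" "P \<noteq> Q" for P Q
    using no[of a b _ _ P Q] no[of "- a" "- b" _ _ P Q] ab(1) ax that unfolding flip by (blast, force)
  from this[OF assms(1,2,4)] this[OF assms(1,3,5)] this[OF assms(2,3,6)] sides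
  show False by blast
qed

text \<open>The two cells at the facet fill different half balls, so together a full ball, which lies in the
  closure of the domain. The domain is the interior of its closure.\<close>

lemma interior_face_in_domain:
  assumes "K \<in> \<T>" "L \<in> \<T>" "K \<noteq> L" "e facet_of K" "e facet_of L" and x: "x \<in> rel_interior e"
  shows "x \<in> \<Omega>"
proof -
  obtain a b where ab: "a \<noteq> 0" "affine hull e = {y. a \<bullet> y = b}" using facet_hyperplane assms by metis
  have "x \<in> affine hull e" using x rel_interior_subset[of e] hull_subset[of e affine] by blast
  then have ax: "a \<bullet> x = b" using ab by simp
  have flip: "{z. a \<bullet> z \<ge> b} = {z. (- a) \<bullet> z \<le> - b}" by simp
  have int: "interior (K \<inter> L) = {}" using assms cell_Int_interior by simp
  have 1: "\<not> ((\<exists>r>0. ball x r \<inter> {z. a \<bullet> z \<le> b} \<subseteq> K) \<and> (\<exists>r>0. ball x r \<inter> {z. a \<bullet> z \<le> b} \<subseteq> L))"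
    using half_balls_meet_in_interior[OF ab(1) ax, of _ _ K L] int by blast
  have 2: "\<not> ((\<exists>r>0. ball x r \<inter> {z. a \<bullet> z \<ge> b} \<subseteq> K) \<and> (\<exists>r>0. ball x r \<inter> {z. a \<bullet> z \<ge> b} \<subseteq> L))"
    using half_balls_meet_in_interior[of "- a" x "- b" _ _ K L] int ab(1) ax unfolding flip by force
  have "\<exists>r s. r > 0 \<and> s > 0 \<and> ball x r \<inter> {z. a \<bullet> z \<le> b} \<subseteq> K \<union> L \<and> ball x s \<inter> {z. a \<bullet> z \<ge> b} \<subseteq> K \<union> L"
    using facet_half_ball[OF assms(1,4) ab(2) x] facet_half_ball[OF assms(2,5) ab(2) x] 1 2
    by (meson le_supI1 le_supI2)
  then obtain r s where rs: "r > 0" "s > 0" "ball x r \<inter> {z. a \<bullet> z \<le> b} \<subseteq> K \<union> L"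
    "ball x s \<inter> {z. a \<bullet> z \<ge> b} \<subseteq> K \<union> L" by blast
  have "ball x (min r s) \<subseteq> K \<union> L"
  proof
    fix z assume "z \<in> ball x (min r s)"
    then show "z \<in> K \<union> L" using rs by (cases "a \<bullet> z \<le> b") auto
  qed
  then have "ball x (min r s) \<subseteq> closure \<Omega>" using cover assms by blast
  then have "x \<in> interior (closure \<Omega>)" unfolding mem_interior using rs by (intro exI[of _ "min r s"]) auto
  then show ?thesis using domain by (simp add: polyhedral_domain_def)
qed

text \<open>Without this, the jump of a function over a face in both families would not control its trace
  on the boundary.\<close>

lemma interior_face_not_boundary: "interior_faces \<T> \<inter> boundary_faces \<Omega> \<T> = {}"
proof -
  have False if e: "e \<in> interior_faces \<T>" "e \<in> boundary_faces \<Omega> \<T>" for e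
  proof -
    obtain K L where KL: "K \<in> \<T>" "L \<in> \<T>" "K \<noteq> L" "e facet_of K" "e facet_of L"
      using e by (auto simp: interior_faces_def)
    have "rel_interior e \<noteq> {}"
      using KL(4) rel_interior_eq_empty[of e] face_of_imp_convex by (auto simp: facet_of_def)
    then obtain x where x: "x \<in> rel_interior e" by auto
    then have "x \<in> \<Omega>" using interior_face_in_domain KL by blast
    moreover have "x \<in> frontier \<Omega>" using x e rel_interior_subset by (auto simp: boundary_faces_def)
    ultimately show False using open_domain by (simp add: frontier_def interior_open)
  qed
  then show ?thesis by blast
qed

end

section \<open>The surface measure on faces\<close>

context
  fixes H :: "'a::euclidean_space set"
  assumes affine: "affine H" and nonempty: "H \<noteq> {}"
begin

lemma direction_onb:
  shows "pairwise orthogonal (direction_onb H)" "\<And>b. b \<in> direction_onb H \<Longrightarrow> norm b = 1"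
    "span (direction_onb H) = {x - y | x y. x \<in> H \<and> y \<in> H}" "finite (direction_onb H)"
proof -
  obtain a where a: "a \<in> H" using nonempty by auto
  have "{x - y | x y. x \<in> H \<and> y \<in> H} = (\<lambda>x. x - a) ` H"
  proof (intro equalityI subsetI)
    fix z assume "z \<in> {x - y | x y. x \<in> H \<and> y \<in> H}"
    then obtain x y where "x \<in> H" "y \<in> H" "z = x - y" by auto
    moreover have "a + 1 *\<^sub>R (x - y) \<in> H" using mem_affine_3_minus[OF affine a \<open>x \<in> H\<close> \<open>y \<in> H\<close>] .
    ultimately show "z \<in> (\<lambda>x. x - a) ` H" by (intro image_eqI[of _ _ "a + z"]) auto
  qed (use a in auto)
  then have "subspace {x - y | x y. x \<in> H \<and> y \<in> H}" using affine_diffs_subspace_subtract[OF affine a] by simp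
  then have ex: "\<exists>B. pairwise orthogonal B \<and> (\<forall>b\<in>B. norm b = 1) \<and>
      span B = {x - y | x y. x \<in> H \<and> y \<in> H}"
    by (rule orthonormal_basis_subspace) (intro exI conjI ballI)
  note props = someI_ex[OF ex, folded direction_onb_def]
  show "pairwise orthogonal (direction_onb H)" using props by (rule conjunct1)
  show "\<And>b. b \<in> direction_onb H \<Longrightarrow> norm b = 1" using props by simp
  show "span (direction_onb H) = {x - y | x y. x \<in> H \<and> y \<in> H}" using props by (elim conjE)
  show "finite (direction_onb H)" using props pairwise_orthogonal_imp_finite by (elim conjE)
qed

text \<open>The parametrization \<open>coord\<close> of \<open>H\<close> by coordinate vectors is the one that transports the product
  measure in the definition of \<open>flat_lebesgue\<close>.\<close>

abbreviation "dirs \<equiv> direction_onb H"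
abbreviation "org \<equiv> (SOME p. p \<in> H)"
abbreviation "coord \<equiv> (\<lambda>t. org + (\<Sum>b\<in>dirs. t b *\<^sub>R b))"

lemma org: "org \<in> H"
  using nonempty some_in_eq by blast

lemma inner_sum_dirs: "b \<in> dirs \<Longrightarrow> (\<Sum>c\<in>dirs. t c *\<^sub>R c) \<bullet> b = t b"
proof -
  assume b: "b \<in> dirs"
  have "(\<Sum>c\<in>dirs. t c *\<^sub>R c) \<bullet> b = (\<Sum>c\<in>dirs. if c = b then t c else 0)"
    unfolding inner_sum_left
  proof (intro sum.cong refl)
    fix c assume c: "c \<in> dirs"
    show "(t c *\<^sub>R c) \<bullet> b = (if c = b then t c else 0)"
      using direction_onb(1) direction_onb(2)[OF b] b c
      by (auto simp: pairwise_def orthogonal_def dot_square_norm)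
  qed
  then show ?thesis using b direction_onb(4) by simp
qed

lemma coord_in: "coord t \<in> H"
proof -
  have "(\<Sum>b\<in>dirs. t b *\<^sub>R b) \<in> span dirs" by (intro span_sum span_scale span_base)
  then obtain x y where xy: "x \<in> H" "y \<in> H" "(\<Sum>b\<in>dirs. t b *\<^sub>R b) = x - y"
    using direction_onb(3) by auto
  then show ?thesis using mem_affine_3_minus[OF affine org xy(1,2), of 1] by simp
qed

lemma coord_ex:
  assumes "x \<in> H" shows "\<exists>t. coord t = x"
proof -
  have "x - org \<in> span dirs" using direction_onb(3) assms org by auto
  then obtain t where "x - org = (\<Sum>b\<in>dirs. t b *\<^sub>R b)"
    using direction_onb(4) by (auto simp: span_finite)
  then show ?thesis by (intro exI[of _ t]) (simp add: algebra_simps)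
qed

lemma sets_flat: "sets (flat_lebesgue H) = sets borel" "space (flat_lebesgue H) = UNIV"
  by (simp_all add: flat_lebesgue_def)

abbreviation "prodm \<equiv> (\<Pi>\<^sub>M b\<in>dirs. (lborel :: real measure))"

lemma coord_measurable: "coord \<in> measurable prodm borel"
  by measurable

lemma emeasure_flat: "A \<in> sets borel \<Longrightarrow> emeasure (flat_lebesgue H) A = emeasure prodm (coord -` A \<inter> space prodm)"
  unfolding flat_lebesgue_def by (rule emeasure_distr[OF coord_measurable])

lemma emeasure_box: "emeasure prodm (Pi\<^sub>E dirs (\<lambda>b. {l b..u b})) = (\<Prod>b\<in>dirs. emeasure lborel {l b..u b::real})"
proof -
  interpret product_sigma_finite "\<lambda>_::'a. lborel :: real measure" by standard
  show ?thesis by (rule emeasure_PiM) (auto simp: direction_onb(4))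
qed

lemma flat_finite_on_bounded:
  assumes "bounded A" "A \<in> sets borel" shows "emeasure (flat_lebesgue H) A < \<infinity>"
proof -
  obtain r where r: "\<And>x. x \<in> A \<Longrightarrow> norm x \<le> r" using assms(1) by (auto simp: bounded_iff)
  define R where "R = r + norm org"
  have "coord -` A \<inter> space prodm \<subseteq> Pi\<^sub>E dirs (\<lambda>b. {-R..R})"
  proof
    fix t assume t: "t \<in> coord -` A \<inter> space prodm"
    have "\<bar>t b\<bar> \<le> R" if b: "b \<in> dirs" for b
    proof -
      have "t b = (coord t - org) \<bullet> b" using inner_sum_dirs[OF b, of t] by simp
      also have "\<bar>\<dots>\<bar> \<le> norm (coord t - org) * norm b" by (rule Cauchy_Schwarz_ineq2)
      also have "\<dots> \<le> norm (coord t) + norm org" using direction_onb(2)[OF b] norm_triangle_ineq4[of "coord t" org] by simp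
      also have "\<dots> \<le> R" using r[of "coord t"] t by (simp add: R_def)
      finally show ?thesis .
    qed
    then show "t \<in> Pi\<^sub>E dirs (\<lambda>b. {-R..R})"
      using t by (auto simp: space_PiM PiE_iff abs_le_iff) (metis minus_le_iff)
  qed
  then have "emeasure prodm (coord -` A \<inter> space prodm) \<le> emeasure prodm (Pi\<^sub>E dirs (\<lambda>b. {-R..R}))"
    by (intro emeasure_mono) (auto simp: direction_onb(4) intro!: sets_PiM_I_finite)
  also have "\<dots> < \<infinity>" unfolding emeasure_box
    by (auto simp: emeasure_lborel_Icc_eq power_less_top_ennreal)
  finally show ?thesis using emeasure_flat[OF assms(2)] by simp
qed

text \<open>The coordinates of the points of a small ball contain a cube, which has positive measure.\<close>

lemma flat_positive_on_open:
  assumes x: "x \<in> H" and d: "d > 0" and sub: "ball x d \<inter> H \<subseteq> A" and A: "A \<in> sets borel"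
  shows "emeasure (flat_lebesgue H) A > 0"
proof -
  obtain t0 where t0: "coord t0 = x" using coord_ex[OF x] by blast
  \<comment> \<open>Moving every coordinate by at most \<open>\<eta>\<close> moves the point by at most \<open>card dirs * \<eta> < d\<close>.\<close>
  define \<eta> where "\<eta> = d / (2 * (card dirs + 1))"
  have \<eta>: "\<eta> > 0" using d by (simp add: \<eta>_def)
  have "Pi\<^sub>E dirs (\<lambda>b. {t0 b - \<eta>..t0 b + \<eta>}) \<subseteq> coord -` A \<inter> space prodm"
  proof
    fix t assume t: "t \<in> Pi\<^sub>E dirs (\<lambda>b. {t0 b - \<eta>..t0 b + \<eta>})"
    have "coord t0 - coord t = (\<Sum>b\<in>dirs. (t0 b - t b) *\<^sub>R b)"
      by (simp add: sum_subtractf scaleR_left_diff_distrib)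
    also have "norm \<dots> \<le> (\<Sum>b\<in>dirs. norm ((t0 b - t b) *\<^sub>R b))" by (rule norm_sum)
    also have "\<dots> \<le> (\<Sum>b\<in>dirs. \<eta>)"
    proof (rule sum_mono)
      fix b assume b: "b \<in> dirs"
      then have "t b \<in> {t0 b - \<eta>..t0 b + \<eta>}" using t by (auto simp: PiE_iff)
      then show "norm ((t0 b - t b) *\<^sub>R b) \<le> \<eta>" using direction_onb(2)[OF b] by (simp add: abs_le_iff)
    qed
    also have "\<dots> = card dirs * \<eta>" by simp
    also have "\<dots> < d" using d unfolding \<eta>_def by (simp add: field_simps) (smt (verit) mult_nonneg_nonneg of_nat_0_le_iff)
    finally have "coord t \<in> ball x d" using t0 by (simp add: dist_norm)
    then have "coord t \<in> A" using sub coord_in by blast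
    then show "t \<in> coord -` A \<inter> space prodm" using t by (auto simp: space_PiM PiE_iff)
  qed
  then have "emeasure prodm (Pi\<^sub>E dirs (\<lambda>b. {t0 b - \<eta>..t0 b + \<eta>})) \<le> emeasure prodm (coord -` A \<inter> space prodm)"
    using A by (intro emeasure_mono measurable_sets[OF coord_measurable])
  moreover have "0 < emeasure prodm (Pi\<^sub>E dirs (\<lambda>b. {t0 b - \<eta>..t0 b + \<eta>}))"
  proof -
    have "(\<Prod>b\<in>dirs. emeasure lborel {t0 b - \<eta>..t0 b + \<eta>}) \<noteq> 0"
      using \<eta> direction_onb(4) by simp
    then show ?thesis unfolding emeasure_box using zero_less_iff_neq_zero by blast
  qed
  ultimately show ?thesis using emeasure_flat[OF A] by simp
qed

end

context
  fixes e :: "'a::euclidean_space set"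
  assumes conv: "convex e" and comp: "compact e" and ne: "e \<noteq> {}"
begin

private abbreviation "H \<equiv> affine hull e"

private lemma H: "affine H" "H \<noteq> {}"
  using ne by auto

private lemma borel_e: "e \<in> sets borel"
  using comp borel_compact by blast

lemma face_integrable:
  assumes "continuous_on UNIV f"
  shows "integrable (flat_lebesgue H) (\<lambda>x. indicator e x * (f x :: real))"
proof -
  have "continuous_on e f" using assms continuous_on_subset by blast
  then have "bounded (f ` e)" using comp compact_continuous_image compact_imp_bounded by blast
  then obtain C where C: "\<And>x. x \<in> e \<Longrightarrow> \<bar>f x\<bar> \<le> C" by (auto simp: bounded_iff)
  have f: "f \<in> borel_measurable borel" using assms borel_measurable_continuous_onI by blast
  show ?thesis
  proof (rule Bochner_Integration.integrable_bound)
    show "integrable (flat_lebesgue H) (\<lambda>x. C * indicator e x)"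
      using flat_finite_on_bounded[OF H _ borel_e] comp compact_imp_bounded borel_e
      by (intro integrable_mult_right integrable_real_indicator) (auto simp: sets_flat[OF H])
    show "(\<lambda>x. indicator e x * f x) \<in> borel_measurable (flat_lebesgue H)"
      using f borel_e by (simp add: measurable_cong_sets[OF sets_flat(1)[OF H] refl])
    have "norm (indicator e x * f x) \<le> norm (C * indicator e x)" for x
      using C[of x] by (cases "x \<in> e") auto
    then show "AE x in flat_lebesgue H. norm (indicator e x * f x) \<le> norm (C * indicator e x)"
      by (intro AE_I2)
  qed
qed

lemma face_integral_eq: "face_integral e f = (\<integral>x. indicator e x * f x \<partial>flat_lebesgue H)"
  by (simp add: face_integral_def set_lebesgue_integral_def)

lemma face_integral_linear:
  assumes "continuous_on UNIV f" "continuous_on UNIV g"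
  shows "face_integral e (\<lambda>x. \<alpha> * f x + \<beta> * g x) = \<alpha> * face_integral e f + \<beta> * face_integral e g"
proof -
  have "face_integral e (\<lambda>x. \<alpha> * f x + \<beta> * g x) = (\<integral>x. \<alpha> * (indicator e x * f x) + \<beta> * (indicator e x * g x) \<partial>flat_lebesgue H)"
    unfolding face_integral_eq by (simp add: algebra_simps)
  also have "\<dots> = \<alpha> * face_integral e f + \<beta> * face_integral e g"
    unfolding face_integral_eq using assms[THEN face_integrable]
    by (subst Bochner_Integration.integral_add) (auto simp del: indicator_simps)
  finally show ?thesis .
qed

lemma face_integral_zero: "(\<And>x. x \<in> e \<Longrightarrow> f x = 0) \<Longrightarrow> face_integral e f = 0"
  unfolding face_integral_eq by (intro integral_eq_zero_AE AE_I2) (auto simp: indicator_def)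

lemma face_integral_nonneg: "(\<And>x. 0 \<le> f x) \<Longrightarrow> 0 \<le> face_integral e f"
  unfolding face_integral_eq by (intro integral_nonneg_AE AE_I2) auto

text \<open>The area is positive because a face has relative interior points. Hence the weight
  \<open>1 / face_area e powr p\<close> of the penalty is positive.\<close>

lemma face_area_pos: "face_area e > 0"
proof -
  obtain x where "x \<in> rel_interior e" using rel_interior_eq_empty[OF conv] ne by auto
  then obtain d where "x \<in> e" "d > 0" "ball x d \<inter> H \<subseteq> e" by (auto simp: mem_rel_interior_ball)
  then have "emeasure (flat_lebesgue H) e > 0"
    using flat_positive_on_open[OF H _ _ _ borel_e, of x d] by (simp add: hull_inc)
  then show ?thesis unfolding face_area_def
    using flat_finite_on_bounded[OF H compact_imp_bounded[OF comp] borel_e]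
    by (simp add: measure_def enn2real_positive_iff)
qed

text \<open>A continuous square with zero integral vanishes almost everywhere, hence on the relative interior,
  where nonempty open sets have positive measure, and by closure on all of \<open>e\<close>.\<close>

lemma face_integral_square_zero:
  assumes f: "continuous_on UNIV f" and 0: "face_integral e (\<lambda>x. f x * f x) = 0" and x: "x \<in> e"
  shows "f x = 0"
proof -
  let ?g = "\<lambda>x. indicator e x * (f x * f x)"
  have gi: "integrable (flat_lebesgue H) ?g" using f by (intro face_integrable continuous_intros)
  have ae: "AE x in flat_lebesgue H. ?g x = 0"
    using 0 gi unfolding face_integral_eq by (subst (asm) integral_nonneg_eq_0_iff_AE) auto
  have fz: "f y = 0" if y: "y \<in> rel_interior e" for y
  proof (rule ccontr)
    assume "f y \<noteq> 0"
    obtain d where d: "y \<in> e" "d > 0" "ball y d \<inter> H \<subseteq> e" using y by (auto simp: mem_rel_interior_ball)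
    have "open {z. f z \<noteq> 0}" using f by (intro open_Collect_neq continuous_intros)
    then obtain d' where d': "d' > 0" "ball y d' \<subseteq> {z. f z \<noteq> 0}"
      using \<open>f y \<noteq> 0\<close> open_contains_ball by blast
    let ?A = "e \<inter> {z. f z \<noteq> 0}"
    have A: "?A \<in> sets borel" using \<open>open {z. f z \<noteq> 0}\<close> borel_e by auto
    have "emeasure (flat_lebesgue H) ?A > 0"
    proof (rule flat_positive_on_open[OF H _ _ _ A])
      show "y \<in> H" using d by (simp add: hull_inc)
      show "min d d' > 0" using d d' by simp
      show "ball y (min d d') \<inter> H \<subseteq> ?A" using d d' by auto
    qed
    moreover have "?A = {x \<in> space (flat_lebesgue H). ?g x \<noteq> 0}"
      by (auto simp: sets_flat[OF H] indicator_def)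
    moreover have "emeasure (flat_lebesgue H) {x \<in> space (flat_lebesgue H). ?g x \<noteq> 0} = 0"
      using ae A calculation(2) by (subst (asm) AE_iff_measurable[OF _ refl]) (auto simp: sets_flat[OF H])
    ultimately show False by simp
  qed
  have "x \<in> closure (rel_interior e)"
    using x closure_subset convex_closure_rel_interior[OF conv] by auto
  moreover have "closed {z. f z = 0}" using f by (intro closed_Collect_eq continuous_intros)
  ultimately show ?thesis using fz closure_minimal[of "rel_interior e" "{z. f z = 0}"] by auto
qed

end

section \<open>Test functions and uniqueness of weak gradients\<close>

lemma AE_not_in_negligible: "negligible N \<Longrightarrow> AE x in lebesgue. x \<notin> N"
  by (intro AE_not_in) (simp add: negligible_iff_null_sets)

lemma compact_support_bounded:
  fixes f :: "'a::euclidean_space \<Rightarrow> real"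
  assumes "continuous_on UNIV f" "compact S" "\<And>x. x \<notin> S \<Longrightarrow> f x = 0"
  obtains C where "C \<ge> 0" "\<And>x. \<bar>f x\<bar> \<le> C"
proof -
  have "bounded (f ` S)"
    by (intro compact_imp_bounded compact_continuous_image continuous_on_subset[OF assms(1)] assms(2)) auto
  then obtain C where C: "\<And>x. x \<in> S \<Longrightarrow> \<bar>f x\<bar> \<le> C" by (auto simp: bounded_iff)
  have "\<bar>f x\<bar> \<le> \<bar>C\<bar>" for x
    using C[of x] assms(3)[of x] by (cases "x \<in> S") auto
  then show ?thesis using that[of "\<bar>C\<bar>"] by simp
qed

lemma test_function_facts:
  assumes "\<phi> \<in> test_functions \<Omega>"
  shows "(\<phi> has_derivative frechet_derivative \<phi> (at x)) (at x)"
    and "continuous_on UNIV \<phi>"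
    and "b \<in> Basis \<Longrightarrow> continuous_on UNIV (\<lambda>x. frechet_derivative \<phi> (at x) b)"
    and "compact (closure {x. \<phi> x \<noteq> 0})" and "closure {x. \<phi> x \<noteq> 0} \<subseteq> \<Omega>"
    and "x \<notin> closure {x. \<phi> x \<noteq> 0} \<Longrightarrow> \<phi> x = 0"
    and "x \<notin> closure {x. \<phi> x \<noteq> 0} \<Longrightarrow> frechet_derivative \<phi> (at x) b = 0"
proof -
  have C: "Ck k \<phi>" for k using assms by (simp add: test_functions_def)
  show "(\<phi> has_derivative frechet_derivative \<phi> (at x)) (at x)"
    using C[of 1] by (simp add: frechet_derivative_works)
  show "continuous_on UNIV \<phi>" using C[of 0] by simp
  show "b \<in> Basis \<Longrightarrow> continuous_on UNIV (\<lambda>x. frechet_derivative \<phi> (at x) b)" using C[of 1] by simp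
  show "compact (closure {x. \<phi> x \<noteq> 0})" "closure {x. \<phi> x \<noteq> 0} \<subseteq> \<Omega>"
    using assms by (auto simp: test_functions_def)
  assume x: "x \<notin> closure {x. \<phi> x \<noteq> 0}"
  then show "\<phi> x = 0" using closure_subset[of "{x. \<phi> x \<noteq> 0}"] by blast
  have "((\<lambda>x. 0) has_derivative (\<lambda>h. 0)) (at x)" by simp
  then have "(\<phi> has_derivative (\<lambda>h. 0)) (at x)"
  proof (rule has_derivative_transform_within_open[where s = "- closure {x. \<phi> x \<noteq> 0}"])
    fix y assume "y \<in> - closure {x. \<phi> x \<noteq> 0}"
    then show "0 = \<phi> y" using closure_subset[of "{x. \<phi> x \<noteq> 0}"] by force
  qed (use x in auto)
  then show "frechet_derivative \<phi> (at x) b = 0" by (metis frechet_derivative_at)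
qed

text \<open>The flat function \<open>exp (- 1 / t)\<close>, extended by 0, together with all functions that occur in its
  derivatives.\<close>

definition flat_exp :: "real poly \<Rightarrow> real \<Rightarrow> real" where
  "flat_exp p t = (if t > 0 then poly p (inverse t) * exp (- inverse t) else 0)"

lemma poly_exp_decay: "((\<lambda>x. poly p x * exp (- x)) \<longlongrightarrow> 0) (at_top :: real filter)"
proof -
  have "(\<lambda>x::real. poly p x * exp (- x)) = (\<lambda>x. \<Sum>i\<le>degree p. coeff p i * (x ^ i / exp x))"
    by (simp add: poly_altdef exp_minus sum_distrib_right divide_inverse mult.assoc)
  moreover have "((\<lambda>x::real. \<Sum>i\<le>degree p. coeff p i * (x ^ i / exp x)) \<longlongrightarrow> 0) at_top"
    by (intro tendsto_null_sum tendsto_mult_right_zero tendsto_power_div_exp_0)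
  ultimately show ?thesis by simp
qed

text \<open>The derivative is again of the form \<open>flat_exp q\<close>. At 0 the difference quotient is, for positive
  \<open>h\<close>, a polynomial in \<open>1 / h\<close> times \<open>exp (- 1 / h)\<close>, which tends to 0.\<close>

lemma flat_exp_DERIV:
  "(flat_exp p has_real_derivative flat_exp ([:0, 0, 1:] * (p - pderiv p)) t) (at t)"
proof -
  consider "t > 0" | "t < 0" | "t = 0" by linarith
  then show ?thesis
  proof cases
    case 1
    have "((\<lambda>t. poly p (inverse t) * exp (- inverse t)) has_real_derivative
        flat_exp ([:0, 0, 1:] * (p - pderiv p)) t) (at t)"
      using 1 by (auto intro!: derivative_eq_intros poly_DERIV[THEN DERIV_chain2]
          simp: flat_exp_def algebra_simps power2_eq_square)
    then show ?thesis
      by (rule has_field_derivative_transform_within_open[where S = "{0<..}"])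
        (use 1 in \<open>auto simp: flat_exp_def\<close>)
  next
    case 2
    have "((\<lambda>t. 0) has_real_derivative 0) (at t)" by simp
    then have "(flat_exp p has_real_derivative 0) (at t)"
      by (rule has_field_derivative_transform_within_open[where S = "{..<0}"])
        (use 2 in \<open>auto simp: flat_exp_def\<close>)
    then show ?thesis using 2 by (simp add: flat_exp_def)
  next
    case 3
    have "((\<lambda>h. flat_exp p h / h) \<longlongrightarrow> 0) (at_left 0)"
      by (rule tendsto_eventually) (auto simp: flat_exp_def eventually_at_filter)
    moreover have "((\<lambda>h. flat_exp p h / h) \<longlongrightarrow> 0) (at_right 0)"
    proof -
      have "((\<lambda>h::real. poly (pCons 0 p) (inverse h) * exp (- inverse h)) \<longlongrightarrow> 0) (at_right 0)"
        by (rule filterlim_compose[OF poly_exp_decay filterlim_inverse_at_top_right])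
      moreover have "\<forall>\<^sub>F h in at_right 0. poly (pCons 0 p) (inverse h) * exp (- inverse h) = flat_exp p h / h"
        by (auto simp: eventually_at_filter flat_exp_def field_simps)
      ultimately show ?thesis by (rule Lim_transform_eventually)
    qed
    ultimately have "((\<lambda>h. flat_exp p h / h) \<longlongrightarrow> 0) (at 0)" by (rule filterlim_split_at)
    then show ?thesis using 3 by (simp add: DERIV_def flat_exp_def)
  qed
qed

text \<open>This class contains the bumps below and is closed under partial derivatives, so its members are
  infinitely differentiable.\<close>

inductive flat_exp_algebra :: "('a::euclidean_space \<Rightarrow> real) \<Rightarrow> bool" where
  base: "flat_exp_algebra (\<lambda>x. flat_exp p (w \<bullet> x + l))"
| const: "flat_exp_algebra (\<lambda>x. c)"
| add: "flat_exp_algebra f \<Longrightarrow> flat_exp_algebra g \<Longrightarrow> flat_exp_algebra (\<lambda>x. f x + g x)"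
| mult: "flat_exp_algebra f \<Longrightarrow> flat_exp_algebra g \<Longrightarrow> flat_exp_algebra (\<lambda>x. f x * g x)"

lemma flat_exp_algebra_derivative:
  "flat_exp_algebra f \<Longrightarrow> \<exists>f'. (\<forall>x. (f has_derivative f' x) (at x)) \<and> (\<forall>b. flat_exp_algebra (\<lambda>x. f' x b))"
proof (induction rule: flat_exp_algebra.induct)
  case (base p w l)
  let ?q = "[:0, 0, 1:] * (p - pderiv p)"
  have "((\<lambda>x. flat_exp p (w \<bullet> x + l)) has_derivative (\<lambda>b. flat_exp ?q (w \<bullet> x + l) * (w \<bullet> b))) (at x)" for x
    using flat_exp_DERIV[of p "w \<bullet> x + l"] unfolding has_field_derivative_def
    by (rule has_derivative_compose[rotated]) (auto intro!: derivative_eq_intros)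
  moreover have "flat_exp_algebra (\<lambda>x. flat_exp ?q (w \<bullet> x + l) * (w \<bullet> b))" for b
    by (intro flat_exp_algebra.intros)
  ultimately show ?case
    by (intro exI[of _ "\<lambda>x b. flat_exp ?q (w \<bullet> x + l) * (w \<bullet> b)"] conjI allI)
next
  case (const c)
  have "((\<lambda>x. c) has_derivative (\<lambda>b. 0)) (at x)" for x by simp
  then show ?case
    by (intro exI[of _ "\<lambda>x b. 0"] conjI allI flat_exp_algebra.const)
next
  case (add f g)
  then obtain f' g' where "\<forall>x. (f has_derivative f' x) (at x)" "\<forall>x. (g has_derivative g' x) (at x)"
    "\<forall>b. flat_exp_algebra (\<lambda>x. f' x b)" "\<forall>b. flat_exp_algebra (\<lambda>x. g' x b)" by blast
  then show ?case
    by (intro exI[of _ "\<lambda>x b. f' x b + g' x b"] conjI allI has_derivative_add flat_exp_algebra.add) auto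
next
  case (mult f g)
  then obtain f' g' where d: "\<forall>x. (f has_derivative f' x) (at x)" "\<forall>x. (g has_derivative g' x) (at x)"
    "\<forall>b. flat_exp_algebra (\<lambda>x. f' x b)" "\<forall>b. flat_exp_algebra (\<lambda>x. g' x b)" by blast
  then show ?case using mult.hyps
    by (intro exI[of _ "\<lambda>x b. f x * g' x b + f' x b * g x"] conjI allI has_derivative_mult
       flat_exp_algebra.intros) auto
qed

lemma flat_exp_algebra_Ck: "flat_exp_algebra f \<Longrightarrow> Ck k f"
proof (induction k arbitrary: f)
  case 0
  then obtain f' where "\<forall>x. (f has_derivative f' x) (at x)" using flat_exp_algebra_derivative by blast
  then have "\<forall>x. isCont f x" using has_derivative_continuous by blast
  then show ?case by (simp add: continuous_at_imp_continuous_on)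
next
  case (Suc k)
  then obtain f' where f': "\<forall>x. (f has_derivative f' x) (at x)" "\<forall>b. flat_exp_algebra (\<lambda>x. f' x b)"
    using flat_exp_algebra_derivative by blast
  then have "frechet_derivative f (at x) = f' x" for x using frechet_derivative_at by metis
  moreover have "f differentiable (at x)" for x using f' unfolding differentiable_def by blast
  ultimately show ?case using f' Suc.IH by auto
qed

text \<open>The factor \<open>r\<close> steepens the bump: for \<open>r\<close> to infinity it tends to the indicator function of the
  open box.\<close>

definition box_bump :: "'a::euclidean_space \<Rightarrow> 'a \<Rightarrow> real \<Rightarrow> 'a \<Rightarrow> real" where
  "box_bump l u r x = (\<Prod>b\<in>Basis. flat_exp 1 (r * (b \<bullet> x - b \<bullet> l)) * flat_exp 1 (r * (b \<bullet> u - b \<bullet> x)))"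

lemma flat_exp_1: "0 \<le> flat_exp 1 t" "flat_exp 1 t \<le> 1" "flat_exp 1 t \<noteq> 0 \<longleftrightarrow> t > 0"
  by (auto simp: flat_exp_def)

lemma box_bump_bounds: "0 \<le> box_bump l u r x" "box_bump l u r x \<le> 1"
  unfolding box_bump_def
  by (intro prod_nonneg mult_nonneg_nonneg flat_exp_1 prod_le_1 conjI mult_le_one)+

lemma box_bump_support: "r > 0 \<Longrightarrow> {x. box_bump l u r x \<noteq> 0} = box l u"
  by (auto simp: box_bump_def flat_exp_1 mem_box inner_commute zero_less_mult_iff)

lemma box_bump_smooth: "flat_exp_algebra (box_bump l u r)"
proof -
  have "flat_exp_algebra (\<lambda>x. \<Prod>b\<in>B. flat_exp 1 (r * (b \<bullet> x - b \<bullet> l)) * flat_exp 1 (r * (b \<bullet> u - b \<bullet> x)))"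
    if "finite B" for B
    using that
  proof (induction B rule: finite_induct)
    case (insert b B)
    have 1: "(\<lambda>x. flat_exp 1 (r * (b \<bullet> x - b \<bullet> l))) = (\<lambda>x. flat_exp 1 ((r *\<^sub>R b) \<bullet> x + (- r * (b \<bullet> l))))"
      by (simp add: algebra_simps)
    have 2: "(\<lambda>x. flat_exp 1 (r * (b \<bullet> u - b \<bullet> x))) = (\<lambda>x. flat_exp 1 (((- r) *\<^sub>R b) \<bullet> x + (r * (b \<bullet> u))))"
      by (simp add: algebra_simps)
    have "flat_exp_algebra (\<lambda>x. flat_exp 1 (r * (b \<bullet> x - b \<bullet> l)))"
      unfolding 1 by (rule flat_exp_algebra.base)
    moreover have "flat_exp_algebra (\<lambda>x. flat_exp 1 (r * (b \<bullet> u - b \<bullet> x)))"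
      unfolding 2 by (rule flat_exp_algebra.base)
    ultimately have "flat_exp_algebra (\<lambda>x. flat_exp 1 (r * (b \<bullet> x - b \<bullet> l)) * flat_exp 1 (r * (b \<bullet> u - b \<bullet> x)))"
      by (rule flat_exp_algebra.mult)
    then show ?case using insert flat_exp_algebra.mult by simp
  qed (simp add: flat_exp_algebra.const)
  then show ?thesis unfolding box_bump_def by simp
qed

lemma box_bump_test_function:
  assumes "r > 0" "cbox l u \<subseteq> \<Omega>" shows "box_bump l u r \<in> test_functions \<Omega>"
proof -
  have "closure {x. box_bump l u r x \<noteq> 0} \<subseteq> cbox l u"
    unfolding box_bump_support[OF assms(1)] by (intro closure_minimal box_subset_cbox closed_cbox)
  moreover from this have "compact (closure {x. box_bump l u r x \<noteq> 0})"
    using bounded_cbox bounded_subset compact_eq_bounded_closed by blast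
  ultimately show ?thesis
    using assms flat_exp_algebra_Ck[OF box_bump_smooth] by (auto simp: test_functions_def)
qed

lemma box_bump_tendsto: "(\<lambda>n. box_bump l u (real (Suc n)) x) \<longlonglongrightarrow> indicator (box l u) x"
proof (cases "x \<in> box l u")
  case True
  have 1: "(\<lambda>n. flat_exp 1 (real (Suc n) * s)) \<longlonglongrightarrow> 1" if "s > 0" for s
  proof -
    have "(\<lambda>n. exp (- (inverse s * inverse (real (Suc n))))) \<longlonglongrightarrow> exp (- (inverse s * 0))"
      by (intro tendsto_intros LIMSEQ_inverse_real_of_nat)
    moreover have "flat_exp 1 (real (Suc n) * s) = exp (- (inverse s * inverse (real (Suc n))))" for n
      using that by (simp add: flat_exp_def)
    ultimately show ?thesis by simp
  qed
  have "(\<lambda>n. box_bump l u (real (Suc n)) x) \<longlonglongrightarrow> (\<Prod>b\<in>(Basis::'a set). 1 * 1)"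
    unfolding box_bump_def using True
    by (intro tendsto_prod tendsto_mult 1) (auto simp: mem_box inner_commute)
  then show ?thesis using True by simp
next
  case False
  then have "box_bump l u (real (Suc n)) x = 0" for n
    using box_bump_support[of "real (Suc n)" l u] by auto
  then show ?thesis using False by simp
qed

lemma sigma_finite_lebesgue: "sigma_finite_measure (lebesgue :: 'a::euclidean_space measure)"
proof
  obtain A :: "'a set set" where A: "countable A" "A \<subseteq> sets lborel" "\<Union>A = space lborel" "\<forall>a\<in>A. emeasure lborel a \<noteq> \<infinity>"
    using lborel.sigma_finite_countable by metis
  then show "\<exists>A. countable A \<and> A \<subseteq> sets lebesgue \<and> \<Union>A = space (lebesgue :: 'a measure) \<and> (\<forall>a\<in>A. emeasure lebesgue a \<noteq> \<infinity>)"
    by (intro exI[of _ A]) (auto simp: subset_iff)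
qed

text \<open>Open boxes form an intersection-stable generator of the Borel sets, so the integrals over all Borel
  sets vanish, and with them those over all Lebesgue sets.\<close>

lemma vanishing_box_integrals:
  fixes g :: "'a::euclidean_space \<Rightarrow> real"
  assumes g: "integrable lebesgue g" and box: "\<And>a b. (\<integral>x. indicator (box a b) x * g x \<partial>lebesgue) = 0"
    and tot: "(\<integral>x. g x \<partial>lebesgue) = 0"
  shows "AE x in lebesgue. g x = 0"
proof (rule sigma_finite_measure.density_zero[OF sigma_finite_lebesgue g])
  have si: "set_integrable lebesgue A g" if "A \<in> sets lebesgue" for A
    unfolding set_integrable_def using integrable_mult_indicator[OF that g] .
  have borel: "set_lebesgue_integral lebesgue A g = 0" if "A \<in> sets borel" for A
  proof -
    let ?G = "range (\<lambda>(a, b). box a b :: 'a set)"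
    have eq: "sets borel = sigma_sets UNIV ?G" unfolding borel_eq_box by (rule sets_measure_of) auto
    have st: "Int_stable ?G" by (auto simp: Int_stable_def box_Int_box)
    have sA: "A \<in> sigma_sets UNIV ?G" using that eq by simp
    show ?thesis
    proof (rule sigma_sets_induct_disjoint[where P = "\<lambda>A. set_lebesgue_integral lebesgue A g = 0", OF st _ sA])
      show "?G \<subseteq> Pow UNIV" by simp
      show "\<And>A. A \<in> ?G \<Longrightarrow> set_lebesgue_integral lebesgue A g = 0"
        using box by (auto simp: set_lebesgue_integral_def)
      show "set_lebesgue_integral lebesgue {} g = 0" by (simp add: set_lebesgue_integral_def)
    next
      fix A assume A: "A \<in> sigma_sets UNIV ?G" "set_lebesgue_integral lebesgue A g = 0"
      then have "A \<in> sets lebesgue" using eq by auto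
      then have "set_lebesgue_integral lebesgue (UNIV - A) g = 0"
        using set_integral_Un[of A "UNIV - A" lebesgue g] A(2) tot si[of A] si[of "UNIV - A"]
          sets.compl_sets[of A lebesgue]
        by (auto simp: set_lebesgue_integral_def)
      then show "set_lebesgue_integral lebesgue (UNIV - A) g = 0" .
    next
      fix A :: "nat \<Rightarrow> 'a set" assume A: "disjoint_family A" "range A \<subseteq> sigma_sets UNIV ?G"
        "\<And>i. set_lebesgue_integral lebesgue (A i) g = 0"
      have "A i \<in> sets borel" for i using A(2) unfolding eq by blast
      then have Ai: "A i \<in> sets lebesgue" for i by simp
      have "set_lebesgue_integral lebesgue (\<Union>i. A i) g = (\<Sum>i. set_lebesgue_integral lebesgue (A i) g)"
        using A(1) Ai by (intro lebesgue_integral_countable_add si) (auto simp: disjoint_family_on_def)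
      then show "set_lebesgue_integral lebesgue (\<Union>i. A i) g = 0" using A(3) by simp
    qed
  qed
  fix A :: "'a set" assume "A \<in> sets lebesgue"
  then obtain S N N' where S: "A = S \<union> N" "N \<subseteq> N'" "N' \<in> null_sets lborel" "S \<in> sets lborel"
    by (rule sets_completionE)
  have "AE x in lebesgue. x \<notin> N'"
    using S(3) by (intro AE_not_in) (simp add: null_sets_completionI)
  then have "AE x in lebesgue. indicator A x *\<^sub>R g x = indicator S x *\<^sub>R g x"
    by eventually_elim (use S in \<open>auto simp: indicator_def\<close>)
  then have "set_lebesgue_integral lebesgue A g = set_lebesgue_integral lebesgue S g"
    unfolding set_lebesgue_integral_def using g \<open>A \<in> sets lebesgue\<close> S(4)
    by (intro integral_cong_AE borel_measurable_scaleR borel_measurable_indicator borel_measurable_integrable) auto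
  then show "set_lebesgue_integral lebesgue A g = 0" using borel S by simp
qed

text \<open>Bumps turn the assumption into vanishing integrals over all boxes inside the domain; countably
  many closed boxes exhaust the domain.\<close>

lemma fundamental_lemma_of_calculus_of_variations:
  fixes f :: "'a::euclidean_space \<Rightarrow> real"
  assumes \<Omega>: "open \<Omega>" and f: "integrable (lebesgue_on \<Omega>) f"
    and test: "\<And>\<phi>. \<phi> \<in> test_functions \<Omega> \<Longrightarrow> (\<integral>x. f x * \<phi> x \<partial>lebesgue_on \<Omega>) = 0"
  shows "AE x in lebesgue_on \<Omega>. f x = 0"
proof -
  have m: "\<Omega> \<in> sets lebesgue" using \<Omega> by (simp add: lborelD)
  define f0 where "f0 x = indicator \<Omega> x * f x" for x
  have f0: "integrable lebesgue f0"
    unfolding f0_def using f m by (simp add: integrable_restrict_space)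
  have test0: "(\<integral>x. f0 x * \<phi> x \<partial>lebesgue) = 0" if "\<phi> \<in> test_functions \<Omega>" for \<phi>
    using test[OF that] m by (simp add: integral_restrict_space f0_def mult.assoc)
  have box: "(\<integral>x. indicator (box l u) x * f0 x \<partial>lebesgue) = 0" if sub: "cbox l u \<subseteq> \<Omega>" for l u
  proof -
    let ?s = "\<lambda>n x. box_bump l u (real (Suc n)) x * f0 x"
    have bump_m: "box_bump l u r \<in> borel_measurable lebesgue" for r
      using flat_exp_algebra_Ck[OF box_bump_smooth, of 0 l u r]
      by (intro measurable_completion) (simp add: borel_measurable_continuous_onI)
    have "(\<lambda>n. \<integral>x. ?s n x \<partial>lebesgue) \<longlonglongrightarrow> (\<integral>x. indicator (box l u) x * f0 x \<partial>lebesgue)"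
    proof (rule integral_dominated_convergence)
      show "integrable lebesgue (\<lambda>x. \<bar>f0 x\<bar>)" using f0 by simp
      show "?s n \<in> borel_measurable lebesgue" for n using bump_m f0 by (intro borel_measurable_times) auto
      show "(\<lambda>x. indicator (box l u) x * f0 x) \<in> borel_measurable lebesgue"
        using f0 by (intro borel_measurable_times borel_measurable_indicator) auto
      show "AE x in lebesgue. (\<lambda>n. ?s n x) \<longlonglongrightarrow> indicator (box l u) x * f0 x"
        by (intro AE_I2 tendsto_mult box_bump_tendsto tendsto_const)
      show "AE x in lebesgue. norm (?s n x) \<le> \<bar>f0 x\<bar>" for n
        using box_bump_bounds[of l u "real (Suc n)"]
        by (intro AE_I2) (simp add: abs_mult mult_left_le_one_le)
    qed
    moreover have "(\<integral>x. ?s n x \<partial>lebesgue) = 0" for n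
      using test0[OF box_bump_test_function[OF _ sub, of "real (Suc n)"]] by (simp add: mult.commute)
    ultimately have "(\<lambda>n. 0) \<longlonglongrightarrow> (\<integral>x. indicator (box l u) x * f0 x \<partial>lebesgue)" by simp
    then show ?thesis using LIMSEQ_unique tendsto_const by metis
  qed
  have local: "AE x in lebesgue. x \<in> cbox l u \<longrightarrow> f0 x = 0" if sub: "cbox l u \<subseteq> \<Omega>" for l u
  proof -
    have "AE x in lebesgue. indicator (box l u) x * f0 x = 0"
    proof (rule vanishing_box_integrals)
      show "integrable lebesgue (\<lambda>x. indicator (box l u) x * f0 x)"
        using integrable_mult_indicator[OF _ f0, of "box l u"] by simp
      show "(\<integral>x. indicator (box l u) x * f0 x \<partial>lebesgue) = 0" by (rule box[OF sub])
      fix a b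
      have "(\<lambda>x. indicator (box a b) x * (indicator (box l u) x * f0 x)) = (\<lambda>x. indicator (box a b \<inter> box l u) x * f0 x)"
        by (auto simp: indicator_def)
      moreover obtain a' b' where ab: "box a b \<inter> box l u = box a' b'" by (simp add: box_Int_box)
      moreover have "(\<integral>x. indicator (box a' b') x * f0 x \<partial>lebesgue) = 0"
      proof (cases "box a' b' = {}")
        case False
        moreover have sub': "box a' b' \<subseteq> box l u" using ab by blast
        ultimately have "closure (box a' b') = cbox a' b'" "closure (box l u) = cbox l u"
          by (auto intro!: closure_box)
        then have "cbox a' b' \<subseteq> cbox l u" using closure_mono[OF sub'] by simp
        then show ?thesis using box sub by blast
      qed simp
      ultimately show "(\<integral>x. indicator (box a b) x * (indicator (box l u) x * f0 x) \<partial>lebesgue) = 0" by simp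
    qed
    moreover have "AE x in lebesgue. x \<notin> cbox l u - box l u"
      by (rule AE_not_in_negligible[OF negligible_frontier_interval])
    ultimately show ?thesis by eventually_elim auto
  qed
  obtain \<D> where D: "countable \<D>" "\<And>X. X \<in> \<D> \<Longrightarrow> \<exists>a b. X = cbox a b" "\<Union>\<D> = \<Omega>"
    using open_countable_Union_open_cbox[OF \<Omega>] by metis
  have "AE x in lebesgue. \<forall>X\<in>\<D>. x \<in> X \<longrightarrow> f0 x = 0"
    using D local by (subst AE_ball_countable[OF D(1)]) blast
  then have "AE x in lebesgue. x \<in> \<Omega> \<longrightarrow> f x = 0"
    by eventually_elim (use D(3) in \<open>force simp: f0_def indicator_def\<close>)
  then show ?thesis using m by (simp add: AE_restrict_space_iff)
qed

lemma weak_gradient_unique: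
  fixes g h :: "'a::euclidean_space \<Rightarrow> 'a"
  assumes \<Omega>: "open \<Omega>" "bounded \<Omega>" and g: "g \<in> L2 \<Omega>" "is_weak_gradient \<Omega> u g"
    and h: "h \<in> L2 \<Omega>" "is_weak_gradient \<Omega> u h"
  shows "AE x in lebesgue_on \<Omega>. g x = h x"
proof -
  have m: "\<Omega> \<in> sets lebesgue" using \<Omega> by (simp add: lborelD)
  have fin: "finite_measure (lebesgue_on \<Omega>)"
    using \<Omega> m by (intro finite_measure_lebesgue_on bounded_set_imp_lmeasurable)
  have int: "integrable (lebesgue_on \<Omega>) (\<lambda>x. k x \<bullet> b)" if "k \<in> L2 \<Omega>" "b \<in> Basis" for k :: "'a \<Rightarrow> 'a" and b
  proof (rule Bochner_Integration.integrable_bound)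
    have k: "k \<in> borel_measurable (lebesgue_on \<Omega>)" "integrable (lebesgue_on \<Omega>) (\<lambda>x. (norm (k x))\<^sup>2)"
      using that by (auto simp: L2_def)
    show "integrable (lebesgue_on \<Omega>) (\<lambda>x. 1 + (norm (k x))\<^sup>2)"
      using k fin by (intro Bochner_Integration.integrable_add finite_measure.integrable_const) auto
    show "(\<lambda>x. k x \<bullet> b) \<in> borel_measurable (lebesgue_on \<Omega>)" using k by simp
    have "\<bar>k x \<bullet> b\<bar> \<le> 1 + (norm (k x))\<^sup>2" for x
    proof -
      have "\<bar>k x \<bullet> b\<bar> \<le> norm (k x)" using Basis_le_norm[OF that(2)] .
      moreover have "0 \<le> (norm (k x) - 1)\<^sup>2" by simp
      then have "2 * norm (k x) \<le> 1 + (norm (k x))\<^sup>2" by (simp add: power2_eq_square algebra_simps)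
      ultimately show ?thesis using norm_ge_zero[of "k x"] by linarith
    qed
    then show "AE x in lebesgue_on \<Omega>. norm (k x \<bullet> b) \<le> norm (1 + (norm (k x))\<^sup>2)"
      by (intro AE_I2) (simp add: abs_of_nonneg add_nonneg_nonneg)
  qed
  have "AE x in lebesgue_on \<Omega>. g x \<bullet> b - h x \<bullet> b = 0" if b: "b \<in> Basis" for b
  proof (rule fundamental_lemma_of_calculus_of_variations[OF \<Omega>(1)])
    show "integrable (lebesgue_on \<Omega>) (\<lambda>x. g x \<bullet> b - h x \<bullet> b)" using int g h b by simp
    fix \<phi> assume t: "\<phi> \<in> test_functions \<Omega>"
    note \<phi> = test_function_facts[OF t]
    obtain C where C: "C \<ge> 0" "\<And>x. \<bar>\<phi> x\<bar> \<le> C"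
      using compact_support_bounded[OF \<phi>(2,4,6)] by blast
    have meas: "\<phi> \<in> borel_measurable (lebesgue_on \<Omega>)"
      using \<phi>(2) by (intro continuous_imp_measurable_on_sets_lebesgue m) (auto intro: continuous_on_subset)
    have i: "integrable (lebesgue_on \<Omega>) (\<lambda>x. (k x \<bullet> b) * \<phi> x)" if "k \<in> L2 \<Omega>" for k :: "'a \<Rightarrow> 'a"
    proof (rule Bochner_Integration.integrable_bound)
      show "integrable (lebesgue_on \<Omega>) (\<lambda>x. C * (k x \<bullet> b))" using int[OF that b] by simp
      show "(\<lambda>x. k x \<bullet> b * \<phi> x) \<in> borel_measurable (lebesgue_on \<Omega>)"
        using borel_measurable_integrable[OF int[OF that b]] meas by simp
      show "AE x in lebesgue_on \<Omega>. norm (k x \<bullet> b * \<phi> x) \<le> norm (C * (k x \<bullet> b))"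
        using C by (intro AE_I2) (simp add: abs_mult mult.commute mult_right_mono)
    qed
    have "(\<integral>x. (g x \<bullet> b) * \<phi> x \<partial>lebesgue_on \<Omega>) = (\<integral>x. (h x \<bullet> b) * \<phi> x \<partial>lebesgue_on \<Omega>)"
      using g(2)[unfolded is_weak_gradient_def, rule_format, OF t b]
        h(2)[unfolded is_weak_gradient_def, rule_format, OF t b] by linarith
    then show "(\<integral>x. (g x \<bullet> b - h x \<bullet> b) * \<phi> x \<partial>lebesgue_on \<Omega>) = 0"
      using i[OF g(1)] i[OF h(1)] by (simp add: left_diff_distrib)
  qed
  then have "AE x in lebesgue_on \<Omega>. \<forall>b\<in>Basis. g x \<bullet> b - h x \<bullet> b = 0"
    by (intro AE_finite_allI) auto
  then show ?thesis by eventually_elim (auto intro: euclidean_eqI)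
qed

lemma weak_gradient_chosen:
  assumes "g \<in> L2 \<Omega>" "is_weak_gradient \<Omega> u g"
  shows "weak_gradient \<Omega> u \<in> L2 \<Omega>" "is_weak_gradient \<Omega> u (weak_gradient \<Omega> u)"
  unfolding weak_gradient_def using someI[of "\<lambda>g. g \<in> L2 \<Omega> \<and> is_weak_gradient \<Omega> u g" g] assms by blast+

section \<open>Weak gradients of continuous piecewise affine functions\<close>

text \<open>The lines in direction \<open>b\<close> through a set of dimension at most \<open>d - 2\<close> lie in an affine subspace of
  dimension at most \<open>d - 1\<close>. So almost every line in a given direction avoids the faces of codimension 2.\<close>

lemma negligible_translates_of_lowdim:
  fixes F :: "'a::euclidean_space set"
  assumes "aff_dim F < int DIM('a) - 1"
  shows "negligible {y + t *\<^sub>R b | y t. y \<in> F}"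
proof (cases "F = {}")
  case False
  then obtain p where p: "p \<in> F" by auto
  let ?A = "affine hull (insert (p + b) F)"
  have "aff_dim ?A \<le> aff_dim F + 1" by (simp add: aff_dim_insert)
  then have "interior ?A = {}" using assms aff_dim_nonempty_interior[of ?A] by force
  then have "negligible ?A" by (simp add: negligible_convex_interior affine_imp_convex)
  moreover have "{y + t *\<^sub>R b | y t. y \<in> F} \<subseteq> ?A"
  proof clarify
    fix y t assume y: "y \<in> F"
    have "y + t *\<^sub>R ((p + b) - p) \<in> ?A"
      using y p by (intro mem_affine_3_minus) (auto simp: hull_inc)
    then show "y + t *\<^sub>R b \<in> ?A" by simp
  qed
  ultimately show ?thesis by (rule negligible_subset)
qed simp

context mesh begin

text \<open>Off the interiors of the cells the value is 0; inside the domain this affects only a null set. The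
  sum makes the function Borel measurable and linear in \<open>q\<close>.\<close>

definition cellwise :: "('a set \<Rightarrow> 'a \<Rightarrow> 'b::real_vector) \<Rightarrow> 'a \<Rightarrow> 'b" where
  "cellwise q x = (\<Sum>K\<in>\<T>. indicator (interior K) x *\<^sub>R q K x)"

lemma interior_cells_disjoint:
  assumes "K \<in> \<T>" "L \<in> \<T>" "x \<in> interior K" "x \<in> interior L" shows "K = L"
  using cell_Int_interior[of K L] assms by (auto simp: interior_Int)

lemma cellwise_eq:
  assumes "K \<in> \<T>" "x \<in> interior K" shows "cellwise q x = q K x"
proof -
  have "cellwise q x = (\<Sum>L\<in>\<T>. if L = K then q K x else 0)"
    unfolding cellwise_def using assms interior_cells_disjoint[OF assms(1)]
    by (intro sum.cong) (auto simp: indicator_def)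
  then show ?thesis using assms finite_cells by simp
qed

lemma cellwise_outside: "(\<And>K. K \<in> \<T> \<Longrightarrow> x \<notin> interior K) \<Longrightarrow> cellwise q x = 0"
  by (simp add: cellwise_def)

definition skeleton :: "'a set" where
  "skeleton = (\<Union>K\<in>\<T>. frontier K)"

lemma negligible_skeleton: "negligible skeleton"
  unfolding skeleton_def using finite_cells negligible_cell_frontier by (intro negligible_Union) auto

lemma off_skeleton:
  assumes "x \<notin> skeleton" shows "x \<notin> closure \<Omega> \<or> (\<exists>K\<in>\<T>. x \<in> interior K)"
proof -
  have "x \<in> interior K" if "K \<in> \<T>" "x \<in> K" for K
    using assms that cell_closed[OF that(1)] by (auto simp: skeleton_def frontier_def)
  then show ?thesis using cover by blast
qed

text \<open>The auxiliary function \<open>w\<close> is the product of \<open>q\<close> and \<open>\<phi>\<close> along the line, with the value at a point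
  of several cells taken from any of them. The choice does not matter: inside the domain two such
  cells meet in a face of dimension at least \<open>d - 1\<close>, hence in a common facet, where their values
  agree; outside the domain \<open>\<phi>\<close> is 0. So \<open>w\<close> is Lipschitz on each set of a finite closed cover of the
  line.\<close>

lemma lipschitz_across_cells:
  fixes b :: 'a
  assumes phi: "\<And>y. y \<notin> \<Omega> \<Longrightarrow> \<phi> y = (0::real)"
    and facet: "\<And>K L e y. K \<in> \<T> \<Longrightarrow> L \<in> \<T> \<Longrightarrow> e facet_of K \<Longrightarrow> e facet_of L \<Longrightarrow> y \<in> e \<Longrightarrow> q K y = q L y"
    and lip: "\<And>K s t x. K \<in> \<T> \<Longrightarrow> \<bar>q K (x + s *\<^sub>R b) * \<phi> (x + s *\<^sub>R b) - q K (x + t *\<^sub>R b) * \<phi> (x + t *\<^sub>R b)\<bar> \<le> M * \<bar>s - t\<bar>"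
    and M: "M \<ge> 0"
    and generic: "\<And>F K t. K \<in> \<T> \<Longrightarrow> F face_of K \<Longrightarrow> aff_dim F < int DIM('a) - 1 \<Longrightarrow> x + t *\<^sub>R b \<notin> F"
    and sk: "x \<notin> skeleton" "x + h *\<^sub>R b \<notin> skeleton"
  shows "\<bar>cellwise q (x + h *\<^sub>R b) * \<phi> (x + h *\<^sub>R b) - cellwise q x * \<phi> x\<bar> \<le> M * \<bar>h\<bar>"
proof -
  define \<gamma> where "\<gamma> t = x + t *\<^sub>R b" for t
  define w where "w t = (if \<gamma> t \<in> \<Omega> then q (SOME K. K \<in> \<T> \<and> \<gamma> t \<in> K) (\<gamma> t) * \<phi> (\<gamma> t) else 0)" for t
  have w: "w t = q K (\<gamma> t) * \<phi> (\<gamma> t)" if K: "K \<in> \<T>" "\<gamma> t \<in> K" for t K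
  proof (cases "\<gamma> t \<in> \<Omega>")
    case True
    define L where "L = (SOME K. K \<in> \<T> \<and> \<gamma> t \<in> K)"
    have L: "L \<in> \<T>" "\<gamma> t \<in> L" using someI[of "\<lambda>K. K \<in> \<T> \<and> \<gamma> t \<in> K" K] K unfolding L_def by auto
    have "q L (\<gamma> t) = q K (\<gamma> t)"
    proof (cases "L = K")
      case False
      have fK: "(L \<inter> K) face_of K" and fL: "(L \<inter> K) face_of L"
        using cell_Int_face[OF K(1) L(1)] cell_Int_face[OF L(1) K(1)] by (simp_all add: Int_commute)
      have "aff_dim (L \<inter> K) \<ge> int DIM('a) - 1"
        using generic[OF K(1) fK, of t] K L by (force simp: \<gamma>_def)
      then have "aff_dim (L \<inter> K) = int DIM('a) - 1" using cell_Int_lowdim[OF L(1) K(1) False] by simp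
      then have "(L \<inter> K) facet_of K" "(L \<inter> K) facet_of L"
        using fK fL K L cell_aff_dim by (auto simp: facet_of_def)
      then show ?thesis using facet[OF L(1) K(1)] K L by blast
    qed simp
    then show ?thesis using True by (simp add: w_def L_def)
  qed (simp add: w_def phi)
  \<comment> \<open>The parameters in a cell, and under the index \<open>None\<close> those outside the domain.\<close>
  define U where "U = (\<lambda>K::'a set option. case K of None \<Rightarrow> {t. \<gamma> t \<notin> \<Omega>} | Some K \<Rightarrow> {t. \<gamma> t \<in> K})"
  let ?I = "insert None (Some ` \<T>)"
  have cont: "continuous_on UNIV \<gamma>" unfolding \<gamma>_def by (intro continuous_intros)
  have "M-lipschitz_on (U i) w" if "i \<in> ?I" for i
  proof (cases i)
    case None
    then show ?thesis using M by (intro lipschitz_onI) (auto simp: U_def w_def)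
  next
    case (Some K)
    then have K: "K \<in> \<T>" using that by auto
    show ?thesis using M Some w[OF K] lip[OF K, of x]
      by (intro lipschitz_onI) (auto simp: U_def dist_real_def \<gamma>_def)
  qed
  moreover have "closed (U i)" if "i \<in> ?I" for i
  proof (cases i)
    case None
    then have "U i = \<gamma> -` (- \<Omega>)" by (auto simp: U_def)
    then show ?thesis using cont open_domain by (simp add: closed_vimage continuous_on_eq_continuous_at closed_Compl)
  next
    case (Some K)
    then have "U i = \<gamma> -` K" by (auto simp: U_def)
    then show ?thesis using cont that Some cell_closed by (auto intro: closed_vimage)
  qed
  moreover have "{u..v} \<subseteq> (\<Union>i\<in>?I. U i)" for u v
  proof
    fix t assume "t \<in> {u..v}"
    show "t \<in> (\<Union>i\<in>?I. U i)"
    proof (cases "\<gamma> t \<in> \<Omega>")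
      case True
      then obtain K where "K \<in> \<T>" "\<gamma> t \<in> K" using cover closure_subset by blast
      then show ?thesis by (auto simp: U_def)
    qed (simp add: U_def)
  qed
  ultimately have lipw: "M-lipschitz_on {u..v} w" for u v
    using finite_cells M by (intro lipschitz_on_closed_Union[where I = ?I and U = U]) auto
  have "dist (w h) (w 0) \<le> M * dist h 0"
    by (rule lipschitz_onD[OF lipw[of "- \<bar>h\<bar>" "\<bar>h\<bar>"]]) auto
  moreover have "w t = cellwise q (\<gamma> t) * \<phi> (\<gamma> t)" if t: "\<gamma> t \<notin> skeleton" for t
    using off_skeleton[OF t]
  proof
    assume "\<gamma> t \<notin> closure \<Omega>"
    then have "\<gamma> t \<notin> \<Omega>" using closure_subset by blast
    then show ?thesis by (simp add: w_def phi)
  next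
    assume "\<exists>K\<in>\<T>. \<gamma> t \<in> interior K"
    then obtain K where K: "K \<in> \<T>" "\<gamma> t \<in> interior K" by blast
    then have "\<gamma> t \<in> K" using interior_subset by blast
    then show ?thesis using w[OF K(1), of t] by (simp only: cellwise_eq[OF K])
  qed
  from this[of h] this[of 0] have "w h = cellwise q (\<gamma> h) * \<phi> (\<gamma> h)" "w 0 = cellwise q (\<gamma> 0) * \<phi> (\<gamma> 0)"
    using sk by (auto simp: \<gamma>_def)
  ultimately show ?thesis by (simp add: dist_real_def \<gamma>_def)
qed

end

context mesh begin

lemma cellwise_measurable:
  fixes f :: "'a set \<Rightarrow> 'a \<Rightarrow> 'b::euclidean_space"
  assumes "\<And>K. K \<in> \<T> \<Longrightarrow> continuous_on UNIV (f K)"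
  shows "cellwise f \<in> borel_measurable borel"
proof -
  have "(\<lambda>x. \<Sum>K\<in>\<T>. indicator (interior K) x *\<^sub>R f K x) \<in> borel_measurable borel"
    using assms by (intro borel_measurable_sum borel_measurable_scaleR borel_measurable_indicator
      borel_measurable_continuous_onI) auto
  then show ?thesis by (simp add: cellwise_def[abs_def])
qed

lemma uniformly_bounded_on_cells:
  fixes f :: "'a set \<Rightarrow> 'a \<Rightarrow> real"
  assumes f: "\<And>K. K \<in> \<T> \<Longrightarrow> continuous_on UNIV (f K)" and S: "compact S"
    and supp: "\<And>K x. K \<in> \<T> \<Longrightarrow> x \<notin> S \<Longrightarrow> f K x = 0"
  obtains M where "M \<ge> 0" "\<And>K x. K \<in> \<T> \<Longrightarrow> \<bar>f K x\<bar> \<le> M"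
proof -
  have "\<forall>K\<in>\<T>. \<exists>C\<ge>0. \<forall>x. \<bar>f K x\<bar> \<le> C"
    using compact_support_bounded[OF f S supp] by metis
  then obtain C where C: "\<And>K. K \<in> \<T> \<Longrightarrow> C K \<ge> 0 \<and> (\<forall>x. \<bar>f K x\<bar> \<le> C K)" by metis
  have "C K \<le> (\<Sum>K\<in>\<T>. C K)" if "K \<in> \<T>" for K
    using C that finite_cells by (intro member_le_sum) auto
  then have "\<bar>f K x\<bar> \<le> (\<Sum>K\<in>\<T>. C K)" if "K \<in> \<T>" for K x
    using C that order_trans by blast
  then show ?thesis using that[of "\<Sum>K\<in>\<T>. C K"] C by (simp add: sum_nonneg)
qed

lemma cellwise_integrable:
  fixes f :: "'a set \<Rightarrow> 'a \<Rightarrow> real"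
  assumes f: "\<And>K. K \<in> \<T> \<Longrightarrow> continuous_on UNIV (f K)" and S: "compact S"
    and supp: "\<And>K x. K \<in> \<T> \<Longrightarrow> x \<notin> S \<Longrightarrow> f K x = 0"
  shows "integrable lborel (cellwise f)"
proof -
  obtain M where "M \<ge> 0" and M: "\<And>K x. K \<in> \<T> \<Longrightarrow> \<bar>f K x\<bar> \<le> M"
    using uniformly_bounded_on_cells[of f, OF f S supp] by blast
  have bound: "norm (cellwise f x) \<le> norm (M * indicator S x)" for x
  proof (cases "\<exists>K\<in>\<T>. x \<in> interior K")
    case True
    then obtain K where K: "K \<in> \<T>" "x \<in> interior K" by blast
    then show ?thesis unfolding cellwise_eq[OF K] using M[OF K(1), of x] supp[OF K(1), of x] \<open>M \<ge> 0\<close>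
      by (cases "x \<in> S") auto
  next
    case False
    then have "cellwise f x = 0" by (intro cellwise_outside) blast
    then show ?thesis by simp
  qed
  show ?thesis
  proof (rule Bochner_Integration.integrable_bound)
    show "integrable lborel (\<lambda>x. M * indicator S x)"
      using S emeasure_lborel_cbox_finite emeasure_compact_finite
      by (intro integrable_mult_right integrable_real_indicator) (auto simp: borel_compact)
    show "cellwise f \<in> borel_measurable lborel" using cellwise_measurable[OF f] by simp
    show "AE x in lborel. norm (cellwise f x) \<le> norm (M * indicator S x)" using bound by (intro AE_I2)
  qed
qed

lemma cellwise_mult:
  fixes q :: "'a set \<Rightarrow> 'a \<Rightarrow> real"
  shows "cellwise q x * c x = cellwise (\<lambda>K x. q K x * c x) x"
  by (simp add: cellwise_def sum_distrib_right mult.assoc)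

lemma cellwise_inner: "cellwise (\<lambda>K x. \<beta> K) x \<bullet> b = cellwise (\<lambda>K x. \<beta> K \<bullet> b) x"
  by (simp add: cellwise_def inner_sum_left)

lemma cellwise_add: "cellwise f x + cellwise g x = cellwise (\<lambda>K x. f K x + g K x) x"
  by (simp add: cellwise_def sum.distrib scaleR_right_distrib)

lemma AE_generic_line:
  fixes b :: 'a
  shows "AE x in lborel. \<forall>K F t. K \<in> \<T> \<longrightarrow> F face_of K \<longrightarrow> aff_dim F < int DIM('a) - 1 \<longrightarrow> x + t *\<^sub>R b \<notin> F"
proof -
  define \<F> where "\<F> = {F. \<exists>K\<in>\<T>. F face_of K \<and> aff_dim F < int DIM('a) - 1}"
  have "finite (\<Union>K\<in>\<T>. {F. F face_of K})"
    using finite_cells cell_simplex simplex_imp_polytope by (auto intro!: finite_polytope_faces)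
  then have "finite \<F>" by (rule rev_finite_subset) (auto simp: \<F>_def)
  then have "negligible (\<Union>F\<in>\<F>. {y + t *\<^sub>R b | y t. y \<in> F})"
  proof (intro negligible_Union)
    fix T assume "T \<in> (\<lambda>F. {y + t *\<^sub>R b | y t. y \<in> F}) ` \<F>"
    then obtain F where "F \<in> \<F>" "T = {y + t *\<^sub>R b | y t. y \<in> F}" by blast
    then show "negligible T" using negligible_translates_of_lowdim[of F b] by (auto simp: \<F>_def)
  qed simp
  then have "AE x in lebesgue. x \<notin> (\<Union>F\<in>\<F>. {y + t *\<^sub>R b | y t. y \<in> F})"
    by (rule AE_not_in_negligible)
  then have "AE x in lborel. x \<notin> (\<Union>F\<in>\<F>. {y + t *\<^sub>R b | y t. y \<in> F})"
    by (simp only: AE_completion_iff)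
  then show ?thesis
  proof eventually_elim
    case (elim x)
    show ?case
    proof (intro allI impI notI)
      fix K F t assume F: "K \<in> \<T>" "F face_of K" "aff_dim F < int DIM('a) - 1" "x + t *\<^sub>R b \<in> F"
      then have "F \<in> \<F>" by (auto simp: \<F>_def)
      moreover have "x \<in> {y + t *\<^sub>R b | y t. y \<in> F}"
        using F(4) by (auto intro!: exI[of _ "x + t *\<^sub>R b"] exI[of _ "- t"])
      ultimately show False using elim by blast
    qed
  qed
qed

lemma AE_off_skeleton: "AE x in lborel. x + c \<notin> skeleton"
proof -
  have "negligible ((+) (- c) ` skeleton)" by (rule negligible_translation[OF negligible_skeleton])
  then have "AE x in lebesgue. x \<notin> (+) (- c) ` skeleton"
    by (rule AE_not_in_negligible)
  then have "AE x in lborel. x \<notin> (+) (- c) ` skeleton" by (simp only: AE_completion_iff)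
  then show ?thesis
    by eventually_elim (auto simp: image_iff algebra_simps)
qed

lemma integral_translate:
  fixes f :: "'a \<Rightarrow> real"
  assumes "f \<in> borel_measurable borel"
  shows "(\<integral>x. f (x + c) \<partial>lborel) = (\<integral>x. f x \<partial>lborel)"
    and "integrable lborel f \<Longrightarrow> integrable lborel (\<lambda>x. f (x + c))"
proof -
  have "(\<integral>x. f x \<partial>distr lborel borel ((+) c)) = (\<integral>x. f (c + x) \<partial>lborel)"
    using assms by (intro integral_distr) auto
  then show "(\<integral>x. f (x + c) \<partial>lborel) = (\<integral>x. f x \<partial>lborel)" by (simp add: lborel_distr_plus add.commute)
  have "integrable (distr lborel borel ((+) c)) f = integrable lborel (\<lambda>x. f (c + x))"
    using assms by (intro integrable_distr_eq) auto
  then show "integrable lborel f \<Longrightarrow> integrable lborel (\<lambda>x. f (x + c))"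
    by (simp add: lborel_distr_plus add.commute)
qed

text \<open>Write \<open>W\<close> for the product of the piecewise affine function and \<open>\<phi>\<close>. Its difference quotients with
  steps \<open>1 / (n + 1)\<close> in direction \<open>b\<close> have integral 0. They converge off the cell boundaries to the
  piecewise derivative \<open>D\<close>, so \<open>D\<close> has integral 0; the product rule splits \<open>D\<close> into the two terms of
  the claim.\<close>

lemma cellwise_integration_by_parts:
  fixes b :: 'a
  assumes phi: "\<phi> \<in> test_functions \<Omega>" and b: "b \<in> Basis"
    and q: "\<And>K x. K \<in> \<T> \<Longrightarrow> q K x = \<alpha> K + \<beta> K \<bullet> x"
    and facet: "\<And>K L e y. K \<in> \<T> \<Longrightarrow> L \<in> \<T> \<Longrightarrow> e facet_of K \<Longrightarrow> e facet_of L \<Longrightarrow> y \<in> e \<Longrightarrow> q K y = q L y"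
  shows "(\<integral>x. cellwise q x * frechet_derivative \<phi> (at x) b \<partial>lborel)
      = - (\<integral>x. (cellwise (\<lambda>K x. \<beta> K) x \<bullet> b) * \<phi> x \<partial>lborel)"
    and "integrable lborel (\<lambda>x. cellwise q x * frechet_derivative \<phi> (at x) b)"
    and "integrable lborel (\<lambda>x. (cellwise (\<lambda>K x. \<beta> K) x \<bullet> b) * \<phi> x)"
proof -
  define S where "S = closure {x. \<phi> x \<noteq> 0}"
  let ?d = "\<lambda>x. frechet_derivative \<phi> (at x) b"
  note F = test_function_facts[OF phi, folded S_def]
  have S: "compact S" "S \<subseteq> \<Omega>" using F(4,5) by auto
  have phi0: "\<phi> x = 0" and d0: "?d x = 0" if "x \<notin> S" for x using F(6,7)[OF that] by auto
  have q_cont: "continuous_on UNIV (q K)" if "K \<in> \<T>" for K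
    using q[OF that] by (simp add: continuous_on_cong[OF refl q[OF that]] continuous_intros)
  define D where "D K x = q K x * ?d x + (\<beta> K \<bullet> b) * \<phi> x" for K x
  have D_cont: "continuous_on UNIV (D K)" if "K \<in> \<T>" for K
    unfolding D_def using F(2) F(3)[OF b] q_cont[OF that] by (intro continuous_intros) auto
  have D0: "D K x = 0" if "x \<notin> S" for K x using phi0[OF that] d0[OF that] by (simp add: D_def)
  obtain M where M: "M \<ge> 0" and DM: "\<And>K x. K \<in> \<T> \<Longrightarrow> \<bar>D K x\<bar> \<le> M"
    using uniformly_bounded_on_cells[of D, OF D_cont S(1) D0] by blast
  have line: "((\<lambda>t. q K (x + t *\<^sub>R b) * \<phi> (x + t *\<^sub>R b)) has_real_derivative D K (x + t *\<^sub>R b)) (at t)"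
    if K: "K \<in> \<T>" for K x t
  proof -
    have "((\<lambda>t. x + t *\<^sub>R b) has_derivative (\<lambda>h. h *\<^sub>R b)) (at t)" by (auto intro!: derivative_eq_intros)
    then have "((\<lambda>t. \<phi> (x + t *\<^sub>R b)) has_derivative (\<lambda>h. frechet_derivative \<phi> (at (x + t *\<^sub>R b)) (h *\<^sub>R b))) (at t)"
      using F(1) by (rule has_derivative_compose)
    moreover have "frechet_derivative \<phi> (at y) (h *\<^sub>R b) = h * frechet_derivative \<phi> (at y) b" for y h
      using linear_scale[OF has_derivative_linear[OF F(1)[of y]]] by simp
    moreover have "(\<lambda>h. h * r) = (*) r" for r :: real by (auto simp: mult.commute)
    ultimately have 1: "((\<lambda>t. \<phi> (x + t *\<^sub>R b)) has_real_derivative ?d (x + t *\<^sub>R b)) (at t)"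
      unfolding has_field_derivative_def by simp
    have "((\<lambda>t. \<alpha> K + \<beta> K \<bullet> (x + t *\<^sub>R b)) has_real_derivative \<beta> K \<bullet> b) (at t)"
      by (auto simp: inner_add_right intro!: derivative_eq_intros)
    then have 2: "((\<lambda>t. q K (x + t *\<^sub>R b)) has_real_derivative \<beta> K \<bullet> b) (at t)" using q[OF K] by simp
    show ?thesis unfolding D_def using DERIV_mult[OF 2 1] by (simp add: algebra_simps)
  qed
  have lip: "\<bar>q K (x + s *\<^sub>R b) * \<phi> (x + s *\<^sub>R b) - q K (x + t *\<^sub>R b) * \<phi> (x + t *\<^sub>R b)\<bar> \<le> M * \<bar>s - t\<bar>"
    if K: "K \<in> \<T>" for K s t x
  proof -
    have "norm (q K (x + s *\<^sub>R b) * \<phi> (x + s *\<^sub>R b) - q K (x + t *\<^sub>R b) * \<phi> (x + t *\<^sub>R b)) \<le> M * norm (s - t)"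
      using line[OF K] DM[OF K]
      by (intro field_differentiable_bound[of UNIV "\<lambda>t. q K (x + t *\<^sub>R b) * \<phi> (x + t *\<^sub>R b)" "\<lambda>t. D K (x + t *\<^sub>R b)"]) auto
    then show ?thesis by simp
  qed
  define W where "W x = cellwise q x * \<phi> x" for x
  have W_cell: "W = cellwise (\<lambda>K x. q K x * \<phi> x)"
    unfolding W_def by (rule ext) (rule cellwise_mult)
  have cont_qphi: "continuous_on UNIV (\<lambda>x. q K x * \<phi> x)" if "K \<in> \<T>" for K
    using q_cont[OF that] F(2) by (intro continuous_intros)
  have W_meas: "W \<in> borel_measurable borel" unfolding W_cell by (rule cellwise_measurable[OF cont_qphi])
  have W_int: "integrable lborel W" unfolding W_cell
    by (rule cellwise_integrable[OF cont_qphi S(1)]) (auto simp: phi0)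
  \<comment> \<open>The steps have length at most 1, so all difference quotients vanish outside the ball of radius \<open>R + 1\<close>.\<close>
  obtain R where R: "\<And>x. x \<in> S \<Longrightarrow> norm x \<le> R" using compact_imp_bounded[OF S(1)] by (auto simp: bounded_iff)
  let ?s = "\<lambda>n. inverse (real (Suc n))"
  let ?f = "\<lambda>n x. (W (x + ?s n *\<^sub>R b) - W x) / ?s n"
  have bound: "\<bar>?f n x\<bar> \<le> M * indicator (cball 0 (R + 1)) x"
    if "\<bar>W (x + ?s n *\<^sub>R b) - W x\<bar> \<le> M * \<bar>?s n\<bar>" for n x
  proof (cases "norm x \<le> R + 1")
    case True
    have "\<bar>r / ?s n\<bar> \<le> M" if "\<bar>r\<bar> \<le> M * \<bar>?s n\<bar>" for r
    proof -
      have "\<bar>r / ?s n\<bar> = \<bar>r\<bar> / \<bar>?s n\<bar>" by (rule abs_divide)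
      also have "\<dots> \<le> M" using that by (subst pos_divide_le_eq) auto
      finally show ?thesis .
    qed
    from this[OF that] show ?thesis using True by simp
  next
    case False
    have "norm x \<le> norm (x + ?s n *\<^sub>R b) + norm (?s n *\<^sub>R b)"
      using norm_triangle_ineq4[of "x + ?s n *\<^sub>R b" "?s n *\<^sub>R b"] by simp
    moreover have "norm (?s n *\<^sub>R b) \<le> 1" using b by (simp add: inverse_le_1_iff)
    ultimately have "x \<notin> S" "x + ?s n *\<^sub>R b \<notin> S" using False R by force+
    then show ?thesis using phi0 M by (simp add: W_def)
  qed
  have "(\<lambda>n. \<integral>x. ?f n x \<partial>lborel) \<longlonglongrightarrow> (\<integral>x. cellwise D x \<partial>lborel)"
  proof (rule integral_dominated_convergence)
    show "cellwise D \<in> borel_measurable lborel" using cellwise_measurable[OF D_cont] by simp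
    have "(\<lambda>x. W (x + c)) \<in> borel_measurable borel" for c
      by (rule measurable_compose[OF _ W_meas]) simp
    then show "?f n \<in> borel_measurable lborel" for n
      using W_meas by (intro borel_measurable_divide borel_measurable_diff) auto
    show "integrable lborel (\<lambda>x. M * indicator (cball 0 (R + 1)) x)"
      using emeasure_compact_finite[OF compact_cball, of 0 "R + 1"]
      by (intro integrable_mult_right integrable_real_indicator) auto
    show "AE x in lborel. norm (?f n x) \<le> M * indicator (cball 0 (R + 1)) x" for n
      using AE_generic_line[of b] AE_off_skeleton[of 0] AE_off_skeleton[of "?s n *\<^sub>R b"]
    proof eventually_elim
      case (elim x)
      have "\<bar>W (x + ?s n *\<^sub>R b) - W x\<bar> \<le> M * \<bar>?s n\<bar>"
        unfolding W_def
      proof (rule lipschitz_across_cells[OF _ facet lip M])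
        show "y \<notin> \<Omega> \<Longrightarrow> \<phi> y = 0" for y using phi0 S by blast
      qed (use elim in auto)
      then show ?case using bound by simp
    qed
    show "AE x in lborel. (\<lambda>n. ?f n x) \<longlonglongrightarrow> cellwise D x"
      using AE_off_skeleton[of 0]
    proof eventually_elim
      case (elim x)
      have s0: "(\<lambda>n. ?s n) \<longlonglongrightarrow> 0" by (rule LIMSEQ_inverse_real_of_nat)
      have sx: "(\<lambda>n. x + ?s n *\<^sub>R b) \<longlonglongrightarrow> x"
        using tendsto_add[OF tendsto_const tendsto_scaleR[OF s0 tendsto_const]] by force
      from elim have "x \<notin> skeleton" by simp
      from off_skeleton[OF this] show ?case
      proof
        assume x: "x \<notin> closure \<Omega>"
        have "\<forall>\<^sub>F n in sequentially. x + ?s n *\<^sub>R b \<in> - closure \<Omega>"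
          using x by (intro topological_tendstoD[OF sx]) auto
        then have "\<forall>\<^sub>F n in sequentially. ?f n x = 0"
        proof eventually_elim
          case (elim n)
          have "closure \<Omega> \<supseteq> S" using S closure_subset by blast
          then have "x \<notin> S" "x + ?s n *\<^sub>R b \<notin> S" using x elim by blast+
          then have "\<phi> x = 0" "\<phi> (x + ?s n *\<^sub>R b) = 0" using phi0 by blast+
          then show ?case unfolding W_def by simp
        qed
        then have "(\<lambda>n. ?f n x) \<longlonglongrightarrow> 0" by (rule tendsto_eventually)
        moreover have "cellwise D x = 0"
          using x closure_subset cell_interior_subset by (intro cellwise_outside) blast
        ultimately show ?thesis by (simp only:)
      next
        assume "\<exists>K\<in>\<T>. x \<in> interior K"
        then obtain K where K: "K \<in> \<T>" "x \<in> interior K" by blast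
        let ?g = "\<lambda>t. q K (x + t *\<^sub>R b) * \<phi> (x + t *\<^sub>R b)"
        have "((\<lambda>h. (?g (0 + h) - ?g 0) / h) \<longlongrightarrow> D K x) (at 0)"
          using line[OF K(1), of x 0] unfolding DERIV_def by simp
        moreover have "filterlim ?s (at 0) sequentially"
          using s0 by (intro filterlim_atI) auto
        ultimately have "(\<lambda>n. (?g (0 + ?s n) - ?g 0) / ?s n) \<longlonglongrightarrow> D K x"
          by (rule filterlim_compose)
        moreover have "\<forall>\<^sub>F n in sequentially. x + ?s n *\<^sub>R b \<in> interior K"
          using K by (intro topological_tendstoD[OF sx]) auto
        then have "\<forall>\<^sub>F n in sequentially. (?g (0 + ?s n) - ?g 0) / ?s n = ?f n x"
        proof eventually_elim
          case (elim n)
          show ?case unfolding W_def using cellwise_eq[OF K, of q] cellwise_eq[OF K(1) elim, of q] by simp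
        qed
        ultimately have "(\<lambda>n. ?f n x) \<longlonglongrightarrow> D K x" by (rule Lim_transform_eventually)
        then show ?thesis using cellwise_eq[OF K, of D] by simp
      qed
    qed
  qed
  moreover have "(\<integral>x. ?f n x \<partial>lborel) = 0" for n
    using W_int integral_translate[OF W_meas, of "?s n *\<^sub>R b"] by simp
  ultimately have "(\<lambda>n. 0) \<longlonglongrightarrow> (\<integral>x. cellwise D x \<partial>lborel)" by simp
  then have zero: "(\<integral>x. cellwise D x \<partial>lborel) = 0" using LIMSEQ_unique tendsto_const by metis
  let ?p = "\<lambda>x. cellwise q x * ?d x" and ?r = "\<lambda>x. (cellwise (\<lambda>K x. \<beta> K) x \<bullet> b) * \<phi> x"
  have p: "?p = cellwise (\<lambda>K x. q K x * ?d x)" by (rule ext) (rule cellwise_mult)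
  have r: "?r = cellwise (\<lambda>K x. (\<beta> K \<bullet> b) * \<phi> x)" unfolding cellwise_inner by (rule ext) (rule cellwise_mult)
  show p_int: "integrable lborel ?p" unfolding p
    by (rule cellwise_integrable[OF _ S(1)]) (auto simp: d0 intro!: continuous_intros q_cont F(3)[OF b])
  show r_int: "integrable lborel ?r" unfolding r
    by (rule cellwise_integrable[OF _ S(1)]) (auto simp: phi0 intro!: continuous_intros F(2))
  have "D = (\<lambda>K x. q K x * ?d x + (\<beta> K \<bullet> b) * \<phi> x)" by (intro ext) (simp add: D_def)
  then have "cellwise D x = ?p x + ?r x" for x
    by (simp only: fun_cong[OF p] fun_cong[OF r] cellwise_add)
  then have "(\<integral>x. ?p x \<partial>lborel) + (\<integral>x. ?r x \<partial>lborel) = 0" using zero p_int r_int by simp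
  then show "(\<integral>x. ?p x \<partial>lborel) = - (\<integral>x. ?r x \<partial>lborel)" by linarith
qed

end

section \<open>Affine functions on cells\<close>

lemma P1_0: "(\<lambda>x. 0) \<in> P1"
  by (auto simp: P1_def intro: exI[of _ 0])

lemma P1_lin:
  assumes "p \<in> P1" "r \<in> P1" shows "(\<lambda>x. s * p x + t * r x) \<in> P1"
proof -
  obtain \<alpha> \<beta> \<alpha>' \<beta>' where "\<And>x. p x = \<alpha> + \<beta> \<bullet> x" "\<And>x. r x = \<alpha>' + \<beta>' \<bullet> x"
    using assms by (auto simp: P1_def)
  then have "s * p x + t * r x = (s * \<alpha> + t * \<alpha>') + (s *\<^sub>R \<beta> + t *\<^sub>R \<beta>') \<bullet> x" for x
    by (simp add: algebra_simps)
  then show ?thesis unfolding P1_def by blast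
qed

lemma P1_continuous: "p \<in> P1 \<Longrightarrow> continuous_on A p"
proof -
  assume "p \<in> P1"
  then obtain \<alpha> \<beta> where "p = (\<lambda>x. \<alpha> + \<beta> \<bullet> x)" by (auto simp: P1_def)
  then show ?thesis by (simp add: continuous_intros)
qed

lemma P1_gradient:
  assumes "\<And>x. p x = \<alpha> + \<beta> \<bullet> x" shows "gradient p x = \<beta>"
  unfolding gradient_def
proof (rule the_equality)
  have p: "p = (\<lambda>x. \<alpha> + \<beta> \<bullet> x)" using assms by auto
  show d: "GDERIV p x :> \<beta>" unfolding gderiv_def p
    by (auto intro!: derivative_eq_intros simp: inner_commute)
  fix D assume "GDERIV p x :> D"
  then have "(\<lambda>h. h \<bullet> D) = (\<lambda>h. h \<bullet> \<beta>)"
    using d unfolding gderiv_def by (rule has_derivative_unique)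
  then show "D = \<beta>" by (metis inner_commute vector_eq_ldot)
qed

lemma P1_expand:
  assumes "p \<in> P1" shows "p x = p 0 + gradient p y \<bullet> x"
proof -
  obtain \<alpha> \<beta> where p: "\<And>x. p x = \<alpha> + \<beta> \<bullet> x" using assms by (auto simp: P1_def)
  show ?thesis unfolding P1_gradient[OF p] using p by simp
qed

text \<open>The values at the origin and the standard basis are coordinates of an affine function; they serve
  to bound the dimension of the piecewise affine functions.\<close>

lemma P1_zero:
  fixes p :: "'a::euclidean_space \<Rightarrow> real"
  assumes "p \<in> P1" "\<And>z. z \<in> insert 0 Basis \<Longrightarrow> p z = 0" shows "p = (\<lambda>x. 0)"
proof -
  obtain \<alpha> \<beta> where p: "\<And>x. p x = \<alpha> + \<beta> \<bullet> x" using assms by (auto simp: P1_def)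
  have "\<alpha> = 0" using assms(2)[of 0] p by simp
  moreover have "\<beta> = 0"
  proof (rule euclidean_eqI)
    fix b :: 'a assume "b \<in> Basis"
    then show "\<beta> \<bullet> b = 0 \<bullet> b" using assms(2)[of b] p[of b] \<open>\<alpha> = 0\<close> by simp
  qed
  ultimately show ?thesis by (intro ext) (simp add: p)
qed

text \<open>Affine functions that agree almost everywhere on a nonempty open set are equal, so the polynomial \<open>on_cell v K\<close>
  is determined by the class of \<open>v\<close> modulo null sets.\<close>

lemma P1_AE_unique:
  assumes p: "p \<in> P1" "r \<in> P1" and K: "interior K \<noteq> {}"
    and ae: "AE x in lebesgue. x \<in> interior K \<longrightarrow> p x = r x"
  shows "p = r"
proof -
  obtain \<alpha> \<beta> where pr: "\<And>x. p x - r x = \<alpha> + \<beta> \<bullet> x"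
    using P1_lin[OF p, of 1 "-1"] by (auto simp: P1_def)
  have zero: "p x - r x = 0" if x: "x \<in> interior K" for x
  proof (rule ccontr)
    let ?U = "interior K \<inter> {y. p y - r y \<noteq> 0}"
    assume "p x - r x \<noteq> 0"
    then have "?U \<noteq> {}" using x by auto
    moreover have "open ?U" using p
      by (intro open_Int open_interior open_Collect_neq continuous_intros P1_continuous)
    moreover have "negligible ?U" unfolding negligible_iff_null_sets
      using \<open>open ?U\<close> ae by (subst AE_iff_null_sets) (auto elim: eventually_mono)
    ultimately show False using open_not_negligible by blast
  qed
  obtain x where x: "x \<in> interior K" using K by auto
  then obtain d where d: "d > 0" "ball x d \<subseteq> interior K" using open_contains_ball[of "interior K"] by auto
  have "\<beta> = 0"
  proof (rule ccontr)
    assume b: "\<beta> \<noteq> 0"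
    let ?y = "x + (d / (2 * norm \<beta>)) *\<^sub>R \<beta>"
    have "?y \<in> interior K" using d b by (intro subsetD[OF d(2)]) (simp add: dist_norm)
    then have "\<alpha> + \<beta> \<bullet> ?y = 0" "\<alpha> + \<beta> \<bullet> x = 0" using zero x pr by metis+
    then have "(d / (2 * norm \<beta>)) * (\<beta> \<bullet> \<beta>) = 0" unfolding inner_add_right inner_scaleR_right by linarith
    then show False using b d by simp
  qed
  moreover have "\<alpha> = 0" using zero[OF x] pr[of x] \<open>\<beta> = 0\<close> by simp
  ultimately show ?thesis using pr by (intro ext) (metis add_0 eq_iff_diff_eq_0 inner_zero_left)
qed

lemma L2_lin:
  fixes u v :: "'a::euclidean_space \<Rightarrow> real"
  assumes "u \<in> L2 \<Omega>" "v \<in> L2 \<Omega>" shows "(\<lambda>x. \<alpha> * u x + \<beta> * v x) \<in> L2 \<Omega>"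
proof -
  have u: "u \<in> borel_measurable (lebesgue_on \<Omega>)" "integrable (lebesgue_on \<Omega>) (\<lambda>x. (u x)\<^sup>2)"
    and v: "v \<in> borel_measurable (lebesgue_on \<Omega>)" "integrable (lebesgue_on \<Omega>) (\<lambda>x. (v x)\<^sup>2)"
    using assms by (auto simp: L2_def)
  have "integrable (lebesgue_on \<Omega>) (\<lambda>x. (\<alpha> * u x + \<beta> * v x)\<^sup>2)"
  proof (rule Bochner_Integration.integrable_bound)
    show "integrable (lebesgue_on \<Omega>) (\<lambda>x. 2 * \<alpha>\<^sup>2 * (u x)\<^sup>2 + 2 * \<beta>\<^sup>2 * (v x)\<^sup>2)" using u v by simp
    show "(\<lambda>x. (\<alpha> * u x + \<beta> * v x)\<^sup>2) \<in> borel_measurable (lebesgue_on \<Omega>)" using u v by simp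
    have "(\<alpha> * u x + \<beta> * v x)\<^sup>2 \<le> 2 * \<alpha>\<^sup>2 * (u x)\<^sup>2 + 2 * \<beta>\<^sup>2 * (v x)\<^sup>2" for x
      using zero_le_power2[of "\<alpha> * u x - \<beta> * v x"] by (simp add: power2_eq_square algebra_simps)
    then show "AE x in lebesgue_on \<Omega>. norm ((\<alpha> * u x + \<beta> * v x)\<^sup>2) \<le> norm (2 * \<alpha>\<^sup>2 * (u x)\<^sup>2 + 2 * \<beta>\<^sup>2 * (v x)\<^sup>2)"
      by (intro AE_I2) (simp add: order_trans[OF _ abs_ge_self])
  qed
  then show ?thesis using u v by (simp add: L2_def)
qed

context mesh begin

abbreviation "PW \<equiv> piecewise_P1 \<Omega> \<T>"

lemma cell_lebesgue: "K \<in> \<T> \<Longrightarrow> K \<in> sets lebesgue"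
  and domain_lebesgue: "\<Omega> \<in> sets lebesgue"
  using cell_closed open_domain by (auto simp: lborelD)

lemma AE_cell_iff:
  assumes "K \<in> \<T>"
  shows "(AE x in lebesgue_on K. P x) \<longleftrightarrow> (AE x in lebesgue. x \<in> interior K \<longrightarrow> P x)"
proof -
  have "AE x in lebesgue. x \<notin> frontier K"
    by (rule AE_not_in_negligible[OF negligible_cell_frontier[OF assms]])
  then have ae: "AE x in lebesgue. x \<in> K \<longleftrightarrow> x \<in> interior K"
    by eventually_elim (use cell_closed[OF assms] interior_subset in \<open>auto simp: frontier_def\<close>)
  have "(AE x in lebesgue. x \<in> K \<longrightarrow> P x) \<longleftrightarrow> (AE x in lebesgue. x \<in> interior K \<longrightarrow> P x)"
  proof
    assume "AE x in lebesgue. x \<in> K \<longrightarrow> P x"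
    with ae show "AE x in lebesgue. x \<in> interior K \<longrightarrow> P x" by eventually_elim auto
  next
    assume "AE x in lebesgue. x \<in> interior K \<longrightarrow> P x"
    with ae show "AE x in lebesgue. x \<in> K \<longrightarrow> P x" by eventually_elim auto
  qed
  then show ?thesis using cell_lebesgue[OF assms] by (simp add: AE_restrict_space_iff)
qed

lemma on_cell_unique:
  assumes "K \<in> \<T>" "p \<in> P1" "AE x in lebesgue. x \<in> interior K \<longrightarrow> v x = p x"
  shows "on_cell v K = p"
  unfolding on_cell_def AE_cell_iff[OF assms(1)]
proof (rule the_equality)
  show "p \<in> P1 \<and> (AE x in lebesgue. x \<in> interior K \<longrightarrow> v x = p x)" using assms by blast
  fix r assume r: "r \<in> P1 \<and> (AE x in lebesgue. x \<in> interior K \<longrightarrow> v x = r x)"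
  then have "AE x in lebesgue. x \<in> interior K \<longrightarrow> v x = r x" by blast
  with assms(3) have "AE x in lebesgue. x \<in> interior K \<longrightarrow> r x = p x" by eventually_elim auto
  then show "r = p" using P1_AE_unique r assms cell_interior by blast
qed

lemma on_cell:
  assumes v: "v \<in> PW" and K: "K \<in> \<T>"
  shows "on_cell v K \<in> P1" and "AE x in lebesgue. x \<in> interior K \<longrightarrow> v x = on_cell v K x"
proof -
  obtain p where p: "p \<in> P1" "AE x in lebesgue. x \<in> interior K \<longrightarrow> v x = p x"
    using v K by (auto simp: piecewise_P1_def AE_cell_iff)
  from on_cell_unique[OF K this] p
  show "on_cell v K \<in> P1" and "AE x in lebesgue. x \<in> interior K \<longrightarrow> v x = on_cell v K x" by simp_all
qed

lemma on_cell_lin: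
  assumes "u \<in> PW" "v \<in> PW" "K \<in> \<T>"
  shows "on_cell (\<lambda>x. \<alpha> * u x + \<beta> * v x) K = (\<lambda>x. \<alpha> * on_cell u K x + \<beta> * on_cell v K x)"
proof (rule on_cell_unique[OF assms(3) P1_lin])
  show "AE x in lebesgue. x \<in> interior K \<longrightarrow> \<alpha> * u x + \<beta> * v x = \<alpha> * on_cell u K x + \<beta> * on_cell v K x"
    using on_cell(2)[OF assms(1,3)] on_cell(2)[OF assms(2,3)] by eventually_elim auto
qed (use assms on_cell in auto)

lemma on_cell_null:
  assumes "u \<in> PW" "K \<in> \<T>" "AE x in lebesgue_on \<Omega>. u x = 0"
  shows "on_cell u K = (\<lambda>x. 0)"
proof (rule on_cell_unique[OF assms(2) P1_0])
  have "AE x in lebesgue. x \<in> \<Omega> \<longrightarrow> u x = 0"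
    using assms(3) domain_lebesgue by (simp add: AE_restrict_space_iff)
  then show "AE x in lebesgue. x \<in> interior K \<longrightarrow> u x = 0"
    by eventually_elim (use cell_interior_subset[OF assms(2)] in auto)
qed

lemma PW_subspace: "L2_subspace \<Omega> PW"
proof
  show "PW \<subseteq> L2 \<Omega>" by (auto simp: piecewise_P1_def)
  show "(\<lambda>x. 0) \<in> PW" using P1_0 by (auto simp: piecewise_P1_def L2_def)
  fix u v \<alpha> \<beta> assume uv: "u \<in> PW" "v \<in> PW"
  show "(\<lambda>x. \<alpha> * u x + \<beta> * v x) \<in> PW"
    unfolding piecewise_P1_def
  proof (intro CollectI conjI ballI)
    show "(\<lambda>x. \<alpha> * u x + \<beta> * v x) \<in> L2 \<Omega>" using uv by (intro L2_lin) (auto simp: piecewise_P1_def)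
    fix K assume K: "K \<in> \<T>"
    show "\<exists>p\<in>P1. AE x in lebesgue_on K. \<alpha> * u x + \<beta> * v x = p x"
      unfolding AE_cell_iff[OF K]
    proof (rule bexI[OF _ P1_lin[OF on_cell(1)[OF uv(1) K] on_cell(1)[OF uv(2) K], of \<alpha> \<beta>]])
      show "AE x in lebesgue. x \<in> interior K \<longrightarrow> \<alpha> * u x + \<beta> * v x = \<alpha> * on_cell u K x + \<beta> * on_cell v K x"
        using on_cell(2)[OF uv(1) K] on_cell(2)[OF uv(2) K] by eventually_elim auto
    qed
  qed
qed

sublocale PW: L2_subspace \<Omega> PW by (rule PW_subspace)

lemma AE_cellwise:
  assumes "v \<in> PW" shows "AE x in lebesgue_on \<Omega>. v x = cellwise (on_cell v) x"
proof -
  have "AE x in lebesgue. \<forall>K\<in>\<T>. x \<in> interior K \<longrightarrow> v x = on_cell v K x"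
    using on_cell(2)[OF assms] finite_cells by (intro AE_finite_allI) auto
  moreover have "AE x in lebesgue. x \<notin> skeleton"
    by (rule AE_not_in_negligible[OF negligible_skeleton])
  ultimately have "AE x in lebesgue. x \<in> \<Omega> \<longrightarrow> v x = cellwise (on_cell v) x"
  proof eventually_elim
    case (elim x)
    show ?case
    proof
      assume "x \<in> \<Omega>"
      then obtain K where K: "K \<in> \<T>" "x \<in> interior K"
        using off_skeleton[OF elim(2)] closure_subset by blast
      then show "v x = cellwise (on_cell v) x" unfolding cellwise_eq[OF K] using elim(1) by auto
    qed
  qed
  then show ?thesis using domain_lebesgue by (simp add: AE_restrict_space_iff)
qed

text \<open>More functions than there are pairs of a cell and an affine coordinate have a nontrivial linear
  combination that vanishes on all cells, contradicting orthonormality.\<close>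

lemma orthonormal_bounded:
  assumes "PW.orthonormal m f" shows "m \<le> card (\<T> \<times> insert 0 (Basis :: 'a set))"
proof (rule ccontr)
  let ?I = "\<T> \<times> insert 0 (Basis :: 'a set)"
  assume "\<not> m \<le> card ?I"
  moreover have "finite ?I" using finite_cells by simp
  ultimately obtain c where c': "\<exists>j\<in>{..<m}. c j \<noteq> 0"
    "\<forall>i\<in>?I. (\<Sum>j\<in>{..<m}. on_cell (f j) (fst i) (snd i) * c j) = 0"
    using underdetermined_system_has_nonzero_solution[of ?I "{..<m}" "\<lambda>i j. on_cell (f j) (fst i) (snd i)"]
    by auto
  have c: "\<exists>j<m. c j \<noteq> 0" using c'(1) by auto
  have c2: "(\<Sum>j<m. on_cell (f j) K z * c j) = 0" if "K \<in> \<T>" "z \<in> insert 0 Basis" for K z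
    using c'(2)[rule_format, of "(K, z)"] that by simp
  have fV: "\<And>j. j < m \<Longrightarrow> f j \<in> PW" using assms PW.orthonormal_in by blast
  have cV: "comb c f m \<in> PW" using fV by (rule PW.comb_in)
  have "on_cell (comb c f m) K = (\<lambda>x. 0)" if K: "K \<in> \<T>" for K
  proof (rule P1_zero[OF on_cell(1)[OF cV K]])
    fix z :: 'a assume z: "z \<in> insert 0 Basis"
    have "on_cell (comb c f m) K z = (\<Sum>j<m. c j * on_cell (f j) K z)"
      using fV on_cell_lin[OF _ _ K] by (intro PW.functional_comb[where F = "\<lambda>u. on_cell u K z"]) auto
    then show "on_cell (comb c f m) K z = 0" using c2[OF K z] by (simp add: mult.commute)
  qed
  then have "cellwise (on_cell (comb c f m)) x = 0" for x by (simp add: cellwise_def)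
  then have "AE x in lebesgue_on \<Omega>. comb c f m x = 0" using AE_cellwise[OF cV] by simp
  then have "(\<Sum>i<m. (c i)\<^sup>2) = 0" using PW.orthonormal_norm[OF assms, of c] PW.ip_zero_iff[OF cV] by simp
  then show False using c by (auto simp: sum_nonneg_eq_0_iff)
qed

end

section \<open>Piecewise gradients\<close>

context mesh begin

definition pw_gradient :: "('a \<Rightarrow> real) \<Rightarrow> 'a \<Rightarrow> 'a" where
  "pw_gradient u = cellwise (\<lambda>K x. gradient (on_cell u K) 0)"

lemma gradient_on_cell: "u \<in> PW \<Longrightarrow> K \<in> \<T> \<Longrightarrow> gradient (on_cell u K) x = gradient (on_cell u K) y"
  using on_cell(1) by (auto simp: P1_def) (metis P1_gradient)

lemma pw_gradient_interior:
  "u \<in> PW \<Longrightarrow> K \<in> \<T> \<Longrightarrow> x \<in> interior K \<Longrightarrow> pw_gradient u x = gradient (on_cell u K) x"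
  unfolding pw_gradient_def by (subst cellwise_eq) (auto intro: gradient_on_cell)

lemma gradient_lin:
  assumes "u \<in> PW" "v \<in> PW" "K \<in> \<T>"
  shows "gradient (on_cell (\<lambda>x. \<alpha> * u x + \<beta> * v x) K) 0
    = \<alpha> *\<^sub>R gradient (on_cell u K) 0 + \<beta> *\<^sub>R gradient (on_cell v K) 0"
proof (rule P1_gradient)
  fix x
  show "on_cell (\<lambda>x. \<alpha> * u x + \<beta> * v x) K x = (\<alpha> * on_cell u K 0 + \<beta> * on_cell v K 0) +
    (\<alpha> *\<^sub>R gradient (on_cell u K) 0 + \<beta> *\<^sub>R gradient (on_cell v K) 0) \<bullet> x"
    unfolding on_cell_lin[OF assms]
    by (subst P1_expand[OF on_cell(1)[OF assms(1,3)], of x 0], subst P1_expand[OF on_cell(1)[OF assms(2,3)], of x 0])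
      (simp add: algebra_simps inner_add_left)
qed

lemma pw_gradient_lin:
  assumes "u \<in> PW" "v \<in> PW"
  shows "pw_gradient (\<lambda>x. \<alpha> * u x + \<beta> * v x) x = \<alpha> *\<^sub>R pw_gradient u x + \<beta> *\<^sub>R pw_gradient v x"
  unfolding pw_gradient_def cellwise_def
  by (simp add: gradient_lin[OF assms] scaleR_sum_right sum.distrib scaleR_right_distrib mult.commute)

lemma pw_gradient_measurable: "pw_gradient u \<in> borel_measurable borel"
  unfolding pw_gradient_def by (intro cellwise_measurable) simp

lemma pw_gradient_bounded: "\<exists>M. \<forall>x. norm (pw_gradient u x) \<le> M"
proof (intro exI allI)
  fix x
  have "norm (pw_gradient u x) \<le> (\<Sum>K\<in>\<T>. norm (indicator (interior K) x *\<^sub>R gradient (on_cell u K) 0))"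
    unfolding pw_gradient_def cellwise_def by (rule norm_sum)
  also have "\<dots> \<le> (\<Sum>K\<in>\<T>. norm (gradient (on_cell u K) 0))"
    by (intro sum_mono) (auto simp: indicator_def)
  finally show "norm (pw_gradient u x) \<le> (\<Sum>K\<in>\<T>. norm (gradient (on_cell u K) 0))" .
qed

lemma finite_measure_domain: "finite_measure (lebesgue_on \<Omega>)"
  using domain domain_lebesgue by (intro finite_measure_lebesgue_on bounded_set_imp_lmeasurable)

lemma borel_imp_domain_measurable: "f \<in> borel_measurable borel \<Longrightarrow> f \<in> borel_measurable (lebesgue_on \<Omega>)"
  by (intro measurable_restrict_space1 measurable_completion) simp

lemma pw_gradient_L2: "pw_gradient u \<in> L2 \<Omega>"
proof -
  obtain M where M: "\<And>x. norm (pw_gradient u x) \<le> M" using pw_gradient_bounded by blast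
  have meas: "pw_gradient u \<in> borel_measurable (lebesgue_on \<Omega>)"
    by (rule borel_imp_domain_measurable[OF pw_gradient_measurable])
  have "(\<lambda>x. (norm (pw_gradient u x))\<^sup>2) \<in> borel_measurable (lebesgue_on \<Omega>)"
    by (intro borel_measurable_power borel_measurable_norm[THEN measurable_compose[OF meas]])
  then have "integrable (lebesgue_on \<Omega>) (\<lambda>x. (norm (pw_gradient u x))\<^sup>2)"
    using M by (intro finite_measure.integrable_const_bound[OF finite_measure_domain, of _ "M\<^sup>2"] AE_I2)
      (auto intro!: power_mono)
  then show ?thesis using meas by (simp add: L2_def)
qed

section \<open>Jumps, the Crouzeix-Raviart space and the conforming space\<close>

lemma interior_face_cells:
  assumes "e \<in> interior_faces \<T>"
  obtains K L where "K \<in> \<T>" "L \<in> \<T>" "K \<noteq> L" "{M \<in> \<T>. e facet_of M} = {K, L}"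
proof -
  obtain K L where KL: "K \<in> \<T>" "L \<in> \<T>" "K \<noteq> L" "e facet_of K" "e facet_of L"
    using assms by (auto simp: interior_faces_def)
  then have "{M \<in> \<T>. e facet_of M} = {K, L}"
    using not_facet_of_three_cells[OF KL(1,2)] by blast
  then show ?thesis using that KL by blast
qed

lemma boundary_face_cell:
  assumes "e \<in> boundary_faces \<Omega> \<T>"
  obtains K where "K \<in> \<T>" "{M \<in> \<T>. e facet_of M} = {K}"
proof -
  obtain K where K: "K \<in> \<T>" "e facet_of K" using assms by (auto simp: boundary_faces_def)
  have "M = K" if "M \<in> \<T>" "e facet_of M" for M
    using facet_of_two_cells(2)[OF that(1) K(1) _ that(2) K(2)] interior_face_not_boundary assms by blast
  then have "{M \<in> \<T>. e facet_of M} = {K}" using K by blast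
  then show ?thesis using that K by blast
qed

text \<open>With exactly two cells at the face and different labels, \<open>ARG_MAX\<close> and \<open>ARG_MIN\<close> pick one cell each.\<close>

lemma jump_interior:
  assumes lab: "inj_on lab \<T>" and "e \<in> interior_faces \<T>"
  obtains K L where "K \<in> \<T>" "L \<in> \<T>" "{M \<in> \<T>. e facet_of M} = {K, L}"
    "\<And>v. jump \<T> lab v e = (\<lambda>x. on_cell v K x - on_cell v L x)"
proof -
  obtain P Q where PQ: "P \<in> \<T>" "Q \<in> \<T>" "P \<noteq> Q" "{M \<in> \<T>. e facet_of M} = {P, Q}"
    using interior_face_cells assms(2) by metis
  \<comment> \<open>\<open>K\<close> is the cell with the larger label.\<close>
  obtain K L where KL: "{K, L} = {P, Q}" "lab L < lab K"
    using PQ lab by (metis inj_onD insert_commute linorder_neqE_nat)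
  have cells_eq: "{M \<in> \<T>. e facet_of M} = {K, L}" using PQ(4) KL(1) by simp
  have cells: "M \<in> \<T> \<and> e facet_of M \<longleftrightarrow> M = K \<or> M = L" for M
  proof -
    have "M \<in> {M \<in> \<T>. e facet_of M} \<longleftrightarrow> M \<in> {K, L}" unfolding cells_eq ..
    then show ?thesis by simp
  qed
  have "(ARG_MAX lab M. M \<in> \<T> \<and> e facet_of M) = K"
    unfolding arg_max_def is_arg_max_def cells using KL(2) by (intro some_equality) auto
  moreover have "(ARG_MIN lab M. M \<in> \<T> \<and> e facet_of M) = L"
    unfolding arg_min_def is_arg_min_def cells using KL(2) by (intro some_equality) auto
  ultimately have "jump \<T> lab v e = (\<lambda>x. on_cell v K x - on_cell v L x)" for v
    using assms(2) by (simp add: jump_def fun_eq_iff)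
  moreover have "K \<in> \<T>" "L \<in> \<T>" using cells by blast+
  ultimately show ?thesis using that cells_eq by blast
qed

lemma jump_boundary:
  assumes "e \<in> boundary_faces \<Omega> \<T>"
  obtains K where "K \<in> \<T>" "{M \<in> \<T>. e facet_of M} = {K}" "\<And>lab v. jump \<T> lab v e = on_cell v K"
proof -
  obtain K where K: "K \<in> \<T>" "{M \<in> \<T>. e facet_of M} = {K}" using boundary_face_cell assms by metis
  then have "(THE M. M \<in> \<T> \<and> e facet_of M) = K" by (intro the_equality) blast+
  moreover have "e \<notin> interior_faces \<T>" using interior_face_not_boundary assms by blast
  ultimately have "jump \<T> lab v e = on_cell v K" for lab v by (simp add: jump_def fun_eq_iff)
  then show ?thesis using that K by blast
qed

lemma face_facet: "e \<in> faces \<Omega> \<T> \<Longrightarrow> \<exists>K\<in>\<T>. e facet_of K"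
  by (auto simp: faces_def interior_faces_def boundary_faces_def)

lemma face_props:
  assumes "e \<in> faces \<Omega> \<T>" shows "convex e" "compact e" "e \<noteq> {}"
proof -
  obtain K where "K \<in> \<T>" "e facet_of K" using face_facet[OF assms] by blast
  then show "convex e" "compact e" "e \<noteq> {}" using facet_convex_compact cell_convex cell_compact by blast+
qed

lemma finite_faces: "finite (faces \<Omega> \<T>)"
proof (rule finite_subset)
  show "faces \<Omega> \<T> \<subseteq> (\<Union>K\<in>\<T>. {F. F face_of K})" using face_facet facet_of_imp_face_of by blast
  show "finite (\<Union>K\<in>\<T>. {F. F face_of K})"
    using finite_cells cell_simplex simplex_imp_polytope by (auto intro!: finite_polytope_faces)
qed

text \<open>One format for the jumps on interior faces (\<open>s = 1\<close>) and on boundary faces (\<open>s = 0\<close>).\<close>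

lemma jump_trace:
  assumes "inj_on lab \<T>" "e \<in> faces \<Omega> \<T>"
  obtains K L s where "K \<in> \<T>" "L \<in> \<T>"
    "\<And>v. jump \<T> lab v e = (\<lambda>x. on_cell v K x - s * on_cell v L x)"
proof (cases "e \<in> interior_faces \<T>")
  case True
  obtain K L where "K \<in> \<T>" "L \<in> \<T>" "{M \<in> \<T>. e facet_of M} = {K, L}"
    "\<And>v. jump \<T> lab v e = (\<lambda>x. on_cell v K x - on_cell v L x)"
    by (rule jump_interior[OF assms(1) True]) (rule that)
  then show ?thesis using that[of K L 1] by simp
next
  case False
  then have "e \<in> boundary_faces \<Omega> \<T>" using assms(2) by (simp add: faces_def)
  then obtain K where "K \<in> \<T>" "\<And>v. jump \<T> lab v e = on_cell v K" using jump_boundary by metis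
  then show ?thesis using that[of K K 0] by simp
qed

lemma jump_continuous:
  assumes "inj_on lab \<T>" "v \<in> PW" "e \<in> faces \<Omega> \<T>" shows "continuous_on UNIV (jump \<T> lab v e)"
proof -
  obtain K L s where "K \<in> \<T>" "L \<in> \<T>" "\<And>v. jump \<T> lab v e = (\<lambda>x. on_cell v K x - s * on_cell v L x)"
    using jump_trace[OF assms(1,3)] by metis
  then show ?thesis using on_cell(1)[OF assms(2)] by (simp add: continuous_on_diff continuous_on_mult_left P1_continuous)
qed

lemma jump_lin:
  assumes "inj_on lab \<T>" "u \<in> PW" "v \<in> PW" "e \<in> faces \<Omega> \<T>"
  shows "jump \<T> lab (\<lambda>x. \<alpha> * u x + \<beta> * v x) e = (\<lambda>x. \<alpha> * jump \<T> lab u e x + \<beta> * jump \<T> lab v e x)"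
proof -
  obtain K L s where "K \<in> \<T>" "L \<in> \<T>" "\<And>v. jump \<T> lab v e = (\<lambda>x. on_cell v K x - s * on_cell v L x)"
    using jump_trace[OF assms(1,4)] by metis
  then show ?thesis by (simp add: on_cell_lin[OF assms(2,3)] algebra_simps)
qed

lemma jump_null:
  assumes "inj_on lab \<T>" "u \<in> PW" "AE x in lebesgue_on \<Omega>. u x = 0" "e \<in> faces \<Omega> \<T>"
  shows "jump \<T> lab u e x = 0"
proof -
  obtain K L s where "K \<in> \<T>" "L \<in> \<T>" "\<And>v. jump \<T> lab v e = (\<lambda>x. on_cell v K x - s * on_cell v L x)"
    using jump_trace[OF assms(1,4)] by metis
  then show ?thesis by (simp add: on_cell_null[OF assms(2) _ assms(3)])
qed

lemma CR_subspace:
  assumes lab: "inj_on lab \<T>" shows "L2_subspace \<Omega> (CR_space \<Omega> \<T> lab)"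
proof
  show "CR_space \<Omega> \<T> lab \<subseteq> L2 \<Omega>" using PW.sub by (auto simp: CR_space_def)
  have fp: "convex e" "compact e" "e \<noteq> {}" if "e \<in> interior_faces \<T> \<or> e \<in> boundary_faces \<Omega> \<T>" for e
    using face_props that by (auto simp: faces_def)
  show "(\<lambda>x. 0) \<in> CR_space \<Omega> \<T> lab"
    unfolding CR_space_def
  proof (intro CollectI conjI ballI impI)
    show "(\<lambda>x. 0) \<in> PW" by (rule PW.zero)
    fix e assume "e \<in> interior_faces \<T>"
    then have "e \<in> faces \<Omega> \<T>" by (simp add: faces_def)
    then show "face_integral e (jump \<T> lab (\<lambda>x. 0) e) = 0"
      by (intro face_integral_zero[OF face_props] jump_null[OF lab PW.zero]) auto
  next
    fix e K assume e: "e \<in> boundary_faces \<Omega> \<T>" "K \<in> \<T>" "e facet_of K"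
    then show "face_integral e (on_cell (\<lambda>x. 0) K) = 0"
      using fp[of e] on_cell_null[OF PW.zero e(2)] by (intro face_integral_zero) auto
  qed
  fix u v \<alpha> \<beta> assume uv: "u \<in> CR_space \<Omega> \<T> lab" "v \<in> CR_space \<Omega> \<T> lab"
  then have PWuv: "u \<in> PW" "v \<in> PW" by (auto simp: CR_space_def)
  show "(\<lambda>x. \<alpha> * u x + \<beta> * v x) \<in> CR_space \<Omega> \<T> lab"
    unfolding CR_space_def
  proof (intro CollectI conjI ballI impI)
    show "(\<lambda>x. \<alpha> * u x + \<beta> * v x) \<in> PW" using PWuv by (rule PW.lin)
    fix e assume e: "e \<in> interior_faces \<T>"
    then have ef: "e \<in> faces \<Omega> \<T>" by (simp add: faces_def)
    have "face_integral e (jump \<T> lab (\<lambda>x. \<alpha> * u x + \<beta> * v x) e) =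
      \<alpha> * face_integral e (jump \<T> lab u e) + \<beta> * face_integral e (jump \<T> lab v e)"
      unfolding jump_lin[OF lab PWuv ef] using fp[of e] e
      by (intro face_integral_linear jump_continuous[OF lab] PWuv ef) auto
    then show "face_integral e (jump \<T> lab (\<lambda>x. \<alpha> * u x + \<beta> * v x) e) = 0"
      using uv e by (simp add: CR_space_def)
  next
    fix e K assume e: "e \<in> boundary_faces \<Omega> \<T>" "K \<in> \<T>" "e facet_of K"
    have "face_integral e (on_cell (\<lambda>x. \<alpha> * u x + \<beta> * v x) K) =
      \<alpha> * face_integral e (on_cell u K) + \<beta> * face_integral e (on_cell v K)"
      unfolding on_cell_lin[OF PWuv e(2)] using fp[of e] e on_cell(1)[OF _ e(2)] PWuv
      by (intro face_integral_linear P1_continuous) auto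
    then show "face_integral e (on_cell (\<lambda>x. \<alpha> * u x + \<beta> * v x) K) = 0"
      using uv e by (simp add: CR_space_def)
  qed
qed

lemma P1_spaceD:
  assumes "w \<in> P1_space \<Omega> \<T>"
  shows "w \<in> PW"
    and "e \<in> interior_faces \<T> \<Longrightarrow> K \<in> \<T> \<Longrightarrow> L \<in> \<T> \<Longrightarrow> e facet_of K \<Longrightarrow> e facet_of L \<Longrightarrow> x \<in> e \<Longrightarrow>
      on_cell w K x = on_cell w L x"
    and "e \<in> boundary_faces \<Omega> \<T> \<Longrightarrow> K \<in> \<T> \<Longrightarrow> e facet_of K \<Longrightarrow> x \<in> e \<Longrightarrow> on_cell w K x = 0"
proof -
  note P = assms[unfolded P1_space_def mem_Collect_eq]
  show "w \<in> PW" using P by (rule conjunct1)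
  show "on_cell w K x = on_cell w L x"
    if "e \<in> interior_faces \<T>" "K \<in> \<T>" "L \<in> \<T>" "e facet_of K" "e facet_of L" "x \<in> e"
    using P[THEN conjunct2, THEN conjunct1, rule_format, OF that(1-3) conjI[OF that(4,5)] that(6)] .
  show "on_cell w K x = 0" if "e \<in> boundary_faces \<Omega> \<T>" "K \<in> \<T>" "e facet_of K" "x \<in> e"
    using P[THEN conjunct2, THEN conjunct2, rule_format, OF that] .
qed

lemma P1_iff_no_jump:
  assumes lab: "inj_on lab \<T>" and v: "v \<in> PW"
  shows "v \<in> P1_space \<Omega> \<T> \<longleftrightarrow> (\<forall>e\<in>faces \<Omega> \<T>. \<forall>x\<in>e. jump \<T> lab v e x = 0)"
proof
  assume P: "v \<in> P1_space \<Omega> \<T>"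
  show "\<forall>e\<in>faces \<Omega> \<T>. \<forall>x\<in>e. jump \<T> lab v e x = 0"
  proof (intro ballI)
    fix e x assume e: "e \<in> faces \<Omega> \<T>" and x: "x \<in> e"
    show "jump \<T> lab v e x = 0" using e unfolding faces_def
    proof
      assume i: "e \<in> interior_faces \<T>"
      obtain K L where KL: "K \<in> \<T>" "L \<in> \<T>" "{M \<in> \<T>. e facet_of M} = {K, L}"
          "\<And>v. jump \<T> lab v e = (\<lambda>x. on_cell v K x - on_cell v L x)"
        by (rule jump_interior[OF lab i]) (rule that)
      have "K \<in> {M \<in> \<T>. e facet_of M}" "L \<in> {M \<in> \<T>. e facet_of M}" unfolding KL(3) by simp_all
      then have "on_cell v K x = on_cell v L x" using x by (intro P1_spaceD(2)[OF P i]) auto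
      then show ?thesis by (simp add: KL(4))
    next
      assume b: "e \<in> boundary_faces \<Omega> \<T>"
      then obtain K where K: "K \<in> \<T>" "{M \<in> \<T>. e facet_of M} = {K}" "jump \<T> lab v e = on_cell v K"
        using jump_boundary by metis
      have "K \<in> {M \<in> \<T>. e facet_of M}" unfolding K(2) by simp
      then show ?thesis using P1_spaceD(3)[OF P b K(1) _ x] K(3) by simp
    qed
  qed
next
  assume J: "\<forall>e\<in>faces \<Omega> \<T>. \<forall>x\<in>e. jump \<T> lab v e x = 0"
  show "v \<in> P1_space \<Omega> \<T>"
    unfolding P1_space_def
  proof (intro CollectI conjI ballI impI v)
    fix e M N x assume e: "e \<in> interior_faces \<T>" "M \<in> \<T>" "N \<in> \<T>" "e facet_of M \<and> e facet_of N" "x \<in> e"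
    obtain K L where KL: "{M \<in> \<T>. e facet_of M} = {K, L}"
          "\<And>v. jump \<T> lab v e = (\<lambda>x. on_cell v K x - on_cell v L x)"
      by (rule jump_interior[OF lab e(1)]) (rule that)
    have "e \<in> faces \<Omega> \<T>" using e(1) by (simp add: faces_def)
    then have "jump \<T> lab v e x = 0" using J e(5) by blast
    then have "on_cell v K x = on_cell v L x" unfolding KL(2) by simp
    moreover have "M \<in> {K, L}" "N \<in> {K, L}" using e KL(1) by blast+
    ultimately show "on_cell v M x = on_cell v N x" by auto
  next
    fix e M x assume e: "e \<in> boundary_faces \<Omega> \<T>" "M \<in> \<T>" "e facet_of M" "x \<in> e"
    obtain K where K: "{M \<in> \<T>. e facet_of M} = {K}" "jump \<T> lab v e = on_cell v K"
      using jump_boundary[OF e(1)] by metis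
    have "M = K" using K e by blast
    moreover have "e \<in> faces \<Omega> \<T>" using e(1) by (simp add: faces_def)
    then have "jump \<T> lab v e x = 0" using J e(4) by blast
    ultimately show "on_cell v M x = 0" using K(2) by simp
  qed
qed

lemma P1_subspace:
  fixes lab :: "'a set \<Rightarrow> nat"
  assumes lab: "inj_on lab \<T>" shows "L2_subspace \<Omega> (P1_space \<Omega> \<T>)"
proof
  show "P1_space \<Omega> \<T> \<subseteq> L2 \<Omega>" using PW.sub P1_spaceD(1) by blast
  show "(\<lambda>x. 0) \<in> P1_space \<Omega> \<T>"
    unfolding P1_iff_no_jump[OF lab PW.zero] by (intro ballI jump_null[OF lab PW.zero]) auto
  fix u v \<alpha> \<beta> assume uv: "u \<in> P1_space \<Omega> \<T>" "v \<in> P1_space \<Omega> \<T>"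
  note PWuv = uv[THEN P1_spaceD(1)]
  show "(\<lambda>x. \<alpha> * u x + \<beta> * v x) \<in> P1_space \<Omega> \<T>"
    using uv jump_lin[OF lab PWuv] PW.lin[OF PWuv]
    by (simp add: P1_iff_no_jump[OF lab] PWuv)
qed

lemma P1_subset_CR:
  assumes lab: "inj_on lab \<T>" shows "P1_space \<Omega> \<T> \<subseteq> CR_space \<Omega> \<T> lab"
proof
  fix v assume v: "v \<in> P1_space \<Omega> \<T>"
  then have PWv: "v \<in> PW" by (simp add: P1_space_def)
  have J: "jump \<T> lab v e x = 0" if "e \<in> faces \<Omega> \<T>" "x \<in> e" for e x
    using P1_iff_no_jump[OF lab PWv] v that by blast
  show "v \<in> CR_space \<Omega> \<T> lab"
    unfolding CR_space_def
  proof (intro CollectI conjI ballI impI PWv)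
    fix e assume "e \<in> interior_faces \<T>"
    then have "e \<in> faces \<Omega> \<T>" by (simp add: faces_def)
    then show "face_integral e (jump \<T> lab v e) = 0" using J face_props by (intro face_integral_zero) auto
  next
    fix e K assume e: "e \<in> boundary_faces \<Omega> \<T>" "K \<in> \<T>" "e facet_of K"
    then have "e \<in> faces \<Omega> \<T>" by (simp add: faces_def)
    then show "face_integral e (on_cell v K) = 0"
      by (intro face_integral_zero[OF face_props] P1_spaceD(3)[OF v e])
  qed
qed

definition penalty :: "('a set \<Rightarrow> nat) \<Rightarrow> ('a \<Rightarrow> real) \<Rightarrow> ('a \<Rightarrow> real) \<Rightarrow> real" where
  "penalty lab u v = (\<Sum>e\<in>faces \<Omega> \<T>. 1 / face_area e powr (2 - real DIM('a) / 2)
                  * face_integral e (\<lambda>x. jump \<T> lab u e x * jump \<T> lab v e x))"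

lemma penalty_term_nonneg:
  assumes "e \<in> faces \<Omega> \<T>"
  shows "0 \<le> 1 / face_area e powr (2 - real DIM('a) / 2)
                  * face_integral e (\<lambda>x. jump \<T> lab v e x * jump \<T> lab v e x)"
proof -
  have "0 \<le> face_integral e (\<lambda>x. jump \<T> lab v e x * jump \<T> lab v e x)"
    by (rule face_integral_nonneg[OF face_props[OF assms]]) simp
  then show ?thesis by (intro mult_nonneg_nonneg) simp_all
qed

lemma penalty_nonneg: "0 \<le> penalty lab v v"
  unfolding penalty_def by (intro sum_nonneg penalty_term_nonneg)

text \<open>Every summand is nonnegative with a positive weight, so the penalty vanishes exactly if all jumps
  do, which is conformity.\<close>

lemma penalty_zero_iff:
  assumes lab: "inj_on lab \<T>" and v: "v \<in> PW"
  shows "penalty lab v v = 0 \<longleftrightarrow> v \<in> P1_space \<Omega> \<T>"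
proof -
  let ?I = "\<lambda>e. face_integral e (\<lambda>x. jump \<T> lab v e x * jump \<T> lab v e x)"
  have "penalty lab v v = 0 \<longleftrightarrow> (\<forall>e\<in>faces \<Omega> \<T>. 1 / face_area e powr (2 - real DIM('a) / 2) * ?I e = 0)"
    unfolding penalty_def by (rule sum_nonneg_eq_0_iff[OF finite_faces penalty_term_nonneg])
  also have "\<dots> \<longleftrightarrow> (\<forall>e\<in>faces \<Omega> \<T>. ?I e = 0)"
  proof (intro ball_cong refl)
    fix e assume "e \<in> faces \<Omega> \<T>"
    then have "face_area e > 0" using face_area_pos face_props by blast
    then show "1 / face_area e powr (2 - real DIM('a) / 2) * ?I e = 0 \<longleftrightarrow> ?I e = 0" by simp
  qed
  also have "\<dots> \<longleftrightarrow> (\<forall>e\<in>faces \<Omega> \<T>. \<forall>x\<in>e. jump \<T> lab v e x = 0)"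
  proof (intro ball_cong refl iffI ballI)
    fix e x assume e: "e \<in> faces \<Omega> \<T>" "x \<in> e"
      "face_integral e (\<lambda>x. jump \<T> lab v e x * jump \<T> lab v e x) = 0"
    show "jump \<T> lab v e x = 0"
      by (rule face_integral_square_zero[OF face_props[OF e(1)] jump_continuous[OF lab v e(1)] e(3,2)])
  next
    fix e assume e: "e \<in> faces \<Omega> \<T>" "\<forall>x\<in>e. jump \<T> lab v e x = 0"
    then show "face_integral e (\<lambda>x. jump \<T> lab v e x * jump \<T> lab v e x) = 0"
      by (intro face_integral_zero[OF face_props[OF e(1)]]) simp
  qed
  finally show ?thesis using P1_iff_no_jump[OF lab v] by simp
qed

lemma penalty_lin:
  assumes lab: "inj_on lab \<T>" and PW: "u \<in> PW" "v \<in> PW" "w \<in> PW"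
  shows "penalty lab (\<lambda>x. \<alpha> * u x + \<beta> * v x) w = \<alpha> * penalty lab u w + \<beta> * penalty lab v w"
proof -
  have "face_integral e (\<lambda>x. jump \<T> lab (\<lambda>x. \<alpha> * u x + \<beta> * v x) e x * jump \<T> lab w e x)
     = \<alpha> * face_integral e (\<lambda>x. jump \<T> lab u e x * jump \<T> lab w e x)
      + \<beta> * face_integral e (\<lambda>x. jump \<T> lab v e x * jump \<T> lab w e x)" if e: "e \<in> faces \<Omega> \<T>" for e
  proof -
    have "(\<lambda>x. jump \<T> lab (\<lambda>x. \<alpha> * u x + \<beta> * v x) e x * jump \<T> lab w e x) =
        (\<lambda>x. \<alpha> * (jump \<T> lab u e x * jump \<T> lab w e x) + \<beta> * (jump \<T> lab v e x * jump \<T> lab w e x))"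
      unfolding jump_lin[OF lab PW(1,2) e] by (simp add: algebra_simps)
    then show ?thesis using face_props[OF e]
      by (simp only:) (intro face_integral_linear continuous_intros jump_continuous[OF lab] PW e)
  qed
  then show ?thesis unfolding penalty_def
    by (simp add: sum_distrib_left sum.distrib[symmetric] algebra_simps)
qed

lemma penalty_null:
  assumes lab: "inj_on lab \<T>" and u: "u \<in> PW" and 0: "AE x in lebesgue_on \<Omega>. u x = 0"
  shows "penalty lab u w = 0"
proof -
  have "jump \<T> lab u e x = 0" if "e \<in> faces \<Omega> \<T>" for e x
    by (rule jump_null[OF lab u 0 that])
  then show ?thesis unfolding penalty_def using face_props
    by (intro sum.neutral ballI) (simp add: face_integral_zero)
qed

end

section \<open>The energy and the continuous form\<close>

context mesh begin

text \<open>The cells cover the domain up to the null set of their boundaries.\<close>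

lemma sum_over_cells:
  fixes f :: "'a \<Rightarrow> real"
  assumes f: "integrable (lebesgue_on \<Omega>) f"
    and h: "\<And>K x. K \<in> \<T> \<Longrightarrow> x \<in> interior K \<Longrightarrow> h K x = f x"
  shows "(\<Sum>K\<in>\<T>. \<integral>x. h K x \<partial>lebesgue_on K) = (\<integral>x. f x \<partial>lebesgue_on \<Omega>)"
proof -
  have f0: "integrable lebesgue (\<lambda>x. indicator \<Omega> x * f x)"
    using f domain_lebesgue by (simp add: integrable_restrict_space)
  have int: "integrable lebesgue (\<lambda>x. indicator (interior K) x * f x)" if "K \<in> \<T>" for K
  proof -
    have "integrable lebesgue (\<lambda>x. indicator (interior K) x *\<^sub>R (indicator \<Omega> x * f x))"
      by (intro integrable_mult_indicator f0) simp
    moreover have "(\<lambda>x. indicator (interior K) x *\<^sub>R (indicator \<Omega> x * f x)) = (\<lambda>x. indicator (interior K) x * f x)"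
      using cell_interior_subset[OF that] by (intro ext) (auto simp: indicator_def)
    ultimately show ?thesis by (simp only:)
  qed
  have cell: "(\<integral>x. h K x \<partial>lebesgue_on K) = (\<integral>x. indicator (interior K) x * f x \<partial>lebesgue)" if K: "K \<in> \<T>" for K
  proof -
    have "AE x in lebesgue. x \<notin> frontier K"
      by (rule AE_not_in_negligible[OF negligible_cell_frontier[OF K]])
    then have ae: "AE x in lebesgue. indicator (interior K) x * f x = indicator K x * h K x"
    proof eventually_elim
      case (elim x)
      then have "x \<in> K \<longleftrightarrow> x \<in> interior K"
        using cell_closed[OF K] interior_subset by (auto simp: frontier_def)
      then show ?case using h[OF K, of x] by (auto simp: indicator_def)
    qed
    have "(\<lambda>x. indicator K x * h K x) \<in> borel_measurable lebesgue"
      using borel_measurable_AE[OF borel_measurable_integrable[OF int[OF K]] ae] .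
    then have "(\<integral>x. indicator K x * h K x \<partial>lebesgue) = (\<integral>x. indicator (interior K) x * f x \<partial>lebesgue)"
      using int[OF K] ae by (intro integral_cong_AE) (auto elim: eventually_mono)
    then show ?thesis using cell_lebesgue[OF K] by (simp add: integral_restrict_space)
  qed
  have "(\<Sum>K\<in>\<T>. \<integral>x. h K x \<partial>lebesgue_on K) = (\<integral>x. (\<Sum>K\<in>\<T>. indicator (interior K) x * f x) \<partial>lebesgue)"
    using int by (simp add: cell Bochner_Integration.integral_sum)
  also have "\<dots> = (\<integral>x. indicator \<Omega> x * f x \<partial>lebesgue)"
  proof (rule integral_cong_AE)
    show "(\<lambda>x. \<Sum>K\<in>\<T>. indicator (interior K) x * f x) \<in> borel_measurable lebesgue"
      using int by (intro borel_measurable_sum) auto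
    show "(\<lambda>x. indicator \<Omega> x * f x) \<in> borel_measurable lebesgue" using f0 by auto
    have "AE x in lebesgue. x \<notin> skeleton"
      by (rule AE_not_in_negligible[OF negligible_skeleton])
    then show "AE x in lebesgue. (\<Sum>K\<in>\<T>. indicator (interior K) x * f x) = indicator \<Omega> x * f x"
    proof eventually_elim
      case (elim x)
      have c: "(\<Sum>K\<in>\<T>. indicator (interior K) x * f x) = cellwise (\<lambda>K x. f x) x" by (simp add: cellwise_def)
      from off_skeleton[OF elim] show ?case
      proof
        assume "x \<notin> closure \<Omega>"
        moreover from this have "x \<notin> \<Omega>" using closure_subset by blast
        ultimately show ?thesis unfolding c using cell_interior_subset
          by (subst cellwise_outside) auto
      next
        assume "\<exists>K\<in>\<T>. x \<in> interior K"
        then obtain K where K: "K \<in> \<T>" "x \<in> interior K" by blast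
        then have "x \<in> \<Omega>" using cell_interior_subset by blast
        then show ?thesis unfolding c cellwise_eq[OF K] by simp
      qed
    qed
  qed
  also have "\<dots> = (\<integral>x. f x \<partial>lebesgue_on \<Omega>)"
    using domain_lebesgue by (simp add: integral_restrict_space)
  finally show ?thesis .
qed

text \<open>Every facet shared by two cells is an interior face, and a conforming function is continuous there:
  this is the compatibility condition of the integration by parts.\<close>

lemma pw_gradient_weak:
  assumes u: "u \<in> P1_space \<Omega> \<T>"
  shows "is_weak_gradient \<Omega> u (pw_gradient u)"
  unfolding is_weak_gradient_def
proof (intro ballI)
  fix \<phi> b assume phi: "\<phi> \<in> test_functions \<Omega>" and b: "b \<in> (Basis :: 'a set)"
  note uP = P1_spaceD(1)[OF u]
  let ?d = "\<lambda>x. frechet_derivative \<phi> (at x) b"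
  have q: "on_cell u K x = on_cell u K 0 + gradient (on_cell u K) 0 \<bullet> x" if "K \<in> \<T>" for K x
    by (rule P1_expand[OF on_cell(1)[OF uP that]])
  have facet: "on_cell u K y = on_cell u L y"
    if "K \<in> \<T>" "L \<in> \<T>" "e facet_of K" "e facet_of L" "y \<in> e" for K L e y
  proof (cases "K = L")
    case False
    then have "e \<in> interior_faces \<T>" using facet_of_two_cells(2)[OF that(1,2) _ that(3,4)] by blast
    then show ?thesis by (rule P1_spaceD(2)[OF u _ that])
  qed simp
  note parts = cellwise_integration_by_parts[where q = "on_cell u" and \<alpha> = "\<lambda>K. on_cell u K 0"
      and \<beta> = "\<lambda>K. gradient (on_cell u K) 0", OF phi b q facet, folded pw_gradient_def]
  have inside: "(\<integral>x. g x \<partial>lebesgue_on \<Omega>) = (\<integral>x. g x \<partial>lborel)"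
    if "integrable lborel g" "\<And>x. x \<notin> \<Omega> \<Longrightarrow> g x = 0" for g :: "'a \<Rightarrow> real"
  proof -
    have "(\<integral>x. g x \<partial>lebesgue_on \<Omega>) = (\<integral>x. indicator \<Omega> x * g x \<partial>lebesgue)"
      using domain_lebesgue by (simp add: integral_restrict_space)
    also have "(\<lambda>x. indicator \<Omega> x * g x) = g" using that(2) by (intro ext) (auto simp: indicator_def)
    also have "(\<integral>x. g x \<partial>lebesgue) = (\<integral>x. g x \<partial>lborel)"
      using that(1) by (intro integral_completion) auto
    finally show ?thesis .
  qed
  have off: "cellwise (on_cell u) x = 0" "pw_gradient u x = 0" if "x \<notin> \<Omega>" for x
    unfolding pw_gradient_def using that cell_interior_subset by (auto intro!: cellwise_outside)
  have d_meas: "?d \<in> borel_measurable (lebesgue_on \<Omega>)"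
    using test_function_facts(3)[OF phi b] by (intro borel_imp_domain_measurable borel_measurable_continuous_onI)
  have cw_meas: "cellwise (on_cell u) \<in> borel_measurable (lebesgue_on \<Omega>)"
    using on_cell(1)[OF uP] by (intro borel_imp_domain_measurable cellwise_measurable P1_continuous)
  have u_meas: "u \<in> borel_measurable (lebesgue_on \<Omega>)" using uP PW.sub by (auto simp: L2_def)
  have "(\<integral>x. u x * ?d x \<partial>lebesgue_on \<Omega>) = (\<integral>x. cellwise (on_cell u) x * ?d x \<partial>lebesgue_on \<Omega>)"
    using AE_cellwise[OF uP] d_meas cw_meas u_meas
    by (intro integral_cong_AE borel_measurable_times) (auto elim: eventually_mono)
  also have "\<dots> = (\<integral>x. cellwise (on_cell u) x * ?d x \<partial>lborel)"
    using parts(2) off by (intro inside) auto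
  also have "\<dots> = - (\<integral>x. (pw_gradient u x \<bullet> b) * \<phi> x \<partial>lborel)" by (rule parts(1))
  also have "\<dots> = - (\<integral>x. (pw_gradient u x \<bullet> b) * \<phi> x \<partial>lebesgue_on \<Omega>)"
    using inside[OF parts(3)] off by simp
  finally show "(\<integral>x. u x * ?d x \<partial>lebesgue_on \<Omega>) = - (\<integral>x. (pw_gradient u x \<bullet> b) * \<phi> x \<partial>lebesgue_on \<Omega>)" .
qed

definition energy :: "('a \<Rightarrow> real) \<Rightarrow> ('a \<Rightarrow> real) \<Rightarrow> ('a \<Rightarrow> real) \<Rightarrow> ('a \<Rightarrow> real) \<Rightarrow> real" where
  "energy a c u v = (\<integral>x. a x * (pw_gradient u x \<bullet> pw_gradient v x) + c x * u x * v x \<partial>lebesgue_on \<Omega>)"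

context
  fixes a c :: "'a \<Rightarrow> real"
  assumes a: "a \<in> borel_measurable (lebesgue_on \<Omega>)" "bounded (a ` \<Omega>)"
    and c: "c \<in> borel_measurable (lebesgue_on \<Omega>)" "bounded (c ` \<Omega>)"
begin

lemma coefficient_bound:
  assumes "bounded (f ` \<Omega>)" obtains C where "\<And>x. x \<in> space (lebesgue_on \<Omega>) \<Longrightarrow> \<bar>f x\<bar> \<le> (C::real)"
  using assms that by (auto simp: bounded_iff)

lemma energy_integrable:
  assumes "u \<in> PW" "v \<in> PW"
  shows "integrable (lebesgue_on \<Omega>) (\<lambda>x. a x * (pw_gradient u x \<bullet> pw_gradient v x))"
    and "integrable (lebesgue_on \<Omega>) (\<lambda>x. c x * u x * v x)"
proof -
  obtain A where A: "\<And>x. x \<in> space (lebesgue_on \<Omega>) \<Longrightarrow> \<bar>a x\<bar> \<le> A" using coefficient_bound a(2) by blast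
  obtain C where C: "\<And>x. x \<in> space (lebesgue_on \<Omega>) \<Longrightarrow> \<bar>c x\<bar> \<le> C" using coefficient_bound c(2) by blast
  obtain M N where M: "\<And>x. norm (pw_gradient u x) \<le> M" and N: "\<And>x. norm (pw_gradient v x) \<le> N"
    using pw_gradient_bounded by metis
  have g: "pw_gradient w \<in> borel_measurable (lebesgue_on \<Omega>)" for w
    by (rule borel_imp_domain_measurable[OF pw_gradient_measurable])
  show "integrable (lebesgue_on \<Omega>) (\<lambda>x. a x * (pw_gradient u x \<bullet> pw_gradient v x))"
  proof (rule finite_measure.integrable_const_bound[OF finite_measure_domain, of _ "\<bar>A\<bar> * (M * N)"])
    show "AE x in lebesgue_on \<Omega>. norm (a x * (pw_gradient u x \<bullet> pw_gradient v x)) \<le> \<bar>A\<bar> * (M * N)"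
    proof (rule AE_I2)
      fix x assume x: "x \<in> space (lebesgue_on \<Omega>)"
      have "\<bar>pw_gradient u x \<bullet> pw_gradient v x\<bar> \<le> M * N"
        using Cauchy_Schwarz_ineq2[of "pw_gradient u x" "pw_gradient v x"] mult_mono[OF M N, of x x]
          norm_ge_zero[of "pw_gradient u x"] M[of x] by (smt (verit) norm_ge_zero)
      moreover have "\<bar>a x\<bar> \<le> \<bar>A\<bar>" using A[OF x] by simp
      ultimately show "norm (a x * (pw_gradient u x \<bullet> pw_gradient v x)) \<le> \<bar>A\<bar> * (M * N)"
        by (simp add: abs_mult mult_mono)
    qed
    show "(\<lambda>x. a x * (pw_gradient u x \<bullet> pw_gradient v x)) \<in> borel_measurable (lebesgue_on \<Omega>)"
      by (intro borel_measurable_times a borel_measurable_inner g)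
  qed
  show "integrable (lebesgue_on \<Omega>) (\<lambda>x. c x * u x * v x)"
  proof (rule Bochner_Integration.integrable_bound)
    show "integrable (lebesgue_on \<Omega>) (\<lambda>x. \<bar>C\<bar> * (u x * v x))"
      using PW.product_integrable[OF assms] by simp
    show "(\<lambda>x. c x * u x * v x) \<in> borel_measurable (lebesgue_on \<Omega>)"
      using assms PW.sub c by (intro borel_measurable_times) (auto simp: L2_def)
    show "AE x in lebesgue_on \<Omega>. norm (c x * u x * v x) \<le> norm (\<bar>C\<bar> * (u x * v x))"
    proof (rule AE_I2)
      fix x assume x: "x \<in> space (lebesgue_on \<Omega>)"
      have "\<bar>c x\<bar> \<le> \<bar>C\<bar>" using C[OF x] by simp
      then show "norm (c x * u x * v x) \<le> norm (\<bar>C\<bar> * (u x * v x))"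
        by (simp add: abs_mult mult.assoc mult_right_mono)
    qed
  qed
qed

lemma energy_lin:
  assumes "u \<in> PW" "v \<in> PW" "w \<in> PW"
  shows "energy a c (\<lambda>x. \<alpha> * u x + \<beta> * v x) w = \<alpha> * energy a c u w + \<beta> * energy a c v w"
proof -
  let ?f = "\<lambda>u x. a x * (pw_gradient u x \<bullet> pw_gradient w x) + c x * u x * w x"
  have "?f (\<lambda>x. \<alpha> * u x + \<beta> * v x) x = \<alpha> * ?f u x + \<beta> * ?f v x" for x
    unfolding pw_gradient_lin[OF assms(1,2)] by (simp add: inner_add_left algebra_simps)
  then have "energy a c (\<lambda>x. \<alpha> * u x + \<beta> * v x) w = (\<integral>x. \<alpha> * ?f u x + \<beta> * ?f v x \<partial>lebesgue_on \<Omega>)"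
    unfolding energy_def by (rule arg_cong[where f = "integral\<^sup>L (lebesgue_on \<Omega>)", OF ext])
  also have "\<dots> = \<alpha> * energy a c u w + \<beta> * energy a c v w"
    unfolding energy_def using energy_integrable[OF assms(1,3)] energy_integrable[OF assms(2,3)]
    by (subst Bochner_Integration.integral_add) (auto simp del: ring_distribs)
  finally show ?thesis .
qed

lemma energy_null:
  assumes "u \<in> PW" "AE x in lebesgue_on \<Omega>. u x = 0"
  shows "energy a c u w = 0"
proof -
  have "gradient (on_cell u K) 0 = 0" if "K \<in> \<T>" for K
    unfolding on_cell_null[OF assms(1) that assms(2)] by (rule P1_gradient[where \<alpha> = 0]) simp
  then have "pw_gradient u x = 0" for x by (simp add: pw_gradient_def cellwise_def)
  then show ?thesis unfolding energy_def using assms(2)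
    by (intro integral_eq_zero_AE) (auto elim: eventually_mono)
qed

lemma PCR_form_eq:
  assumes "u \<in> PW" "v \<in> PW"
  shows "PCR_form \<Omega> \<T> lab a c \<gamma> u v = energy a c u v + \<gamma> * penalty lab u v"
proof -
  have "(\<Sum>K\<in>\<T>. \<integral>x. a x * (gradient (on_cell u K) x \<bullet> gradient (on_cell v K) x)
                  + c x * u x * v x \<partial>lebesgue_on K) = energy a c u v"
    unfolding energy_def using energy_integrable[OF assms] assms
    by (intro sum_over_cells) (auto simp: pw_gradient_interior)
  then show ?thesis by (simp add: PCR_form_def penalty_def)
qed

lemma cont_form_eq:
  assumes "u \<in> P1_space \<Omega> \<T>" "v \<in> P1_space \<Omega> \<T>"
  shows "cont_form \<Omega> a c u v = energy a c u v"
proof -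
  have wg: "AE x in lebesgue_on \<Omega>. weak_gradient \<Omega> w x = pw_gradient w x"
      "weak_gradient \<Omega> w \<in> borel_measurable (lebesgue_on \<Omega>)" if "w \<in> P1_space \<Omega> \<T>" for w
  proof -
    note pw = pw_gradient_L2 pw_gradient_weak[OF that]
    note wg = weak_gradient_chosen[OF pw]
    show "AE x in lebesgue_on \<Omega>. weak_gradient \<Omega> w x = pw_gradient w x"
      by (rule weak_gradient_unique[OF open_domain domain(2) wg pw])
    show "weak_gradient \<Omega> w \<in> borel_measurable (lebesgue_on \<Omega>)" using wg(1) by (simp add: L2_def)
  qed
  have g: "pw_gradient w \<in> borel_measurable (lebesgue_on \<Omega>)" for w
    by (rule borel_imp_domain_measurable[OF pw_gradient_measurable])
  have uv: "u \<in> borel_measurable (lebesgue_on \<Omega>)" "v \<in> borel_measurable (lebesgue_on \<Omega>)"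
    using assms P1_spaceD(1) PW.sub by (auto simp: L2_def)
  show ?thesis unfolding cont_form_def energy_def
  proof (rule integral_cong_AE)
    show "AE x in lebesgue_on \<Omega>. a x * (weak_gradient \<Omega> u x \<bullet> weak_gradient \<Omega> v x) + c x * u x * v x =
        a x * (pw_gradient u x \<bullet> pw_gradient v x) + c x * u x * v x"
      using wg(1)[OF assms(1)] wg(1)[OF assms(2)] by eventually_elim simp
  qed (intro borel_measurable_add borel_measurable_times borel_measurable_inner a c g uv wg(2) assms)+
qed

end

end

theorem theorem2p2:
  fixes \<Omega> :: "'a::euclidean_space set"
    and \<T> :: "'a set set"
    and lab :: "'a set \<Rightarrow> nat"
    and a c :: "'a \<Rightarrow> real"
    and C \<sigma> :: real
    and i :: nat
  assumes dim: "DIM('a) = 2 \<or> DIM('a) = 3"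
    and domain: "polyhedral_domain \<Omega>" "bounded \<Omega>"
    and mesh: "simplicial_mesh \<Omega> \<T>" "shape_regular \<sigma> \<T>" "inj_on lab \<T>"
    and coeff_a: "a \<in> borel_measurable (lebesgue_on \<Omega>)" "bounded (a ` \<Omega>)"
    and coeff_c: "c \<in> borel_measurable (lebesgue_on \<Omega>)" "bounded (c ` \<Omega>)"
    and C_pos: "C > 0"
    and form_symmetric: "\<forall>u\<in>H10 \<Omega>. \<forall>v\<in>H10 \<Omega>. cont_form \<Omega> a c u v = cont_form \<Omega> a c v u"
    and form_bounded: "\<forall>u\<in>H10 \<Omega>. \<forall>v\<in>H10 \<Omega>.
          \<bar>cont_form \<Omega> a c u v\<bar> \<le> C * H1_norm \<Omega> u * H1_norm \<Omega> v"
    and form_coercive: "\<forall>v\<in>H10 \<Omega>. (H1_norm \<Omega> v)\<^sup>2 \<le> C * cont_form \<Omega> a c v v"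
    and index: "1 \<le> i" "i \<le> L2_dim \<Omega> (CR_space \<Omega> \<T> lab)"
  shows "(i \<le> L2_dim \<Omega> (P1_space \<Omega> \<T>) \<longrightarrow>
            ((\<lambda>\<gamma>. nth_eigenvalue \<Omega> (CR_space \<Omega> \<T> lab) (PCR_form \<Omega> \<T> lab a c \<gamma>) i)
              \<longlongrightarrow> nth_eigenvalue \<Omega> (P1_space \<Omega> \<T>) (cont_form \<Omega> a c) i) at_top) \<and>
         (i > L2_dim \<Omega> (P1_space \<Omega> \<T>) \<longrightarrow>
            filterlim (\<lambda>\<gamma>. nth_eigenvalue \<Omega> (CR_space \<Omega> \<T> lab) (PCR_form \<Omega> \<T> lab a c \<gamma>) i)
              at_top at_top)"
proof -
  interpret mesh \<Omega> \<T> using domain mesh(1) by unfold_locales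
  note lab = mesh(3)
  let ?V = "CR_space \<Omega> \<T> lab" and ?W = "P1_space \<Omega> \<T>"
  have VPW: "?V \<subseteq> PW" by (auto simp: CR_space_def)
  have WV: "?W \<subseteq> ?V" by (rule P1_subset_CR[OF lab])
  interpret V: L2_subspace \<Omega> ?V by (rule CR_subspace[OF lab])
  have AE_null: "AE x in lebesgue_on \<Omega>. u x = 0" if "u \<in> PW" "L2_inner \<Omega> u u = 0" for u
    using PW.ip_zero_iff that by blast
  have energy_form: "V.form (energy a c)"
    unfolding V.form_def
  proof (intro conjI ballI allI impI)
    show "energy a c u v = energy a c v u" for u v
      by (simp add: energy_def inner_commute mult.commute mult.left_commute)
  next
    fix u v w \<alpha> \<beta> assume "u \<in> ?V" "v \<in> ?V" "w \<in> ?V"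
    then show "energy a c (\<lambda>x. \<alpha> * u x + \<beta> * v x) w = \<alpha> * energy a c u w + \<beta> * energy a c v w"
      using VPW by (intro energy_lin[OF coeff_a coeff_c]) auto
  next
    fix u w assume "u \<in> ?V" "w \<in> ?V" "L2_inner \<Omega> u u = 0"
    then show "energy a c u w = 0"
      using VPW by (intro energy_null[OF coeff_a coeff_c] AE_null) auto
  qed
  have penalty_form: "V.form (penalty lab)"
    unfolding V.form_def
  proof (intro conjI ballI allI impI)
    show "penalty lab u v = penalty lab v u" for u v
      by (simp add: penalty_def mult.commute)
  next
    fix u v w \<alpha> \<beta> assume "u \<in> ?V" "v \<in> ?V" "w \<in> ?V"
    then show "penalty lab (\<lambda>x. \<alpha> * u x + \<beta> * v x) w = \<alpha> * penalty lab u w + \<beta> * penalty lab v w"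
      using VPW by (intro penalty_lin[OF lab]) auto
  next
    fix u w assume "u \<in> ?V" "w \<in> ?V" "L2_inner \<Omega> u u = 0"
    then show "penalty lab u w = 0"
      using VPW by (intro penalty_null[OF lab] AE_null) auto
  qed
  have "m \<le> card (\<T> \<times> insert 0 (Basis :: 'a set))" if "V.orthonormal m f" for m f
    using that VPW by (intro orthonormal_bounded[of m f]) (auto simp: V.orthonormal_def PW.orthonormal_def)
  then obtain N u where onb: "V.onb N u" using V.onb_exists by blast
  have eigenvalue: "nth_eigenvalue \<Omega> ?V (PCR_form \<Omega> \<T> lab a c \<gamma>) i
      = nth_eigenvalue \<Omega> ?V (\<lambda>v w. energy a c v w + \<gamma> * penalty lab v w) i" for \<gamma>
    using VPW by (intro nth_eigenvalue_cong PCR_form_eq[OF coeff_a coeff_c]) auto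
  have kernel: "penalty lab v v = 0 \<longleftrightarrow> v \<in> ?W" if "v \<in> ?V" for v
    using that VPW by (intro penalty_zero_iff[OF lab]) auto
  note limit = penalized_eigenvalue_limit[OF V.L2_subspace_axioms P1_subspace[OF lab] WV onb energy_form penalty_form
      penalty_nonneg kernel cont_form_eq[OF coeff_a coeff_c] index]
  show ?thesis
    unfolding eigenvalue by (intro conjI impI limit) simp_all
qed

end
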